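(* Let $\mathcal{A}$ be an abelian length category, let $\lambda$ be a length function on $\mathcal{A}$ with associated Gabriel--Roiter measure $\mu_\lambda$, and let $X$ be an object of $\mathcal{A}$. Define recursively $X_1=X$ and $X_{i+1}=X_i/\operatorname{Rej}\left(X_i,\mathcal{A}(<\mu_\lambda(X_i))\right)$ for $i\in\mathbb{N}$. Let $\ell\in\mathbb{N}_0$ be the smallest integer with $X_{\ell+1}=0$ (it exists), and put $\mathcal{C}_i=\operatorname{add}\left(\bigoplus_{j\ge i}X_j\right)$. Then $$0=\mathcal{C}_{\ell+1}\subset\mathcal{C}_\ell\subset\cdots\subset\mathcal{C}_1$$ is a left complete total rejective chain of subcategories of $\mathcal{A}$.
   Context: $\mathbb{N}=\{1,2,\dots\}$, $\mathbb{N}_0=\mathbb{N}\cup\{0\}$; $\subset$ denotes strict inclusion. Categories are locally small. $\operatorname{add}X$ is the full subcategory of direct summands of finite direct sums of copies of $X$. All subcategories are full and closed under isomorphisms, finite direct sums and direct summands. **Abelian length category.** An abelian category in which every object satisfies the ascending and descending chain conditions on subobjects and in which the isomorphism classes of indecomposable objects form a set. $\operatorname{ind}\mathcal{A}$ is a set of representatives of these classes. **Length function.** A map $\lambda$ from the objects of $\mathcal{A}$ to $[0,+\infty[$ with $\lambda(X)=0$ if and only if $X=0$, and $\lambda(Y_2)=\lambda(Y_1)+\lambda(Y_3)$ for every short exact sequence $0\to Y_1\to Y_2\to Y_3\to 0$. **Gabriel--Roiter measure associated to $\lambda$.** Totally order the finite subsets of $[0,+\infty[$ by: for $I\neq J$,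 $I<J$ if $\min((I\setminus J)\cup(J\setminus I))\in J$. For $Y$ indecomposable, $\mu_\lambda(Y)$ is the maximum, in this order, of the sets $\{\lambda(Y_1),\dots,\lambda(Y_t)\}$ where $Y_1\subset\cdots\subset Y_t$ is a chain (strict inclusions) of indecomposable subobjects of $Y$. For general objects, $\mu_\lambda(\bigoplus_{i=1}^tY_i)=\max\{\mu_\lambda(Y_i)\mid i=1,\dots,t\}$ for $Y_i$ indecomposable (so $\mu_\lambda(0)=\emptyset$). For a finite set $I\subseteq[0,+\infty[$, $\mathcal{A}(<I)$ is the set of all $Y\in\operatorname{ind}\mathcal{A}$ with $\mu_\lambda(Y)<I$. **Reject.** For a set $\Theta$ of objects, $\operatorname{Rej}(X,\Theta)$ is the subobject of $X$ given by the intersection of $\operatorname{Ker}f$ over all $f\in\operatorname{Hom}_{\mathcal{A}}(X,T)$, $T\in\Theta$ (it exists in $\mathcal{A}$). **Left rejective subcategory.** For a subcategory $\mathcal{C}'$ of $\mathcal{C}$, a left $\mathcal{C}'$-approximation of $X\in\mathcal{C}$ is a morphism $f:X\to X'$ with $X'\in\mathcal{C}'$ such that every morphism $X\to X''$ with $X''\in\mathcal{C}'$ factors through $f$. $\mathcal{C}'$ is left rejective in $\mathcal{C}$ if every $X\in\mathcal{C}$ has a left $\mathcal{C}'$-approximation which is an epimorphism in $\mathcal{C}$. **Left complete total rejective chain.** A chain $0=\mathcal{C}_{\ell+1}\subset\mathcal{C}_\ell\subset\cdots\subset\mathcal{C}_1$ of proper inclusions of subcategories of $\mathcal{A}$ such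 that, for every $1\le i\le\ell$, $\mathcal{C}_i$ is a left rejective subcategory of $\mathcal{C}_1$ and every nonisomorphism between indecomposable objects in $\mathcal{C}_i$ factors through an object in $\mathcal{C}_{i+1}$. *)

theory Defs
  imports Complex_Main "HOL-Algebra.Group"
begin

section \<open>Abelian length categories\<close>

text \<open>
  Objects and arrows are carrier sets of arbitrary types, so the objects (hence the isomorphism
  classes of indecomposable objects) and all hom-sets automatically form sets.
  \<open>Add\<close> and \<open>Zero X Y\<close> are the addition of parallel arrows and the zero arrow from \<open>X\<close> to \<open>Y\<close>.
\<close>

record ('o, 'm) additive_cat =
  Obj :: "'o set"
  Arr :: "'m set"
  Dom :: "'m \<Rightarrow> 'o"
  Cod :: "'m \<Rightarrow> 'o"
  Id :: "'o \<Rightarrow> 'm"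
  Comp :: "'m \<Rightarrow> 'm \<Rightarrow> 'm"  (infixr "\<cdot>\<index>" 70)
  Add :: "'m \<Rightarrow> 'm \<Rightarrow> 'm"
  Zero :: "'o \<Rightarrow> 'o \<Rightarrow> 'm"

definition homs :: "('o, 'm) additive_cat \<Rightarrow> 'o \<Rightarrow> 'o \<Rightarrow> 'm set" where
  "homs C X Y = {f \<in> Arr C. Dom C f = X \<and> Cod C f = Y}"

definition hom_group :: "('o, 'm) additive_cat \<Rightarrow> 'o \<Rightarrow> 'o \<Rightarrow> 'm monoid" where
  "hom_group C X Y = \<lparr>carrier = homs C X Y, monoid.mult = Add C, one = Zero C X Y\<rparr>"

locale category =
  fixes C :: "('o, 'm) additive_cat" (structure)
  assumes Dom_Obj: "f \<in> Arr C \<Longrightarrow> Dom C f \<in> Obj C"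
    and Cod_Obj: "f \<in> Arr C \<Longrightarrow> Cod C f \<in> Obj C"
    and Id_homs: "X \<in> Obj C \<Longrightarrow> Id C X \<in> homs C X X"
    and Comp_homs: "f \<in> homs C X Y \<Longrightarrow> g \<in> homs C Y Z \<Longrightarrow> g \<cdot> f \<in> homs C X Z"
    and Comp_assoc: "f \<in> homs C W X \<Longrightarrow> g \<in> homs C X Y \<Longrightarrow> h \<in> homs C Y Z \<Longrightarrow>
      (h \<cdot> g) \<cdot> f = h \<cdot> (g \<cdot> f)"
    and Comp_Id_left: "f \<in> homs C X Y \<Longrightarrow> Id C Y \<cdot> f = f"
    and Comp_Id_right: "f \<in> homs C X Y \<Longrightarrow> f \<cdot> Id C X = f"

locale preadditive_category = category +
  assumes hom_comm_group: "X \<in> Obj C \<Longrightarrow> Y \<in> Obj C \<Longrightarrow> comm_group (hom_group C X Y)"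
    and Comp_Add_left: "f \<in> homs C X Y \<Longrightarrow> g \<in> homs C Y Z \<Longrightarrow> h \<in> homs C Y Z \<Longrightarrow>
      Add C g h \<cdot> f = Add C (g \<cdot> f) (h \<cdot> f)"
    and Comp_Add_right: "f \<in> homs C X Y \<Longrightarrow> g \<in> homs C X Y \<Longrightarrow> h \<in> homs C Y Z \<Longrightarrow>
      h \<cdot> Add C f g = Add C (h \<cdot> f) (h \<cdot> g)"

definition monic :: "('o, 'm) additive_cat \<Rightarrow> 'm \<Rightarrow> bool" where
  "monic C m \<longleftrightarrow> m \<in> Arr C \<and>
    (\<forall>Z\<in>Obj C. \<forall>u\<in>homs C Z (Dom C m). \<forall>v\<in>homs C Z (Dom C m).
      m \<cdot>\<^bsub>C\<^esub> u = m \<cdot>\<^bsub>C\<^esub> v \<longrightarrow> u = v)"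

text \<open>Epimorphism in the full subcategory on a set \<open>D\<close> of objects.\<close>

definition epic_in :: "('o, 'm) additive_cat \<Rightarrow> 'o set \<Rightarrow> 'm \<Rightarrow> bool" where
  "epic_in C D f \<longleftrightarrow> f \<in> Arr C \<and> Dom C f \<in> D \<and> Cod C f \<in> D \<and>
    (\<forall>Z\<in>D. \<forall>u\<in>homs C (Cod C f) Z. \<forall>v\<in>homs C (Cod C f) Z.
      u \<cdot>\<^bsub>C\<^esub> f = v \<cdot>\<^bsub>C\<^esub> f \<longrightarrow> u = v)"

abbreviation epic :: "('o, 'm) additive_cat \<Rightarrow> 'm \<Rightarrow> bool" where
  "epic C f \<equiv> epic_in C (Obj C) f"

definition isomorphism :: "('o, 'm) additive_cat \<Rightarrow> 'm \<Rightarrow> bool" where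
  "isomorphism C f \<longleftrightarrow> f \<in> Arr C \<and>
    (\<exists>g\<in>homs C (Cod C f) (Dom C f).
      g \<cdot>\<^bsub>C\<^esub> f = Id C (Dom C f) \<and> f \<cdot>\<^bsub>C\<^esub> g = Id C (Cod C f))"

definition isomorphic :: "('o, 'm) additive_cat \<Rightarrow> 'o \<Rightarrow> 'o \<Rightarrow> bool" where
  "isomorphic C X Y \<longleftrightarrow> (\<exists>f\<in>homs C X Y. isomorphism C f)"

definition zero_object :: "('o, 'm) additive_cat \<Rightarrow> 'o \<Rightarrow> bool" where
  "zero_object C Z \<longleftrightarrow> Z \<in> Obj C \<and>
    (\<forall>X\<in>Obj C. (\<exists>!f. f \<in> homs C X Z) \<and> (\<exists>!f. f \<in> homs C Z X))"

definition is_kernel :: "('o, 'm) additive_cat \<Rightarrow> 'm \<Rightarrow> 'm \<Rightarrow> bool" where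
  "is_kernel C k f \<longleftrightarrow> k \<in> Arr C \<and> f \<in> Arr C \<and> Cod C k = Dom C f \<and>
    f \<cdot>\<^bsub>C\<^esub> k = Zero C (Dom C k) (Cod C f) \<and>
    (\<forall>Z\<in>Obj C. \<forall>g\<in>homs C Z (Dom C f). f \<cdot>\<^bsub>C\<^esub> g = Zero C Z (Cod C f) \<longrightarrow>
      (\<exists>!h. h \<in> homs C Z (Dom C k) \<and> k \<cdot>\<^bsub>C\<^esub> h = g))"

definition is_cokernel :: "('o, 'm) additive_cat \<Rightarrow> 'm \<Rightarrow> 'm \<Rightarrow> bool" where
  "is_cokernel C q f \<longleftrightarrow> q \<in> Arr C \<and> f \<in> Arr C \<and> Dom C q = Cod C f \<and>
    q \<cdot>\<^bsub>C\<^esub> f = Zero C (Dom C f) (Cod C q) \<and>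
    (\<forall>Z\<in>Obj C. \<forall>g\<in>homs C (Cod C f) Z. g \<cdot>\<^bsub>C\<^esub> f = Zero C (Dom C f) Z \<longrightarrow>
      (\<exists>!h. h \<in> homs C (Cod C q) Z \<and> h \<cdot>\<^bsub>C\<^esub> q = g))"

definition short_exact :: "('o, 'm) additive_cat \<Rightarrow> 'm \<Rightarrow> 'm \<Rightarrow> bool" where
  "short_exact C f g \<longleftrightarrow> is_kernel C f g \<and> is_cokernel C g f"

text \<open>
  Direct sums are coproducts. In a preadditive category with a zero object, finite coproducts
  are the same as finite biproducts. The index set may be infinite.
\<close>

definition direct_sum :: "('o, 'm) additive_cat \<Rightarrow> 'o \<Rightarrow> nat set \<Rightarrow> (nat \<Rightarrow> 'o) \<Rightarrow> bool" where
  "direct_sum C S I F \<longleftrightarrow> S \<in> Obj C \<and>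
    (\<exists>\<iota>. (\<forall>i\<in>I. \<iota> i \<in> homs C (F i) S) \<and>
      (\<forall>Z\<in>Obj C. \<forall>g. (\<forall>i\<in>I. g i \<in> homs C (F i) Z) \<longrightarrow>
        (\<exists>!h. h \<in> homs C S Z \<and> (\<forall>i\<in>I. h \<cdot>\<^bsub>C\<^esub> \<iota> i = g i))))"

definition direct_sum_list :: "('o, 'm) additive_cat \<Rightarrow> 'o \<Rightarrow> 'o list \<Rightarrow> bool" where
  "direct_sum_list C S Ys \<longleftrightarrow> direct_sum C S {..<length Ys} (\<lambda>i. Ys ! i)"

locale abelian_category = preadditive_category +
  assumes ex_zero_object: "\<exists>Z. zero_object C Z"
    and ex_direct_sum: "X \<in> Obj C \<Longrightarrow> Y \<in> Obj C \<Longrightarrow> \<exists>S. direct_sum_list C S [X, Y]"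
    and ex_kernel: "f \<in> Arr C \<Longrightarrow> \<exists>k. is_kernel C k f"
    and ex_cokernel: "f \<in> Arr C \<Longrightarrow> \<exists>q. is_cokernel C q f"
    and monic_is_kernel: "monic C m \<Longrightarrow> \<exists>f. is_kernel C m f"
    and epic_is_cokernel: "epic C q \<Longrightarrow> \<exists>f. is_cokernel C q f"

text \<open>
  Subobjects of \<open>X\<close> are represented by monomorphisms into \<open>X\<close>, preordered by \<open>sub_le\<close>;
  two of them represent the same subobject iff each factors through the other.
\<close>

definition subobject :: "('o, 'm) additive_cat \<Rightarrow> 'm \<Rightarrow> 'o \<Rightarrow> bool" where
  "subobject C m X \<longleftrightarrow> monic C m \<and> Cod C m = X"

definition sub_le :: "('o, 'm) additive_cat \<Rightarrow> 'm \<Rightarrow> 'm \<Rightarrow> bool" where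
  "sub_le C m n \<longleftrightarrow> (\<exists>h\<in>homs C (Dom C m) (Dom C n). n \<cdot>\<^bsub>C\<^esub> h = m)"

definition sub_less :: "('o, 'm) additive_cat \<Rightarrow> 'm \<Rightarrow> 'm \<Rightarrow> bool" where
  "sub_less C m n \<longleftrightarrow> sub_le C m n \<and> \<not> sub_le C n m"

locale abelian_length_category = abelian_category +
  assumes acc: "X \<in> Obj C \<Longrightarrow> (\<And>i::nat. subobject C (m i) X) \<Longrightarrow>
      (\<And>i. sub_le C (m i) (m (Suc i))) \<Longrightarrow> \<exists>N. \<forall>i\<ge>N. sub_le C (m i) (m N)"
    and dcc: "X \<in> Obj C \<Longrightarrow> (\<And>i::nat. subobject C (m i) X) \<Longrightarrow>
      (\<And>i. sub_le C (m (Suc i)) (m i)) \<Longrightarrow> \<exists>N. \<forall>i\<ge>N. sub_le C (m N) (m i)"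

definition indecomposable :: "('o, 'm) additive_cat \<Rightarrow> 'o \<Rightarrow> bool" where
  "indecomposable C Y \<longleftrightarrow> Y \<in> Obj C \<and> \<not> zero_object C Y \<and>
    (\<forall>U V. direct_sum_list C Y [U, V] \<longrightarrow> zero_object C U \<or> zero_object C V)"

definition ind_representatives :: "('o, 'm) additive_cat \<Rightarrow> 'o set \<Rightarrow> bool" where
  "ind_representatives C R \<longleftrightarrow> (\<forall>Y\<in>R. indecomposable C Y) \<and>
    (\<forall>Y. indecomposable C Y \<longrightarrow> (\<exists>!Z. Z \<in> R \<and> isomorphic C Y Z))"


section \<open>Length functions and the Gabriel--Roiter measure\<close>

definition length_function :: "('o, 'm) additive_cat \<Rightarrow> ('o \<Rightarrow> real) \<Rightarrow> bool" where
  "length_function C lam \<longleftrightarrow>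
    (\<forall>X\<in>Obj C. lam X \<ge> 0 \<and> (lam X = 0 \<longleftrightarrow> zero_object C X)) \<and>
    (\<forall>f g. short_exact C f g \<longrightarrow> lam (Cod C f) = lam (Dom C f) + lam (Cod C g))"

definition gr_less :: "real set \<Rightarrow> real set \<Rightarrow> bool" where
  "gr_less I J \<longleftrightarrow> I \<noteq> J \<and> Min ((I - J) \<union> (J - I)) \<in> J"

definition gr_is_max :: "real set set \<Rightarrow> real set \<Rightarrow> bool" where
  "gr_is_max \<S> I \<longleftrightarrow> I \<in> \<S> \<and> (\<forall>J\<in>\<S>. J = I \<or> gr_less J I)"

definition ind_chain :: "('o, 'm) additive_cat \<Rightarrow> 'o \<Rightarrow> 'm list \<Rightarrow> bool" where
  "ind_chain C Y ms \<longleftrightarrow> ms \<noteq> [] \<and>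
    (\<forall>m\<in>set ms. subobject C m Y \<and> indecomposable C (Dom C m)) \<and> sorted_wrt (sub_less C) ms"

definition gr_measure_ind :: "('o, 'm) additive_cat \<Rightarrow> ('o \<Rightarrow> real) \<Rightarrow> 'o \<Rightarrow> real set" where
  "gr_measure_ind C lam Y =
    (THE I. gr_is_max {(\<lambda>m. lam (Dom C m)) ` set ms | ms. ind_chain C Y ms} I)"

text \<open>
  The empty set is the least element of the order, so inserting it only affects the
  empty direct sum: the measure of a zero object is the empty set.
\<close>

definition gr_measure :: "('o, 'm) additive_cat \<Rightarrow> ('o \<Rightarrow> real) \<Rightarrow> 'o \<Rightarrow> real set" where
  "gr_measure C lam X =
    (THE I. \<exists>Ys. (\<forall>Y\<in>set Ys. indecomposable C Y) \<and> direct_sum_list C X Ys \<and>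
      gr_is_max (insert {} (gr_measure_ind C lam ` set Ys)) I)"

text \<open>\<open>R\<close> is a set of representatives of the isomorphism classes of indecomposable objects.\<close>

definition gr_below ::
  "('o, 'm) additive_cat \<Rightarrow> ('o \<Rightarrow> real) \<Rightarrow> 'o set \<Rightarrow> real set \<Rightarrow> 'o set" where
  "gr_below C lam R I = {Y \<in> R. gr_less (gr_measure C lam Y) I}"


section \<open>Rejects and the sequence of quotients\<close>

text \<open>
  The intersection of a family \<open>K\<close> of subobjects of \<open>X\<close>: an arrow into \<open>X\<close> factors through it iff
  it factors through every member of \<open>K\<close>. The empty intersection is \<open>X\<close>.
\<close>

definition is_intersection :: "('o, 'm) additive_cat \<Rightarrow> 'm \<Rightarrow> 'o \<Rightarrow> 'm set \<Rightarrow> bool" where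
  "is_intersection C r X K \<longleftrightarrow> subobject C r X \<and> (\<forall>k\<in>K. sub_le C r k) \<and>
    (\<forall>g\<in>Arr C. Cod C g = X \<and> (\<forall>k\<in>K. sub_le C g k) \<longrightarrow> sub_le C g r)"

definition is_reject :: "('o, 'm) additive_cat \<Rightarrow> 'm \<Rightarrow> 'o \<Rightarrow> 'o set \<Rightarrow> bool" where
  "is_reject C r X \<Theta> \<longleftrightarrow> is_intersection C r X {k. \<exists>T\<in>\<Theta>. \<exists>f\<in>homs C X T. is_kernel C k f}"

text \<open>
  \<open>Q\<close> is a quotient \<open>X / Rej(X, \<Theta>)\<close>, which is only determined up to isomorphism.
\<close>

definition reject_quotient :: "('o, 'm) additive_cat \<Rightarrow> 'o \<Rightarrow> 'o set \<Rightarrow> 'o \<Rightarrow> bool" where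
  "reject_quotient C X \<Theta> Q \<longleftrightarrow> (\<exists>r q. is_reject C r X \<Theta> \<and> is_cokernel C q r \<and> Cod C q = Q)"

text \<open>The sequence is indexed from 1; its value at 0 is irrelevant.\<close>

definition gr_reject_sequence ::
  "('o, 'm) additive_cat \<Rightarrow> ('o \<Rightarrow> real) \<Rightarrow> 'o set \<Rightarrow> 'o \<Rightarrow> (nat \<Rightarrow> 'o) \<Rightarrow> bool" where
  "gr_reject_sequence C lam R X Xs \<longleftrightarrow> Xs 1 = X \<and>
    (\<forall>i\<ge>1. reject_quotient C (Xs i) (gr_below C lam R (gr_measure C lam (Xs i))) (Xs (i + 1)))"


section \<open>Subcategories and rejective chains\<close>

text \<open>
  Full subcategories are given by their sets of objects. A direct sum of a list of length 0
  is a zero object, and a direct sum of a list of length 1 is an isomorphic object.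
\<close>

definition direct_summand :: "('o, 'm) additive_cat \<Rightarrow> 'o \<Rightarrow> 'o \<Rightarrow> bool" where
  "direct_summand C Z S \<longleftrightarrow> (\<exists>W. direct_sum_list C S [Z, W])"

definition subcategory :: "('o, 'm) additive_cat \<Rightarrow> 'o set \<Rightarrow> bool" where
  "subcategory C D \<longleftrightarrow> D \<subseteq> Obj C \<and>
    (\<forall>X\<in>D. \<forall>Y. isomorphic C X Y \<longrightarrow> Y \<in> D) \<and>
    (\<forall>Ys S. set Ys \<subseteq> D \<and> direct_sum_list C S Ys \<longrightarrow> S \<in> D) \<and>
    (\<forall>S\<in>D. \<forall>Z. direct_summand C Z S \<longrightarrow> Z \<in> D)"

definition add_closure :: "('o, 'm) additive_cat \<Rightarrow> 'o \<Rightarrow> 'o set" where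
  "add_closure C X =
    {Z. \<exists>n S. direct_sum_list C S (replicate n X) \<and> direct_summand C Z S}"

text \<open>
  \<open>add\<close> of the direct sum of all \<open>Xs j\<close> with \<open>j \<ge> i\<close>; it does not depend on the choice of the
  direct sum \<open>S\<close>.
\<close>

definition add_tail :: "('o, 'm) additive_cat \<Rightarrow> (nat \<Rightarrow> 'o) \<Rightarrow> nat \<Rightarrow> 'o set" where
  "add_tail C Xs i = {Z. \<exists>S. direct_sum C S {i..} Xs \<and> Z \<in> add_closure C S}"

definition left_approximation :: "('o, 'm) additive_cat \<Rightarrow> 'o set \<Rightarrow> 'o \<Rightarrow> 'm \<Rightarrow> bool" where
  "left_approximation C D' X f \<longleftrightarrow> f \<in> Arr C \<and> Dom C f = X \<and> Cod C f \<in> D' \<and>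
    (\<forall>X''\<in>D'. \<forall>g\<in>homs C X X''. \<exists>h\<in>homs C (Cod C f) X''. h \<cdot>\<^bsub>C\<^esub> f = g)"

definition left_rejective :: "('o, 'm) additive_cat \<Rightarrow> 'o set \<Rightarrow> 'o set \<Rightarrow> bool" where
  "left_rejective C D' D \<longleftrightarrow> D' \<subseteq> D \<and>
    (\<forall>X\<in>D. \<exists>f. left_approximation C D' X f \<and> epic_in C D f)"

definition factors_through :: "('o, 'm) additive_cat \<Rightarrow> 'm \<Rightarrow> 'o \<Rightarrow> bool" where
  "factors_through C f W \<longleftrightarrow>
    (\<exists>g\<in>homs C (Dom C f) W. \<exists>h\<in>homs C W (Cod C f). h \<cdot>\<^bsub>C\<^esub> g = f)"

definition left_complete_total_rejective_chain ::
  "('o, 'm) additive_cat \<Rightarrow> nat \<Rightarrow> (nat \<Rightarrow> 'o set) \<Rightarrow> bool" where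
  "left_complete_total_rejective_chain C l Cs \<longleftrightarrow>
    (\<forall>i\<in>{1..l + 1}. subcategory C (Cs i)) \<and>
    Cs (l + 1) = {Z. zero_object C Z} \<and>
    (\<forall>i\<in>{1..l}. Cs (i + 1) \<subset> Cs i) \<and>
    (\<forall>i\<in>{1..l}. left_rejective C (Cs i) (Cs 1) \<and>
      (\<forall>Y\<in>Cs i. \<forall>Z\<in>Cs i. \<forall>f\<in>homs C Y Z.
        indecomposable C Y \<and> indecomposable C Z \<and> \<not> isomorphism C f \<longrightarrow>
        (\<exists>W\<in>Cs (i + 1). factors_through C f W)))"

end

theory Submission
  imports Defs
begin

text \<open>
  Write \<open>\<mu>\<close> for the Gabriel--Roiter measure. The proof rests on Gabriel's main property, in the
  following form (\<open>main_property\<close>): if the maps \<open>f : X \<rightarrow> Y\<^sub>f\<close> from an indecomposable object to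
  indecomposable objects with \<open>\<mu>(Y\<^sub>f) \<le> \<mu>(X)\<close> are jointly monic, then one of them is an isomorphism.
  Consequently, an indecomposable subobject of an object that is cogenerated by indecomposable
  objects of measure below \<open>I\<close> has itself measure below \<open>I\<close>. This also shows that the measure of a
  decomposable object does not depend on the decomposition (\<open>gr_measure_is_max\<close>). The inductions run over the number of values that \<open>\<lambda>\<close> takes on the subobjects of an object: this
  number is finite (\<open>finite_sub_values\<close>) and drops for proper subobjects and proper quotients.

  By construction, \<open>X\<^bsub>i+1\<^esub>\<close> is the largest quotient of \<open>X\<^sub>i\<close> that is cogenerated by indecomposable
  objects of measure below \<open>\<mu>(X\<^sub>i)\<close> (\<open>reject_quotientE\<close>). Hence \<open>\<mu>(X\<^bsub>i+1\<^esub>) < \<mu>(X\<^sub>i)\<close> as long as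
  \<open>X\<^sub>i \<noteq> 0\<close>, the sequence reaches \<open>0\<close>, and the inclusions are proper. It also follows that every map
  from \<open>X\<^sub>j\<close> to a later term, or more generally to any object cogenerated in this way, factors
  through \<open>X\<^bsub>j+1\<^esub>\<close>.

  An object \<open>Z\<close> belongs to the \<open>i\<close>-th subcategory if and only if its identity is a sum of
  endomorphisms \<open>b a\<close> that factor through objects \<open>X\<^sub>j\<close> with \<open>j \<ge> i\<close> (\<open>add_tail_iff\<close>). The left
  approximation of \<open>Z\<close> is its largest quotient cogenerated by these \<open>X\<^sub>j\<close>; the sum that represents
  the identity of \<open>Z\<close> descends to this quotient along the approximations \<open>X\<^sub>j \<rightarrow> X\<^sub>i\<close>, which shows that
  the quotient lies in the subcategory (\<open>ideal_tail_descends\<close>).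

  For a nonisomorphism \<open>f : Y \<rightarrow> Z\<close> between indecomposable objects of the \<open>i\<close>-th subcategory, either
  \<open>\<mu>(Y) < \<mu>(X\<^sub>i)\<close>, or the image of \<open>f\<close> is cogenerated by objects of measure below \<open>\<mu>(X\<^sub>i)\<close>. In both
  cases the maps from \<open>X\<^sub>i\<close> that occur in \<open>f = \<Sum> f b a\<close> factor through \<open>X\<^bsub>i+1\<^esub>\<close>
  (\<open>nonisomorphism_factors\<close>).
\<close>


section \<open>Preadditive categories\<close>

lemma homs_iff [simp]:
  "f \<in> homs C X Y \<longleftrightarrow> f \<in> Arr C \<and> Dom C f = X \<and> Cod C f = Y"
  by (auto simp: homs_def)

context category
begin

lemma hom_Obj:
  assumes "f \<in> homs C X Y"
  shows "X \<in> Obj C" "Y \<in> Obj C"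
  using assms Dom_Obj Cod_Obj by auto

lemma Comp_typing [simp]:
  assumes "f \<in> Arr C" "g \<in> Arr C" "Dom C g = Cod C f"
  shows "g \<cdot> f \<in> Arr C" "Dom C (g \<cdot> f) = Dom C f" "Cod C (g \<cdot> f) = Cod C g"
  using Comp_homs[of f "Dom C f" "Cod C f" g "Cod C g"] assms by auto

lemma Id_typing [simp]:
  assumes "X \<in> Obj C"
  shows "Id C X \<in> Arr C" "Dom C (Id C X) = X" "Cod C (Id C X) = X"
  using Id_homs[OF assms] by auto

lemma Comp_assoc_simp [simp]:
  assumes "f \<in> Arr C" "g \<in> Arr C" "h \<in> Arr C" "Dom C g = Cod C f" "Dom C h = Cod C g"
  shows "(h \<cdot> g) \<cdot> f = h \<cdot> (g \<cdot> f)"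
  using Comp_assoc[of f "Dom C f" "Cod C f" g "Cod C g" h "Cod C h"] assms by auto

lemma Comp_Id_simps [simp]:
  assumes "f \<in> Arr C"
  shows "Cod C f = Y \<Longrightarrow> Id C Y \<cdot> f = f" "Dom C f = X \<Longrightarrow> f \<cdot> Id C X = f"
  using Comp_Id_left[of f "Dom C f" "Cod C f"] Comp_Id_right[of f "Dom C f" "Cod C f"] assms
  by auto

lemma Comp_reassoc:
  assumes "h \<cdot> g = k" "f \<in> Arr C" "g \<in> Arr C" "h \<in> Arr C" "Dom C g = Cod C f" "Dom C h = Cod C g"
  shows "h \<cdot> (g \<cdot> f) = k \<cdot> f"
  using assms by (metis Comp_assoc_simp)

lemma monic_cancel:
  assumes "monic C m" "u \<in> homs C Z (Dom C m)" "v \<in> homs C Z (Dom C m)" "m \<cdot> u = m \<cdot> v"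
  shows "u = v"
  using assms hom_Obj(1)[OF assms(2)] unfolding monic_def by blast

lemma epic_cancel:
  assumes "epic C f" "u \<in> homs C (Cod C f) Z" "v \<in> homs C (Cod C f) Z" "u \<cdot> f = v \<cdot> f"
  shows "u = v"
  using assms hom_Obj(2)[OF assms(2)] unfolding epic_in_def by blast

lemma epic_Comp:
  assumes "epic C f" "epic C g" "Dom C g = Cod C f"
  shows "epic C (g \<cdot> f)"
  unfolding epic_in_def
proof (intro conjI ballI impI)
  have [simp]: "f \<in> Arr C" "g \<in> Arr C"
    using assms by (auto simp: epic_in_def)
  show "g \<cdot> f \<in> Arr C" "Dom C (g \<cdot> f) \<in> Obj C" "Cod C (g \<cdot> f) \<in> Obj C"
    using assms by (auto simp: Dom_Obj Cod_Obj)
  fix Z u v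
  assume u: "u \<in> homs C (Cod C (g \<cdot> f)) Z" and v: "v \<in> homs C (Cod C (g \<cdot> f)) Z"
    and eq: "u \<cdot> (g \<cdot> f) = v \<cdot> (g \<cdot> f)"
  have "(u \<cdot> g) \<cdot> f = (v \<cdot> g) \<cdot> f"
    using u v eq assms by simp
  then have "u \<cdot> g = v \<cdot> g"
    using epic_cancel[OF assms(1), of "u \<cdot> g" Z "v \<cdot> g"] u v assms by simp
  then show "u = v"
    using epic_cancel[OF assms(2), of u Z v] u v assms by simp
qed

lemma epic_Id: "X \<in> Obj C \<Longrightarrow> epic C (Id C X)"
  unfolding epic_in_def by auto

lemma monic_Id: "X \<in> Obj C \<Longrightarrow> monic C (Id C X)"
  unfolding monic_def by auto

lemma monic_Comp:
  assumes "monic C f" "monic C g" "Dom C g = Cod C f"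
  shows "monic C (g \<cdot> f)"
  unfolding monic_def
proof (intro conjI ballI impI)
  have [simp]: "f \<in> Arr C" "g \<in> Arr C"
    using assms by (auto simp: monic_def)
  show "g \<cdot> f \<in> Arr C"
    using assms by auto
  fix Z u v
  assume u: "u \<in> homs C Z (Dom C (g \<cdot> f))" and v: "v \<in> homs C Z (Dom C (g \<cdot> f))"
    and eq: "(g \<cdot> f) \<cdot> u = (g \<cdot> f) \<cdot> v"
  have "g \<cdot> (f \<cdot> u) = g \<cdot> (f \<cdot> v)"
    using u v eq assms by simp
  then have "f \<cdot> u = f \<cdot> v"
    using monic_cancel[OF assms(2), of "f \<cdot> u" Z "f \<cdot> v"] u v assms by simp
  then show "u = v"
    using monic_cancel[OF assms(1), of u Z v] u v assms by simp
qed

lemma monic_left_factor: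
  assumes "monic C (g \<cdot> f)" "f \<in> Arr C" "g \<in> Arr C" "Dom C g = Cod C f"
  shows "monic C f"
  unfolding monic_def
proof (intro conjI ballI impI)
  fix Z u v
  assume u: "u \<in> homs C Z (Dom C f)" and v: "v \<in> homs C Z (Dom C f)" and eq: "f \<cdot> u = f \<cdot> v"
  then have "(g \<cdot> f) \<cdot> u = (g \<cdot> f) \<cdot> v"
    using assms(2-) by simp
  then show "u = v"
    using monic_cancel[OF assms(1), of u Z v] u v assms by simp
qed (use assms in auto)

lemma isomorphismI:
  assumes "f \<in> homs C X Y" "g \<in> homs C Y X" "g \<cdot> f = Id C X" "f \<cdot> g = Id C Y"
  shows "isomorphism C f"
  using assms unfolding isomorphism_def by auto

lemma isomorphismE:
  assumes "isomorphism C f" "f \<in> homs C X Y"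
  obtains g where "g \<in> homs C Y X" "g \<cdot> f = Id C X" "f \<cdot> g = Id C Y"
  using assms unfolding isomorphism_def by auto

lemma split_monic:
  assumes "s \<in> homs C X Y" "r \<in> homs C Y X" "r \<cdot> s = Id C X"
  shows "monic C s"
  using monic_left_factor[of r s] monic_Id hom_Obj(1)[OF assms(1)] assms by simp

lemma isomorphism_monic:
  assumes "isomorphism C f" "f \<in> homs C X Y"
  shows "monic C f"
  using split_monic isomorphismE[OF assms] assms(2) by metis

lemma split_monic_epic_iso:
  assumes "s \<in> homs C X Y" "r \<in> homs C Y X" "s \<cdot> r = Id C Y" "monic C s"
  shows "isomorphism C s"
proof (rule isomorphismI[OF assms(1,2) _ assms(3)])
  have [simp]: "X \<in> Obj C" "Y \<in> Obj C"
    using hom_Obj assms(1) by blast+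
  have "s \<cdot> (r \<cdot> s) = s \<cdot> Id C X"
    using assms(1,2) Comp_reassoc[OF assms(3), of s] by simp
  then show "r \<cdot> s = Id C X"
    by (rule monic_cancel[OF assms(4), of _ X, rotated -1]) (use assms(1,2) in auto)
qed

end

definition retract :: "('o, 'm) additive_cat \<Rightarrow> 'o \<Rightarrow> 'o \<Rightarrow> bool" where
  "retract C Z S \<longleftrightarrow> (\<exists>s\<in>homs C Z S. \<exists>r\<in>homs C S Z. r \<cdot>\<^bsub>C\<^esub> s = Id C Z)"

context preadditive_category
begin

lemma Zero_typing [simp]:
  assumes "X \<in> Obj C" "Y \<in> Obj C"
  shows "Zero C X Y \<in> Arr C" "Dom C (Zero C X Y) = X" "Cod C (Zero C X Y) = Y"
proof -
  interpret G: comm_group "hom_group C X Y"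
    using hom_comm_group assms .
  show "Zero C X Y \<in> Arr C" "Dom C (Zero C X Y) = X" "Cod C (Zero C X Y) = Y"
    using G.one_closed by (auto simp: hom_group_def)
qed

lemma Add_typing [simp]:
  assumes "f \<in> Arr C" "g \<in> Arr C" "Dom C f = Dom C g" "Cod C f = Cod C g"
  shows "Add C f g \<in> Arr C" "Dom C (Add C f g) = Dom C g" "Cod C (Add C f g) = Cod C g"
proof -
  interpret G: comm_group "hom_group C (Dom C g) (Cod C g)"
    using hom_comm_group Dom_Obj Cod_Obj assms by blast
  show "Add C f g \<in> Arr C" "Dom C (Add C f g) = Dom C g" "Cod C (Add C f g) = Cod C g"
    using G.m_closed[of f g] assms by (auto simp: hom_group_def)
qed

lemma Add_assoc:
  assumes "f \<in> homs C X Y" "g \<in> homs C X Y" "h \<in> homs C X Y"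
  shows "Add C (Add C f g) h = Add C f (Add C g h)"
proof -
  interpret G: comm_group "hom_group C X Y"
    using hom_comm_group hom_Obj assms by blast
  show ?thesis
    using G.m_assoc[of f g h] assms by (auto simp: hom_group_def)
qed

lemma Add_Zero [simp]:
  assumes "f \<in> Arr C" "Dom C f = X" "Cod C f = Y"
  shows "Add C f (Zero C X Y) = f" "Add C (Zero C X Y) f = f"
proof -
  interpret G: comm_group "hom_group C X Y"
    using hom_comm_group Dom_Obj Cod_Obj assms by blast
  show "Add C f (Zero C X Y) = f" "Add C (Zero C X Y) f = f"
    using G.l_one[of f] G.r_one[of f] assms by (auto simp: hom_group_def)
qed

lemma Add_cancel_right:
  assumes "f \<in> homs C X Y" "g \<in> homs C X Y" "h \<in> homs C X Y" "Add C f h = Add C g h"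
  shows "f = g"
proof -
  interpret G: comm_group "hom_group C X Y"
    using hom_comm_group hom_Obj assms by blast
  show ?thesis
    using G.right_cancel[of h f g] assms by (auto simp: hom_group_def)
qed

lemma ex_difference:
  assumes "f \<in> homs C X Y" "g \<in> homs C X Y"
  obtains w where "w \<in> homs C X Y" "Add C w g = f"
proof -
  interpret G: comm_group "hom_group C X Y"
    using hom_comm_group hom_Obj assms by blast
  let ?w = "f \<otimes>\<^bsub>hom_group C X Y\<^esub> inv\<^bsub>hom_group C X Y\<^esub> g"
  have carr: "f \<in> carrier (hom_group C X Y)" "g \<in> carrier (hom_group C X Y)"
    using assms by (auto simp: hom_group_def)
  have "?w \<in> carrier (hom_group C X Y)"
    using carr by simp
  moreover have "?w \<otimes>\<^bsub>hom_group C X Y\<^esub> g = f"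
    using carr by (simp add: G.m_assoc)
  ultimately show thesis
    using that by (auto simp: hom_group_def)
qed

lemma Comp_Add [simp]:
  assumes "f \<in> Arr C" "g \<in> Arr C" "Dom C f = Dom C g" "Cod C f = Cod C g" "h \<in> Arr C"
  shows "Dom C h = Cod C g \<Longrightarrow> h \<cdot> Add C f g = Add C (h \<cdot> f) (h \<cdot> g)"
    and "Cod C h = Dom C g \<Longrightarrow> Add C f g \<cdot> h = Add C (f \<cdot> h) (g \<cdot> h)"
  using Comp_Add_right[of f "Dom C g" "Cod C g" g h "Cod C h"]
    Comp_Add_left[of h "Dom C h" "Dom C g" f "Cod C g" g] assms by auto

lemma Comp_Zero [simp]:
  assumes "f \<in> Arr C"
  shows "Dom C f = Y \<Longrightarrow> X \<in> Obj C \<Longrightarrow> f \<cdot> Zero C X Y = Zero C X (Cod C f)"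
    and "Cod C f = X \<Longrightarrow> Y \<in> Obj C \<Longrightarrow> Zero C X Y \<cdot> f = Zero C (Dom C f) Y"
proof -
  have [simp]: "Dom C f \<in> Obj C" "Cod C f \<in> Obj C"
    using assms Dom_Obj Cod_Obj by auto
  show "f \<cdot> Zero C X Y = Zero C X (Cod C f)" if "Dom C f = Y" "X \<in> Obj C"
  proof -
    have [simp]: "Y \<in> Obj C"
      using that by auto
    have "Add C (f \<cdot> Zero C X Y) (f \<cdot> Zero C X Y) = f \<cdot> Add C (Zero C X Y) (Zero C X Y)"
      using assms that by (subst Comp_Add(1)) auto
    also have "\<dots> = Add C (Zero C X (Cod C f)) (f \<cdot> Zero C X Y)"
      using assms that by simp
    finally show ?thesis
      using Add_cancel_right[of "f \<cdot> Zero C X Y" X "Cod C f" "Zero C X (Cod C f)"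
          "f \<cdot> Zero C X Y"] assms that by simp
  qed
  show "Zero C X Y \<cdot> f = Zero C (Dom C f) Y" if "Cod C f = X" "Y \<in> Obj C"
  proof -
    have [simp]: "X \<in> Obj C"
      using that by auto
    have "Add C (Zero C X Y \<cdot> f) (Zero C X Y \<cdot> f) = Add C (Zero C X Y) (Zero C X Y) \<cdot> f"
      using assms that by (subst Comp_Add(2)) auto
    also have "\<dots> = Add C (Zero C (Dom C f) Y) (Zero C X Y \<cdot> f)"
      using assms that by simp
    finally show ?thesis
      using Add_cancel_right[of "Zero C X Y \<cdot> f" "Dom C f" Y "Zero C (Dom C f) Y"
          "Zero C X Y \<cdot> f"] assms that by simp
  qed
qed

lemma monic_iff:
  "monic C f \<longleftrightarrow> f \<in> Arr C \<and>
    (\<forall>Z u. u \<in> homs C Z (Dom C f) \<and> f \<cdot> u = Zero C Z (Cod C f) \<longrightarrow> u = Zero C Z (Dom C f))"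
    (is "_ \<longleftrightarrow> ?R")
proof
  assume m: "monic C f"
  then have f: "f \<in> Arr C" "Dom C f \<in> Obj C"
    using Dom_Obj by (auto simp: monic_def)
  have "u = Zero C Z (Dom C f)" if u: "u \<in> homs C Z (Dom C f)" "f \<cdot> u = Zero C Z (Cod C f)" for Z u
    using hom_Obj(1)[OF u(1)] u f monic_cancel[OF m u(1), of "Zero C Z (Dom C f)"] by simp
  then show ?R
    using f by blast
next
  assume R: ?R
  show "monic C f"
    unfolding monic_def
  proof (intro conjI ballI impI)
    fix Z u v
    assume Z: "Z \<in> Obj C" and u: "u \<in> homs C Z (Dom C f)" and v: "v \<in> homs C Z (Dom C f)"
      and eq: "f \<cdot> u = f \<cdot> v"
    have [simp]: "f \<in> Arr C" "Dom C f \<in> Obj C" "Cod C f \<in> Obj C"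
      using R Dom_Obj Cod_Obj by auto
    obtain w where w: "w \<in> homs C Z (Dom C f)" "Add C w v = u"
      using ex_difference[OF u v] .
    have "Add C (f \<cdot> w) (f \<cdot> v) = f \<cdot> u"
      using w(1) v by (simp add: w(2)[symmetric])
    then have "f \<cdot> w = Zero C Z (Cod C f)"
      using Add_cancel_right[of "f \<cdot> w" Z "Cod C f" "Zero C Z (Cod C f)" "f \<cdot> v"] eq w v Z by simp
    then have "w = Zero C Z (Dom C f)"
      using R w by blast
    then show "u = v"
      using w v by auto
  qed (use R in auto)
qed

lemma epic_iff:
  "epic C f \<longleftrightarrow> f \<in> Arr C \<and>
    (\<forall>Z u. u \<in> homs C (Cod C f) Z \<and> u \<cdot> f = Zero C (Dom C f) Z \<longrightarrow> u = Zero C (Cod C f) Z)"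
    (is "_ \<longleftrightarrow> ?R")
proof
  assume m: "epic C f"
  then have f: "f \<in> Arr C" "Cod C f \<in> Obj C"
    using Cod_Obj by (auto simp: epic_in_def)
  have "u = Zero C (Cod C f) Z" if u: "u \<in> homs C (Cod C f) Z" "u \<cdot> f = Zero C (Dom C f) Z" for Z u
    using hom_Obj(2)[OF u(1)] u f epic_cancel[OF m u(1), of "Zero C (Cod C f) Z"] by simp
  then show ?R
    using f by blast
next
  assume R: ?R
  show "epic C f"
    unfolding epic_in_def
  proof (intro conjI ballI impI)
    fix Z u v
    assume Z: "Z \<in> Obj C" and u: "u \<in> homs C (Cod C f) Z" and v: "v \<in> homs C (Cod C f) Z"
      and eq: "u \<cdot> f = v \<cdot> f"
    have [simp]: "f \<in> Arr C" "Dom C f \<in> Obj C" "Cod C f \<in> Obj C"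
      using R Dom_Obj Cod_Obj by auto
    obtain w where w: "w \<in> homs C (Cod C f) Z" "Add C w v = u"
      using ex_difference[OF u v] .
    have "Add C (w \<cdot> f) (v \<cdot> f) = u \<cdot> f"
      using w(1) v by (simp add: w(2)[symmetric])
    then have "w \<cdot> f = Zero C (Dom C f) Z"
      using Add_cancel_right[of "w \<cdot> f" "Dom C f" Z "Zero C (Dom C f) Z" "v \<cdot> f"] eq w v Z by simp
    then have "w = Zero C (Cod C f) Z"
      using R w by blast
    then show "u = v"
      using w v by auto
  qed (use R in \<open>auto simp: Dom_Obj Cod_Obj\<close>)
qed

lemma monic_zero:
  assumes "monic C f" "u \<in> homs C Z (Dom C f)" "f \<cdot> u = Zero C Z (Cod C f)"
  shows "u = Zero C Z (Dom C f)"
  using assms unfolding monic_iff by blast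

lemma epic_zero:
  assumes "epic C f" "u \<in> homs C (Cod C f) Z" "u \<cdot> f = Zero C (Dom C f) Z"
  shows "u = Zero C (Cod C f) Z"
  using assms unfolding epic_iff by blast

lemma zero_object_iff: "zero_object C Z \<longleftrightarrow> Z \<in> Obj C \<and> Id C Z = Zero C Z Z"
proof
  assume "zero_object C Z"
  then show "Z \<in> Obj C \<and> Id C Z = Zero C Z Z"
    unfolding zero_object_def by (metis Id_homs Zero_typing homs_iff)
next
  assume *: "Z \<in> Obj C \<and> Id C Z = Zero C Z Z"
  have "f = Zero C X Z" if "f \<in> homs C X Z" for X f
    using Comp_Id_simps(1)[of f Z] Comp_Zero(2)[of f Z Z] that * by auto
  moreover have "f = Zero C Z X" if "f \<in> homs C Z X" for X f
    using Comp_Id_simps(2)[of f Z] Comp_Zero(1)[of f Z Z] that * by auto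
  moreover have "Zero C X Z \<in> homs C X Z" "Zero C Z X \<in> homs C Z X" if "X \<in> Obj C" for X
    using that * by auto
  ultimately show "zero_object C Z"
    unfolding zero_object_def using * by meson
qed

lemma zero_object_hom:
  assumes "zero_object C Z"
  shows "f \<in> homs C X Z \<Longrightarrow> f = Zero C X Z" "f \<in> homs C Z X \<Longrightarrow> f = Zero C Z X"
  using assms hom_Obj Zero_typing unfolding zero_object_def by (metis homs_iff)+

end


section \<open>Morphisms that are sums of morphisms through given objects\<close>

text \<open>
  The ideal of the morphisms \<open>\<Sum> b\<^sub>k a\<^sub>k\<close> for which every \<open>b\<^sub>k a\<^sub>k\<close> factors through an object
  of \<open>P\<close>. An object is a direct summand of a finite direct sum of objects of \<open>P\<close> if and only if
  its identity lies in this ideal. This criterion passes to direct sums and retracts, and it can be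
  transported to quotients term by term.
\<close>

inductive ideal :: "('o, 'm) additive_cat \<Rightarrow> 'o set \<Rightarrow> 'o \<Rightarrow> 'o \<Rightarrow> 'm \<Rightarrow> bool"
  for C P X Y where
  zero: "X \<in> Obj C \<Longrightarrow> Y \<in> Obj C \<Longrightarrow> ideal C P X Y (Zero C X Y)"
| step: "W \<in> P \<Longrightarrow> a \<in> homs C X W \<Longrightarrow> b \<in> homs C W Y \<Longrightarrow> ideal C P X Y g \<Longrightarrow>
    ideal C P X Y (Add C (b \<cdot>\<^bsub>C\<^esub> a) g)"

context preadditive_category
begin

lemma ideal_homs: "ideal C P X Y f \<Longrightarrow> f \<in> homs C X Y"
  by (induction rule: ideal.induct) auto

lemma ideal_through:
  assumes "W \<in> P" "a \<in> homs C X W" "b \<in> homs C W Y"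
  shows "ideal C P X Y (b \<cdot> a)"
proof -
  have "X \<in> Obj C" "Y \<in> Obj C"
    using assms hom_Obj by blast+
  then have "ideal C P X Y (Add C (b \<cdot> a) (Zero C X Y))"
    using assms by (intro ideal.step ideal.zero)
  then show ?thesis
    using assms by simp
qed

lemma ideal_mono: "ideal C P X Y f \<Longrightarrow> P \<subseteq> Q \<Longrightarrow> ideal C Q X Y f"
  by (induction rule: ideal.induct) (auto intro: ideal.intros)

lemma ideal_Add:
  assumes "ideal C P X Y f" "ideal C P X Y g"
  shows "ideal C P X Y (Add C f g)"
  using assms
proof (induction rule: ideal.induct)
  case zero
  then show ?case
    using ideal_homs[OF zero(3)] by simp
next
  case (step W a b h)
  have "Add C (Add C (b \<cdot> a) h) g = Add C (b \<cdot> a) (Add C h g)"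
    using Add_assoc[of "b \<cdot> a" X Y h g] step ideal_homs[OF step(4)] ideal_homs[OF step(6)] by auto
  then show ?case
    using ideal.step[OF step(1,2,3) step(5)[OF step(6)]] by simp
qed

lemma ideal_Comp_left:
  assumes "ideal C P X Y f" "h \<in> homs C Y Z"
  shows "ideal C P X Z (h \<cdot> f)"
  using assms(1)
proof (induction rule: ideal.induct)
  case zero
  then show ?case
    using assms(2) hom_Obj(2)[OF assms(2)] ideal.zero[of X C Z P] by simp
next
  case (step W a b g)
  have "h \<cdot> Add C (b \<cdot> a) g = Add C ((h \<cdot> b) \<cdot> a) (h \<cdot> g)"
    using step ideal_homs[OF step(4)] assms(2) by auto
  then show ?case
    using ideal.step[OF step(1,2) _ step(5), of "h \<cdot> b"] step assms(2) by simp
qed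

lemma ideal_Comp_right:
  assumes "ideal C P X Y f" "h \<in> homs C Z X"
  shows "ideal C P Z Y (f \<cdot> h)"
  using assms(1)
proof (induction rule: ideal.induct)
  case zero
  then show ?case
    using assms(2) hom_Obj(1)[OF assms(2)] ideal.zero[of Z C Y P] by simp
next
  case (step W a b g)
  have "Add C (b \<cdot> a) g \<cdot> h = Add C (b \<cdot> (a \<cdot> h)) (g \<cdot> h)"
    using step ideal_homs[OF step(4)] assms(2) by auto
  then show ?case
    using ideal.step[OF step(1) _ step(3) step(5), of "a \<cdot> h"] step assms(2) by simp
qed

lemma ideal_trans:
  assumes "ideal C P X Y f" "\<And>W. W \<in> P \<Longrightarrow> ideal C Q W W (Id C W)"
  shows "ideal C Q X Y f"
  using assms(1)
proof (induction rule: ideal.induct)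
  case zero
  then show ?case
    by (rule ideal.zero)
next
  case (step W a b g)
  have "ideal C Q X Y (b \<cdot> (Id C W \<cdot> a))"
    using ideal_Comp_left[OF ideal_Comp_right[OF assms(2)[OF step(1)] step(2)] step(3)] .
  then show ?case
    using step ideal_Add by simp
qed

lemma ideal_retract:
  assumes "retract C Z S" "ideal C P S S (Id C S)"
  shows "ideal C P Z Z (Id C Z)"
proof -
  obtain s r where s: "s \<in> homs C Z S" and r: "r \<in> homs C S Z" "r \<cdot> s = Id C Z"
    using assms(1) unfolding retract_def by blast
  have "ideal C P Z Z (r \<cdot> (Id C S \<cdot> s))"
    using ideal_Comp_left[OF ideal_Comp_right[OF assms(2) s] r(1)] .
  then show ?thesis
    using s r by simp
qed

text \<open>
  A morphism that is killed by all maps from \<open>X\<close> to objects of \<open>P\<close> is killed by the whole ideal.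
  If the ideal contains the identity of \<open>X\<close>, the maps from \<open>X\<close> to \<open>P\<close> are therefore jointly monic.
\<close>

lemma ideal_annihilates:
  assumes "ideal C P X Y f" "u \<in> homs C Z X"
    and "\<And>W a. W \<in> P \<Longrightarrow> a \<in> homs C X W \<Longrightarrow> a \<cdot> u = Zero C Z W"
  shows "f \<cdot> u = Zero C Z Y"
  using assms(1)
proof (induction rule: ideal.induct)
  case zero
  then show ?case
    using assms(2) by simp
next
  case (step W a b g)
  have "Z \<in> Obj C" "Y \<in> Obj C"
    using assms(2) step(3) hom_Obj by blast+
  then show ?case
    using step assms(2) assms(3)[OF step(1,2)] ideal_homs[OF step(4)] by auto
qed

end


section \<open>Direct sums\<close>

context preadditive_category
begin

lemma direct_sumE:
  assumes "direct_sum C S I F"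
  obtains \<iota> where "S \<in> Obj C" "\<And>i. i \<in> I \<Longrightarrow> \<iota> i \<in> homs C (F i) S"
    "\<And>Z g. Z \<in> Obj C \<Longrightarrow> (\<And>i. i \<in> I \<Longrightarrow> g i \<in> homs C (F i) Z) \<Longrightarrow>
      \<exists>!h. h \<in> homs C S Z \<and> (\<forall>i\<in>I. h \<cdot> \<iota> i = g i)"
proof -
  from assms obtain \<iota> where "S \<in> Obj C" "\<forall>i\<in>I. \<iota> i \<in> homs C (F i) S"
    "\<forall>Z\<in>Obj C. \<forall>g. (\<forall>i\<in>I. g i \<in> homs C (F i) Z) \<longrightarrow>
      (\<exists>!h. h \<in> homs C S Z \<and> (\<forall>i\<in>I. h \<cdot> \<iota> i = g i))"
    unfolding direct_sum_def by blast
  then show thesis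
    by (intro that[of \<iota>]) blast+
qed

text \<open>
  If all but finitely many summands vanish, then the identity of a direct sum is the finite sum
  of the idempotents that belong to the other summands. This is why the projections are jointly
  monic and why the identity lies in the ideal of the summands.
\<close>

lemma direct_sum_projections:
  assumes S: "direct_sum C S I F" and F: "\<And>i. i \<in> I \<Longrightarrow> F i \<in> Obj C"
    and fin: "finite {i \<in> I. \<not> zero_object C (F i)}"
  obtains \<iota> \<pi> where "\<And>i. i \<in> I \<Longrightarrow> \<iota> i \<in> homs C (F i) S" "\<And>i. i \<in> I \<Longrightarrow> \<pi> i \<in> homs C S (F i)"
    "\<And>i. i \<in> I \<Longrightarrow> \<pi> i \<cdot> \<iota> i = Id C (F i)"
    "\<And>i j. i \<in> I \<Longrightarrow> j \<in> I \<Longrightarrow> i \<noteq> j \<Longrightarrow> \<pi> i \<cdot> \<iota> j = Zero C (F j) (F i)"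
    "\<And>Z u. u \<in> homs C Z S \<Longrightarrow> (\<And>i. i \<in> I \<Longrightarrow> \<pi> i \<cdot> u = Zero C Z (F i)) \<Longrightarrow> u = Zero C Z S"
    "ideal C (F ` I) S S (Id C S)"
proof -
  have SO [simp]: "S \<in> Obj C"
    using S unfolding direct_sum_def by blast
  obtain \<iota> where "S \<in> Obj C" and \<iota>: "\<And>i. i \<in> I \<Longrightarrow> \<iota> i \<in> homs C (F i) S"
    and univ: "\<And>Z g. Z \<in> Obj C \<Longrightarrow> (\<And>i. i \<in> I \<Longrightarrow> g i \<in> homs C (F i) Z) \<Longrightarrow>
      \<exists>!h. h \<in> homs C S Z \<and> (\<forall>i\<in>I. h \<cdot> \<iota> i = g i)"
    using direct_sumE[OF S] by blast
  define \<delta> where "\<delta> i j = (if j = i then Id C (F i) else Zero C (F j) (F i))" for i j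
  have "\<exists>h. h \<in> homs C S (F i) \<and> (\<forall>j\<in>I. h \<cdot> \<iota> j = \<delta> i j)" if "i \<in> I" for i
    proof -
      have "\<delta> i j \<in> homs C (F j) (F i)" if "j \<in> I" for j
        using F[OF that] F[OF \<open>i \<in> I\<close>] by (simp add: \<delta>_def)
      then show ?thesis
        using univ[of "F i" "\<delta> i"] F[OF that] by blast
    qed
  then obtain \<pi> where \<pi>: "\<And>i. i \<in> I \<Longrightarrow> \<pi> i \<in> homs C S (F i)"
    and \<pi>\<iota>: "\<And>i j. i \<in> I \<Longrightarrow> j \<in> I \<Longrightarrow> \<pi> i \<cdot> \<iota> j = \<delta> i j"
    by metis
  define e where "e f J \<longleftrightarrow> f \<in> homs C S S \<and> (\<forall>j\<in>I. f \<cdot> \<iota> j = (if j \<in> J then \<iota> j else Zero C (F j) S)) \<and>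
    ideal C (F ` I) S S f \<and>
    (\<forall>Z u. u \<in> homs C Z S \<and> (\<forall>i\<in>I. \<pi> i \<cdot> u = Zero C Z (F i)) \<longrightarrow> f \<cdot> u = Zero C Z S)" for f J
  have ex_e: "\<exists>f. e f J" if "finite J" "J \<subseteq> I" for J
    using that
  proof (induction rule: finite_induct)
    case empty
    have "e (Zero C S S) {}"
      unfolding e_def using ideal.zero[of S C S "F ` I"] \<iota> F by auto
    then show ?case
      by blast
  next
    case (insert i J)
    then obtain f where f: "e f J"
      by blast
    have i: "i \<in> I" "i \<notin> J"
      using insert by auto
    have fS: "f \<in> homs C S S"
      using f unfolding e_def by blast
    have "e (Add C (\<iota> i \<cdot> \<pi> i) f) (insert i J)"
      unfolding e_def
    proof (intro conjI ballI allI impI)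
      show "Add C (\<iota> i \<cdot> \<pi> i) f \<in> homs C S S"
        using \<iota>[OF i(1)] \<pi>[OF i(1)] fS by auto
      show "ideal C (F ` I) S S (Add C (\<iota> i \<cdot> \<pi> i) f)"
        using ideal.step[OF _ \<pi>[OF i(1)] \<iota>[OF i(1)]] f i unfolding e_def by blast
    next
      fix j
      assume j: "j \<in> I"
      have "Add C (\<iota> i \<cdot> \<pi> i) f \<cdot> \<iota> j = Add C (\<iota> i \<cdot> \<delta> i j) (f \<cdot> \<iota> j)"
        using \<iota>[OF i(1)] \<pi>[OF i(1)] fS \<iota>[OF j] \<pi>\<iota>[OF i(1) j] by simp
      also have "\<dots> = (if j \<in> insert i J then \<iota> j else Zero C (F j) S)"
        using f i j \<iota>[OF i(1)] \<iota>[OF j] F[OF i(1)] F[OF j] unfolding e_def \<delta>_def by auto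
      finally show "Add C (\<iota> i \<cdot> \<pi> i) f \<cdot> \<iota> j = (if j \<in> insert i J then \<iota> j else Zero C (F j) S)" .
    next
      fix Z u
      assume u: "u \<in> homs C Z S \<and> (\<forall>i\<in>I. \<pi> i \<cdot> u = Zero C Z (F i))"
      have "Z \<in> Obj C"
        using u hom_Obj by blast
      then show "Add C (\<iota> i \<cdot> \<pi> i) f \<cdot> u = Zero C Z S"
        using \<iota>[OF i(1)] \<pi>[OF i(1)] fS u i f F[OF i(1)] unfolding e_def by auto
    qed
    then show ?case
      by blast
  qed
  obtain f where f: "e f {i \<in> I. \<not> zero_object C (F i)}"
    using ex_e[OF fin] by blast
  have "f \<cdot> \<iota> j = \<iota> j" if "j \<in> I" for j
    using f zero_object_hom(2)[OF _ \<iota>[OF that]] that unfolding e_def by auto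
  moreover have "Id C S \<cdot> \<iota> j = \<iota> j" if "j \<in> I" for j
    using \<iota>[OF that] by simp
  ultimately have "f = Id C S"
    using univ[OF SO \<iota>] f unfolding e_def by (metis Id_homs SO)
  then have id: "e (Id C S) {i \<in> I. \<not> zero_object C (F i)}"
    using f by simp
  show thesis
  proof (rule that[of \<iota> \<pi>])
    show "ideal C (F ` I) S S (Id C S)"
      using id unfolding e_def by blast
    show "u = Zero C Z S"
      if "u \<in> homs C Z S" "\<And>i. i \<in> I \<Longrightarrow> \<pi> i \<cdot> u = Zero C Z (F i)" for Z u
    proof -
      have "Id C S \<cdot> u = Zero C Z S"
        using id that unfolding e_def by blast
      then show ?thesis
        using that(1) by simp
    qed
  qed (use \<iota> \<pi> \<pi>\<iota> in \<open>auto simp: \<delta>_def\<close>)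
qed

lemma direct_sum_reindex:
  assumes S: "direct_sum C S I F" and \<phi>: "bij_betw \<phi> I J" and G: "\<And>i. i \<in> I \<Longrightarrow> G (\<phi> i) = F i"
  shows "direct_sum C S J G"
proof -
  define \<psi> where "\<psi> = inv_into I \<phi>"
  have \<psi>: "\<And>j. j \<in> J \<Longrightarrow> \<psi> j \<in> I" "\<And>j. j \<in> J \<Longrightarrow> \<phi> (\<psi> j) = j" "\<And>i. i \<in> I \<Longrightarrow> \<psi> (\<phi> i) = i"
    "\<And>i. i \<in> I \<Longrightarrow> \<phi> i \<in> J"
    using \<phi> unfolding \<psi>_def
    by (auto simp: bij_betw_inv_into_left bij_betw_inv_into_right bij_betwE bij_betw_imp_surj_on inv_into_into)
  obtain \<iota> where "S \<in> Obj C" and \<iota>: "\<And>i. i \<in> I \<Longrightarrow> \<iota> i \<in> homs C (F i) S"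
    and univ: "\<And>Z g. Z \<in> Obj C \<Longrightarrow> (\<And>i. i \<in> I \<Longrightarrow> g i \<in> homs C (F i) Z) \<Longrightarrow>
      \<exists>!h. h \<in> homs C S Z \<and> (\<forall>i\<in>I. h \<cdot> \<iota> i = g i)"
    using direct_sumE[OF S] by blast
  show ?thesis
    unfolding direct_sum_def
  proof (intro conjI exI[of _ "\<lambda>j. \<iota> (\<psi> j)"] ballI allI impI)
    show "S \<in> Obj C"
      using S unfolding direct_sum_def by blast
    show "\<iota> (\<psi> j) \<in> homs C (G j) S" if "j \<in> J" for j
      using \<iota>[OF \<psi>(1)[OF that]] G[OF \<psi>(1)[OF that]] \<psi>(2)[OF that] by simp
    fix Z g
    assume Z: "Z \<in> Obj C" and g: "\<forall>j\<in>J. g j \<in> homs C (G j) Z"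
    have "\<exists>!h. h \<in> homs C S Z \<and> (\<forall>i\<in>I. h \<cdot> \<iota> i = g (\<phi> i))"
      using univ[OF Z, of "\<lambda>i. g (\<phi> i)"] g G \<psi>(4) by metis
    moreover have "(\<forall>i\<in>I. h \<cdot> \<iota> i = g (\<phi> i)) \<longleftrightarrow> (\<forall>j\<in>J. h \<cdot> \<iota> (\<psi> j) = g j)" for h
      using \<psi> by metis
    ultimately show "\<exists>!h. h \<in> homs C S Z \<and> (\<forall>j\<in>J. h \<cdot> \<iota> (\<psi> j) = g j)"
      by simp
  qed
qed

lemma direct_sum_pair_iff:
  "direct_sum_list C S [X, Y] \<longleftrightarrow> S \<in> Obj C \<and> (\<exists>i\<in>homs C X S. \<exists>j\<in>homs C Y S.
    \<forall>Z\<in>Obj C. \<forall>f\<in>homs C X Z. \<forall>g\<in>homs C Y Z. \<exists>!h. h \<in> homs C S Z \<and> h \<cdot> i = f \<and> h \<cdot> j = g)"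
    (is "?L \<longleftrightarrow> ?R")
proof -
  have set: "{..<length [X, Y]} = {0, 1::nat}"
    by auto
  show ?thesis
  proof
    assume ?L
    then obtain \<iota> where S: "S \<in> Obj C" and \<iota>: "\<forall>i\<in>{0,1}. \<iota> i \<in> homs C ([X, Y] ! i) S"
      and univ: "\<forall>Z\<in>Obj C. \<forall>g. (\<forall>i\<in>{0,1}. g i \<in> homs C ([X, Y] ! i) Z) \<longrightarrow>
        (\<exists>!h. h \<in> homs C S Z \<and> (\<forall>i\<in>{0,1}. h \<cdot> \<iota> i = g i))"
      unfolding direct_sum_list_def direct_sum_def set by blast
    have "\<exists>!h. h \<in> homs C S Z \<and> h \<cdot> \<iota> 0 = f \<and> h \<cdot> \<iota> 1 = g"
      if "Z \<in> Obj C" "f \<in> homs C X Z" "g \<in> homs C Y Z" for Z f g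
    proof -
      have "\<forall>i\<in>{0, 1}. (if i = 0 then f else g) \<in> homs C ([X, Y] ! i) Z"
        using that by simp
      then show ?thesis
        using univ[THEN bspec, OF that(1), THEN spec, of "\<lambda>i. if i = 0 then f else g"] by simp
    qed
    moreover have "\<iota> 0 \<in> homs C X S" "\<iota> 1 \<in> homs C Y S"
      using \<iota> by auto
    ultimately show ?R
      using S by blast
  next
    assume ?R
    then obtain i j where S: "S \<in> Obj C" and ij: "i \<in> homs C X S" "j \<in> homs C Y S"
      and univ: "\<And>Z f g. Z \<in> Obj C \<Longrightarrow> f \<in> homs C X Z \<Longrightarrow> g \<in> homs C Y Z \<Longrightarrow>
        \<exists>!h. h \<in> homs C S Z \<and> h \<cdot> i = f \<and> h \<cdot> j = g"
      by metis
    show ?L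
      unfolding direct_sum_list_def direct_sum_def set
    proof (intro conjI exI[of _ "\<lambda>k. if k = 0 then i else j"] ballI allI impI)
      fix Z and g :: "nat \<Rightarrow> 'b"
      assume "Z \<in> Obj C" and g: "\<forall>i\<in>{0,1}. g i \<in> homs C ([X, Y] ! i) Z"
      then show "\<exists>!h. h \<in> homs C S Z \<and> (\<forall>k\<in>{0,1}. h \<cdot> (if k = 0 then i else j) = g k)"
        using univ[of Z "g 0" "g 1"] by simp
    qed (use S ij in auto)
  qed
qed

lemma direct_sum_pairE:
  assumes "direct_sum_list C S [X, Y]"
  obtains i j where "S \<in> Obj C" "i \<in> homs C X S" "j \<in> homs C Y S"
    "\<And>Z f g. Z \<in> Obj C \<Longrightarrow> f \<in> homs C X Z \<Longrightarrow> g \<in> homs C Y Z \<Longrightarrow>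
      \<exists>!h. h \<in> homs C S Z \<and> h \<cdot> i = f \<and> h \<cdot> j = g"
  using assms unfolding direct_sum_pair_iff by (elim conjE bexE) blast

lemma direct_sum_Un:
  assumes S: "direct_sum C S I F" and T: "direct_sum C T J F" and "I \<inter> J = {}"
    and U: "direct_sum_list C U [S, T]"
  shows "direct_sum C U (I \<union> J) F"
proof -
  obtain \<iota> where "S \<in> Obj C" and \<iota>: "\<And>i. i \<in> I \<Longrightarrow> \<iota> i \<in> homs C (F i) S"
    and univ: "\<And>Z g. Z \<in> Obj C \<Longrightarrow> (\<And>i. i \<in> I \<Longrightarrow> g i \<in> homs C (F i) Z) \<Longrightarrow>
      \<exists>!h. h \<in> homs C S Z \<and> (\<forall>i\<in>I. h \<cdot> \<iota> i = g i)"
    using direct_sumE[OF S] by blast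
  obtain \<kappa> where "T \<in> Obj C" and \<kappa>: "\<And>i. i \<in> J \<Longrightarrow> \<kappa> i \<in> homs C (F i) T"
    and univ': "\<And>Z g. Z \<in> Obj C \<Longrightarrow> (\<And>i. i \<in> J \<Longrightarrow> g i \<in> homs C (F i) Z) \<Longrightarrow>
      \<exists>!h. h \<in> homs C T Z \<and> (\<forall>i\<in>J. h \<cdot> \<kappa> i = g i)"
    using direct_sumE[OF T] by blast
  obtain s t where UO: "U \<in> Obj C" and s: "s \<in> homs C S U" and t: "t \<in> homs C T U"
    and univ'': "\<And>Z f g. Z \<in> Obj C \<Longrightarrow> f \<in> homs C S Z \<Longrightarrow> g \<in> homs C T Z \<Longrightarrow>
        \<exists>!h. h \<in> homs C U Z \<and> h \<cdot> s = f \<and> h \<cdot> t = g"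
    using direct_sum_pairE[OF U] by blast
  define k where "k i = (if i \<in> I then s \<cdot> \<iota> i else t \<cdot> \<kappa> i)" for i
  have k: "k i \<in> homs C (F i) U" if "i \<in> I \<union> J" for i
    using that \<iota> \<kappa> s t assms(3) by (auto simp: k_def)
  have kI: "k i = s \<cdot> \<iota> i" if "i \<in> I" for i
    using that by (simp add: k_def)
  have kJ: "k i = t \<cdot> \<kappa> i" if "i \<in> J" for i
    using that assms(3) by (auto simp: k_def)
  have comp: "h \<cdot> k i = (h \<cdot> s) \<cdot> \<iota> i" if "h \<in> homs C U Z" "i \<in> I" for h Z i
    using that \<iota>[OF that(2)] s by (simp add: kI)
  have comp': "h \<cdot> k i = (h \<cdot> t) \<cdot> \<kappa> i" if "h \<in> homs C U Z" "i \<in> J" for h Z i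
    using that \<kappa>[OF that(2)] t by (simp add: kJ)
  show ?thesis
    unfolding direct_sum_def
  proof (intro conjI exI[of _ k] ballI allI impI)
    fix Z g
    assume Z: "Z \<in> Obj C" and g: "\<forall>i\<in>I \<union> J. g i \<in> homs C (F i) Z"
    obtain a where a: "a \<in> homs C S Z" "\<And>i. i \<in> I \<Longrightarrow> a \<cdot> \<iota> i = g i"
      and a_unique: "\<And>a'. a' \<in> homs C S Z \<Longrightarrow> (\<And>i. i \<in> I \<Longrightarrow> a' \<cdot> \<iota> i = g i) \<Longrightarrow> a' = a"
    proof -
      have "\<exists>!h. h \<in> homs C S Z \<and> (\<forall>i\<in>I. h \<cdot> \<iota> i = g i)"
        using g by (intro univ[OF Z]) blast
      then show thesis
        by (elim ex1E conjE) (rule that, blast+)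
    qed
    obtain b where b: "b \<in> homs C T Z" "\<And>i. i \<in> J \<Longrightarrow> b \<cdot> \<kappa> i = g i"
      and b_unique: "\<And>b'. b' \<in> homs C T Z \<Longrightarrow> (\<And>i. i \<in> J \<Longrightarrow> b' \<cdot> \<kappa> i = g i) \<Longrightarrow> b' = b"
    proof -
      have "\<exists>!h. h \<in> homs C T Z \<and> (\<forall>i\<in>J. h \<cdot> \<kappa> i = g i)"
        using g by (intro univ'[OF Z]) blast
      then show thesis
        by (elim ex1E conjE) (rule that, blast+)
    qed
    obtain h where h: "h \<in> homs C U Z" "h \<cdot> s = a" "h \<cdot> t = b"
      and h_unique: "\<And>h'. h' \<in> homs C U Z \<Longrightarrow> h' \<cdot> s = a \<Longrightarrow> h' \<cdot> t = b \<Longrightarrow> h' = h"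
      using univ''[OF Z a(1) b(1)] by blast
    show "\<exists>!h. h \<in> homs C U Z \<and> (\<forall>i\<in>I \<union> J. h \<cdot> k i = g i)"
    proof (rule ex1I[of _ h])
      show "h \<in> homs C U Z \<and> (\<forall>i\<in>I \<union> J. h \<cdot> k i = g i)"
        using h comp[OF h(1)] comp'[OF h(1)] a b by auto
      fix h'
      assume h': "h' \<in> homs C U Z \<and> (\<forall>i\<in>I \<union> J. h' \<cdot> k i = g i)"
      then have "h' \<cdot> s = a"
        using s comp[of h' Z] by (intro a_unique) auto
      moreover have "h' \<cdot> t = b"
        using h' t comp'[of h' Z] by (intro b_unique) auto
      ultimately show "h' = h"
        using h' h_unique by blast
    qed
  qed (use UO k in auto)
qed

lemma direct_sum_append:
  assumes "direct_sum_list C S Xs" "direct_sum_list C T Ys" "direct_sum_list C U [S, T]"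
  shows "direct_sum_list C U (Xs @ Ys)"
proof -
  let ?n = "length Xs" and ?m = "length Ys"
  let ?F = "\<lambda>i. (Xs @ Ys) ! i"
  have "direct_sum C S {..<?n} ?F"
    using direct_sum_reindex[of S "{..<?n}" "(!) Xs" "\<lambda>i. i" "{..<?n}" ?F] assms(1)
    by (auto simp: direct_sum_list_def nth_append bij_betw_def)
  moreover have "direct_sum C T {?n..<?n + ?m} ?F"
    using direct_sum_reindex[of T "{..<?m}" "(!) Ys" "\<lambda>i. ?n + i" "{?n..<?n + ?m}" ?F] assms(2)
    by (simp add: direct_sum_list_def bij_betw_def lessThan_atLeast0 add.commute[of ?n] nth_append)
  ultimately have "direct_sum C U ({..<?n} \<union> {?n..<?n + ?m}) ?F"
    using assms(3) by (intro direct_sum_Un) auto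
  moreover have "{..<?n} \<union> {?n..<?n + ?m} = {..<length (Xs @ Ys)}"
    by auto
  ultimately show ?thesis
    unfolding direct_sum_list_def by simp
qed

lemma direct_sum_list_projections:
  assumes "\<forall>Y\<in>set Ys. Y \<in> Obj C" "direct_sum_list C X Ys"
  shows "ideal C (set Ys) X X (Id C X)" "Y \<in> set Ys \<Longrightarrow> retract C Y X"
proof -
  let ?I = "{..<length Ys}"
  have Obj: "Ys ! i \<in> Obj C" if "i \<in> ?I" for i
    using assms(1) that by simp
  have fin: "finite {i \<in> ?I. \<not> zero_object C (Ys ! i)}"
    by simp
  have img: "(!) Ys ` ?I = set Ys"
    by (auto simp: set_conv_nth)
  have "ideal C (set Ys) X X (Id C X) \<and> (\<forall>i\<in>?I. retract C (Ys ! i) X)"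
    using assms(2)[unfolded direct_sum_list_def] Obj fin
  proof (rule direct_sum_projections)
    fix \<iota> \<pi>
    assume "\<And>i. i \<in> ?I \<Longrightarrow> \<iota> i \<in> homs C (Ys ! i) X" "\<And>i. i \<in> ?I \<Longrightarrow> \<pi> i \<in> homs C X (Ys ! i)"
      "\<And>i. i \<in> ?I \<Longrightarrow> \<pi> i \<cdot> \<iota> i = Id C (Ys ! i)" "ideal C ((!) Ys ` ?I) X X (Id C X)"
    then show "ideal C (set Ys) X X (Id C X) \<and> (\<forall>i\<in>?I. retract C (Ys ! i) X)"
      unfolding retract_def img by blast
  qed
  then show "ideal C (set Ys) X X (Id C X)" "Y \<in> set Ys \<Longrightarrow> retract C Y X"
    by (auto simp: in_set_conv_nth)
qed

lemma direct_sum_zero: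
  assumes "zero_object C S" "\<And>i. i \<in> I \<Longrightarrow> zero_object C (F i)"
  shows "direct_sum C S I F"
proof -
  have S: "S \<in> Obj C" "Id C S = Zero C S S"
    using assms(1) zero_object_iff by auto
  have F: "F i \<in> Obj C" if "i \<in> I" for i
    using assms(2)[OF that] by (auto simp: zero_object_iff)
  show ?thesis
    unfolding direct_sum_def
  proof (intro conjI exI[of _ "\<lambda>i. Zero C (F i) S"] ballI allI impI)
    fix Z g
    assume Z: "Z \<in> Obj C" and g: "\<forall>i\<in>I. g i \<in> homs C (F i) Z"
    show "\<exists>!h. h \<in> homs C S Z \<and> (\<forall>i\<in>I. h \<cdot> Zero C (F i) S = g i)"
    proof (rule ex1I[of _ "Zero C S Z"])
      show "Zero C S Z \<in> homs C S Z \<and> (\<forall>i\<in>I. Zero C S Z \<cdot> Zero C (F i) S = g i)"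
        using S Z F g zero_object_hom(2)[OF assms(2)] by (auto simp del: homs_iff) auto
    qed (use zero_object_hom(2)[OF assms(1)] in blast)
  qed (use S F in auto)
qed

lemma direct_sum_singleton:
  assumes "X \<in> Obj C" "F i = X"
  shows "direct_sum C X {i} F"
  unfolding direct_sum_def
proof (intro conjI exI[of _ "\<lambda>_. Id C X"] ballI allI impI)
  fix Z g
  assume "Z \<in> Obj C" and g: "\<forall>j\<in>{i}. g j \<in> homs C (F j) Z"
  then show "\<exists>!h. h \<in> homs C X Z \<and> (\<forall>j\<in>{i}. h \<cdot> Id C X = g j)"
    using assms by (intro ex1I[of _ "g i"]) auto
qed (use assms in auto)

lemma direct_sum_list_single: "X \<in> Obj C \<Longrightarrow> direct_sum_list C X [X]"
  using direct_sum_singleton[of X "\<lambda>i. [X] ! i" 0] by (simp add: direct_sum_list_def lessThan_Suc)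

text \<open>In a preadditive category, the equations of a biproduct characterise binary direct sums.\<close>

lemma biproduct_direct_sum:
  assumes i: "i \<in> homs C X S" and j: "j \<in> homs C Y S" and p: "p \<in> homs C S X" and q: "q \<in> homs C S Y"
    and eqs: "p \<cdot> i = Id C X" "q \<cdot> j = Id C Y" "p \<cdot> j = Zero C Y X" "q \<cdot> i = Zero C X Y"
    and sum: "Add C (i \<cdot> p) (j \<cdot> q) = Id C S"
  shows "direct_sum_list C S [X, Y]"
proof -
  have [simp]: "X \<in> Obj C" "Y \<in> Obj C" "S \<in> Obj C"
    using i j hom_Obj by blast+
  show ?thesis
    unfolding direct_sum_pair_iff
  proof (intro conjI bexI[OF _ i] bexI[OF _ j] ballI)
    fix Z f g
    assume Z [simp]: "Z \<in> Obj C" and f: "f \<in> homs C X Z" and g: "g \<in> homs C Y Z"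
    show "\<exists>!h. h \<in> homs C S Z \<and> h \<cdot> i = f \<and> h \<cdot> j = g"
    proof (rule ex1I[of _ "Add C (f \<cdot> p) (g \<cdot> q)"])
      show "Add C (f \<cdot> p) (g \<cdot> q) \<in> homs C S Z \<and>
          Add C (f \<cdot> p) (g \<cdot> q) \<cdot> i = f \<and> Add C (f \<cdot> p) (g \<cdot> q) \<cdot> j = g"
        using i j p q f g eqs by simp
      fix h
      assume h: "h \<in> homs C S Z \<and> h \<cdot> i = f \<and> h \<cdot> j = g"
      have "h = h \<cdot> Add C (i \<cdot> p) (j \<cdot> q)"
        using h sum by simp
      also have "\<dots> = Add C (h \<cdot> (i \<cdot> p)) (h \<cdot> (j \<cdot> q))"
        using h i j p q by simp
      also have "h \<cdot> (i \<cdot> p) = f \<cdot> p"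
        using h i p by (intro Comp_reassoc) auto
      also have "h \<cdot> (j \<cdot> q) = g \<cdot> q"
        using h j q by (intro Comp_reassoc) auto
      finally show "h = Add C (f \<cdot> p) (g \<cdot> q)" .
    qed
  qed simp
qed

lemma direct_sum_biproduct:
  assumes "direct_sum_list C S [X, Y]"
  obtains i j p q where "i \<in> homs C X S" "j \<in> homs C Y S" "p \<in> homs C S X" "q \<in> homs C S Y"
    "p \<cdot> i = Id C X" "q \<cdot> j = Id C Y" "p \<cdot> j = Zero C Y X" "q \<cdot> i = Zero C X Y"
    "Add C (i \<cdot> p) (j \<cdot> q) = Id C S"
proof -
  obtain i j where "S \<in> Obj C" and i: "i \<in> homs C X S" and j: "j \<in> homs C Y S"
    and univ: "\<And>Z f g. Z \<in> Obj C \<Longrightarrow> f \<in> homs C X Z \<Longrightarrow> g \<in> homs C Y Z \<Longrightarrow>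
      \<exists>!h. h \<in> homs C S Z \<and> h \<cdot> i = f \<and> h \<cdot> j = g"
    using direct_sum_pairE[OF assms] by blast
  have O [simp]: "X \<in> Obj C" "Y \<in> Obj C" "S \<in> Obj C"
    using i j hom_Obj by blast+
  have zero: "Zero C Y X \<in> homs C Y X" "Zero C X Y \<in> homs C X Y"
    by simp_all
  obtain p where p: "p \<in> homs C S X" "p \<cdot> i = Id C X" "p \<cdot> j = Zero C Y X"
    using univ[OF O(1) Id_homs[OF O(1)] zero(1)] by blast
  obtain q where q: "q \<in> homs C S Y" "q \<cdot> i = Zero C X Y" "q \<cdot> j = Id C Y"
    using univ[OF O(2) zero(2) Id_homs[OF O(2)]] by blast
  have "\<exists>!h. h \<in> homs C S S \<and> h \<cdot> i = i \<and> h \<cdot> j = j"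
    using univ[OF O(3) i j] .
  moreover have "Add C (i \<cdot> p) (j \<cdot> q) \<in> homs C S S \<and> Add C (i \<cdot> p) (j \<cdot> q) \<cdot> i = i \<and>
      Add C (i \<cdot> p) (j \<cdot> q) \<cdot> j = j"
    using i j p q by simp
  moreover have "Id C S \<in> homs C S S \<and> Id C S \<cdot> i = i \<and> Id C S \<cdot> j = j"
    using i j by simp
  ultimately have "Add C (i \<cdot> p) (j \<cdot> q) = Id C S"
    by blast
  then show thesis
    by (rule that[OF i j p(1) q(1) p(2) q(3) p(3) q(2)])
qed

lemma direct_summand_retract:
  assumes "direct_summand C Z S"
  shows "retract C Z S"
proof -
  obtain W where "direct_sum_list C S [Z, W]"
    using assms unfolding direct_summand_def by blast
  then show ?thesis
    by (rule direct_sum_biproduct) (unfold retract_def, blast)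
qed

end


section \<open>Abelian categories\<close>

context preadditive_category
begin

lemma is_kernelD:
  assumes "is_kernel C k f" "f \<in> homs C X Y"
  shows "k \<in> homs C (Dom C k) X" "f \<cdot> k = Zero C (Dom C k) Y"
    "\<And>Z g. g \<in> homs C Z X \<Longrightarrow> f \<cdot> g = Zero C Z Y \<Longrightarrow> \<exists>h\<in>homs C Z (Dom C k). k \<cdot> h = g"
proof -
  show "k \<in> homs C (Dom C k) X" "f \<cdot> k = Zero C (Dom C k) Y"
    using assms unfolding is_kernel_def by auto
  fix Z g
  assume g: "g \<in> homs C Z X" "f \<cdot> g = Zero C Z Y"
  then have "Z \<in> Obj C" "g \<in> homs C Z (Dom C f)" "f \<cdot> g = Zero C Z (Cod C f)"
    using assms(2) hom_Obj(1) by auto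
  then show "\<exists>h\<in>homs C Z (Dom C k). k \<cdot> h = g"
    using assms(1) unfolding is_kernel_def by blast
qed

lemma is_cokernelD:
  assumes "is_cokernel C q f" "f \<in> homs C X Y"
  shows "q \<in> homs C Y (Cod C q)" "q \<cdot> f = Zero C X (Cod C q)"
    "\<And>Z g. g \<in> homs C Y Z \<Longrightarrow> g \<cdot> f = Zero C X Z \<Longrightarrow> \<exists>h\<in>homs C (Cod C q) Z. h \<cdot> q = g"
proof -
  show "q \<in> homs C Y (Cod C q)" "q \<cdot> f = Zero C X (Cod C q)"
    using assms unfolding is_cokernel_def by auto
  fix Z g
  assume g: "g \<in> homs C Y Z" "g \<cdot> f = Zero C X Z"
  then have "Z \<in> Obj C" "g \<in> homs C (Cod C f) Z" "g \<cdot> f = Zero C (Dom C f) Z"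
    using assms(2) hom_Obj(2) by auto
  then show "\<exists>h\<in>homs C (Cod C q) Z. h \<cdot> q = g"
    using assms(1) unfolding is_cokernel_def by blast
qed

lemma is_kernelI:
  assumes "k \<in> homs C K X" "f \<in> homs C X Y" "f \<cdot> k = Zero C K Y" "monic C k"
    and fac: "\<And>Z g. g \<in> homs C Z X \<Longrightarrow> f \<cdot> g = Zero C Z Y \<Longrightarrow> \<exists>h\<in>homs C Z K. k \<cdot> h = g"
  shows "is_kernel C k f"
  unfolding is_kernel_def
proof (intro conjI ballI impI)
  fix Z g
  assume g: "g \<in> homs C Z (Dom C f)" "f \<cdot> g = Zero C Z (Cod C f)"
  then have "\<exists>h\<in>homs C Z K. k \<cdot> h = g"
    using assms(2) by (intro fac) auto
  then obtain h where h: "h \<in> homs C Z (Dom C k)" "k \<cdot> h = g"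
    using assms(1) by auto
  moreover have "h' = h" if "h' \<in> homs C Z (Dom C k) \<and> k \<cdot> h' = g" for h'
    by (rule monic_cancel[OF assms(4)]) (use that h in auto)
  ultimately show "\<exists>!h. h \<in> homs C Z (Dom C k) \<and> k \<cdot> h = g"
    by blast
qed (use assms in auto)

lemma is_cokernelI:
  assumes "q \<in> homs C Y Q" "f \<in> homs C X Y" "q \<cdot> f = Zero C X Q" "epic C q"
    and fac: "\<And>Z g. g \<in> homs C Y Z \<Longrightarrow> g \<cdot> f = Zero C X Z \<Longrightarrow> \<exists>h\<in>homs C Q Z. h \<cdot> q = g"
  shows "is_cokernel C q f"
  unfolding is_cokernel_def
proof (intro conjI ballI impI)
  fix Z g
  assume g: "g \<in> homs C (Cod C f) Z" "g \<cdot> f = Zero C (Dom C f) Z"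
  then have "\<exists>h\<in>homs C Q Z. h \<cdot> q = g"
    using assms(2) by (intro fac) auto
  then obtain h where h: "h \<in> homs C (Cod C q) Z" "h \<cdot> q = g"
    using assms(1) by auto
  moreover have "h' = h" if "h' \<in> homs C (Cod C q) Z \<and> h' \<cdot> q = g" for h'
    by (rule epic_cancel[OF assms(4)]) (use that h in auto)
  ultimately show "\<exists>!h. h \<in> homs C (Cod C q) Z \<and> h \<cdot> q = g"
    by blast
qed (use assms in auto)

lemma kernel_monic:
  assumes "is_kernel C k f"
  shows "monic C k"
  unfolding monic_def
proof (intro conjI ballI impI)
  have k [simp]: "k \<in> Arr C" "f \<in> Arr C" "Dom C f = Cod C k"
    and z: "f \<cdot> k = Zero C (Dom C k) (Cod C f)"
    using assms unfolding is_kernel_def by auto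
  show "k \<in> Arr C"
    by simp
  fix Z u v
  assume Z: "Z \<in> Obj C" and u: "u \<in> homs C Z (Dom C k)" and v: "v \<in> homs C Z (Dom C k)"
    and eq: "k \<cdot> u = k \<cdot> v"
  have "f \<cdot> (k \<cdot> u) = Zero C (Dom C k) (Cod C f) \<cdot> u"
    using Comp_reassoc[OF z, of u] u by simp
  also have "\<dots> = Zero C Z (Cod C f)"
    using u Z by (simp add: Cod_Obj)
  finally have "\<exists>!h. h \<in> homs C Z (Dom C k) \<and> k \<cdot> h = k \<cdot> u"
    using assms Z u unfolding is_kernel_def by simp
  then show "u = v"
    using u v eq by metis
qed

lemma cokernel_epic:
  assumes "is_cokernel C q f"
  shows "epic C q"
  unfolding epic_in_def
proof (intro conjI ballI impI)
  have q [simp]: "q \<in> Arr C" "f \<in> Arr C" "Dom C q = Cod C f"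
    and z: "q \<cdot> f = Zero C (Dom C f) (Cod C q)"
    using assms unfolding is_cokernel_def by auto
  show "q \<in> Arr C" "Dom C q \<in> Obj C" "Cod C q \<in> Obj C"
    by (auto simp: Cod_Obj)
  fix Z u v
  assume Z: "Z \<in> Obj C" and u: "u \<in> homs C (Cod C q) Z" and v: "v \<in> homs C (Cod C q) Z"
    and eq: "u \<cdot> q = v \<cdot> q"
  have "(u \<cdot> q) \<cdot> f = u \<cdot> Zero C (Dom C f) (Cod C q)"
    using z u by simp
  also have "\<dots> = Zero C (Dom C f) Z"
    using u Z by (simp add: Dom_Obj)
  finally have "\<exists>!h. h \<in> homs C (Cod C q) Z \<and> h \<cdot> q = u \<cdot> q"
    using assms Z u unfolding is_cokernel_def by simp
  then show "u = v"
    using u v eq by metis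
qed

end

context abelian_category
begin

lemma kernelE:
  assumes "f \<in> homs C X Y"
  obtains K k where "is_kernel C k f" "k \<in> homs C K X" "monic C k" "f \<cdot> k = Zero C K Y"
    "\<And>Z g. g \<in> homs C Z X \<Longrightarrow> f \<cdot> g = Zero C Z Y \<Longrightarrow> \<exists>h\<in>homs C Z K. k \<cdot> h = g"
proof -
  obtain k where "is_kernel C k f"
    using ex_kernel assms by auto
  then show thesis
    using that is_kernelD[OF _ assms] kernel_monic by blast
qed

lemma cokernelE:
  assumes "f \<in> homs C X Y"
  obtains Q q where "is_cokernel C q f" "q \<in> homs C Y Q" "epic C q" "q \<cdot> f = Zero C X Q"
    "\<And>Z g. g \<in> homs C Y Z \<Longrightarrow> g \<cdot> f = Zero C X Z \<Longrightarrow> \<exists>h\<in>homs C Q Z. h \<cdot> q = g"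
proof -
  obtain q where "is_cokernel C q f"
    using ex_cokernel assms by auto
  then show thesis
    using that is_cokernelD[OF _ assms] cokernel_epic by blast
qed

lemma monic_kernel_of_cokernel:
  assumes m: "monic C m" "m \<in> homs C X Y" and q: "is_cokernel C q m"
  shows "is_kernel C m q"
proof -
  obtain f where f: "is_kernel C m f"
    using monic_is_kernel[OF m(1)] by blast
  then have fY: "f \<in> homs C Y (Cod C f)"
    using m(2) unfolding is_kernel_def by auto
  note kf = is_kernelD[OF f fY] and cq = is_cokernelD[OF q m(2)]
  have "f \<cdot> m = Zero C X (Cod C f)"
    using kf(2) m(2) by simp
  then obtain f' where f': "f' \<in> homs C (Cod C q) (Cod C f)" "f' \<cdot> q = f"
    using cq(3)[OF fY] by blast
  show ?thesis
  proof (rule is_kernelI[OF m(2) cq(1,2) m(1)])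
    fix Z g
    assume g: "g \<in> homs C Z Y" "q \<cdot> g = Zero C Z (Cod C q)"
    have "Z \<in> Obj C" "Cod C q \<in> Obj C"
      using hom_Obj g(1) cq(1) by blast+
    then have "f \<cdot> g = Zero C Z (Cod C f)"
      using Comp_reassoc[OF f'(2), of g] f' cq(1) g by simp
    then show "\<exists>h\<in>homs C Z X. m \<cdot> h = g"
      using kf(3)[OF g(1)] m(2) by simp
  qed
qed

lemma epic_cokernel_of_kernel:
  assumes q: "epic C q" "q \<in> homs C X Y" and k: "is_kernel C k q"
  shows "is_cokernel C q k"
proof -
  obtain f where f: "is_cokernel C q f"
    using epic_is_cokernel[OF q(1)] by blast
  then have fX: "f \<in> homs C (Dom C f) X"
    using q(2) unfolding is_cokernel_def by auto
  note cf = is_cokernelD[OF f fX] and kq = is_kernelD[OF k q(2)]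
  have "q \<cdot> f = Zero C (Dom C f) Y"
    using cf(2) q(2) by simp
  then obtain f' where f': "f' \<in> homs C (Dom C f) (Dom C k)" "k \<cdot> f' = f"
    using kq(3)[OF fX] by blast
  show ?thesis
  proof (rule is_cokernelI[OF q(2) kq(1,2) q(1)])
    fix Z g
    assume g: "g \<in> homs C X Z" "g \<cdot> k = Zero C (Dom C k) Z"
    have "Z \<in> Obj C"
      using hom_Obj g(1) by blast+
    have "g \<cdot> (k \<cdot> f') = Zero C (Dom C k) Z \<cdot> f'"
      by (rule Comp_reassoc[OF g(2)]) (use f' g kq(1) in auto)
    also have "\<dots> = Zero C (Dom C f) Z"
      using f'(1) \<open>Z \<in> Obj C\<close> by simp
    finally have "g \<cdot> f = Zero C (Dom C f) Z"
      using f'(2) by simp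
    then show "\<exists>h\<in>homs C Y Z. h \<cdot> q = g"
      using cf(3)[OF g(1)] q(2) by simp
  qed
qed

lemma monic_epic_iso:
  assumes "monic C f" "epic C f"
  shows "isomorphism C f"
proof -
  define X Y where "X = Dom C f" and "Y = Cod C f"
  have f: "f \<in> homs C X Y"
    using assms(1) unfolding monic_def X_def Y_def by auto
  have [simp]: "X \<in> Obj C" "Y \<in> Obj C"
    using hom_Obj[OF f] by auto
  obtain Q q where q: "is_cokernel C q f" "q \<in> homs C Y Q" "q \<cdot> f = Zero C X Q"
    using cokernelE[OF f] by metis
  have [simp]: "Q \<in> Obj C"
    using hom_Obj[OF q(2)] by auto
  have "q = Zero C Y Q"
    using epic_zero[OF assms(2), of q Q] q f by simp
  then have "q \<cdot> Id C Y = Zero C Y Q"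
    using q(2) by simp
  then obtain t where t: "t \<in> homs C Y X" "f \<cdot> t = Id C Y"
    using is_kernelD(3)[OF monic_kernel_of_cokernel[OF assms(1) f q(1)] q(2) Id_homs] f by auto
  then show ?thesis
    using split_monic_epic_iso[OF f t(1,2) assms(1)] by blast
qed

text \<open>
  The image of \<open>f\<close> is the kernel \<open>m\<close> of its cokernel. If \<open>w\<close> kills the factor \<open>e\<close> of \<open>f = m e\<close>,
  then \<open>e\<close> factors through the kernel \<open>n\<close> of \<open>w\<close>; as \<open>m n\<close> is itself a kernel, it has to contain
  the image, so that \<open>n\<close> is invertible and \<open>w = 0\<close>.
\<close>

lemma image_factorization:
  assumes f: "f \<in> homs C X Y"
  obtains I m e where "m \<in> homs C I Y" "monic C m" "e \<in> homs C X I" "epic C e" "m \<cdot> e = f"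
proof -
  obtain Q q where q: "q \<in> homs C Y Q" "q \<cdot> f = Zero C X Q"
    and q_fac: "\<And>Z g. g \<in> homs C Y Z \<Longrightarrow> g \<cdot> f = Zero C X Z \<Longrightarrow> \<exists>h\<in>homs C Q Z. h \<cdot> q = g"
    using cokernelE[OF f] by metis
  obtain I m where m: "m \<in> homs C I Y" "monic C m" "q \<cdot> m = Zero C I Q"
    and m_fac: "\<And>Z g. g \<in> homs C Z Y \<Longrightarrow> q \<cdot> g = Zero C Z Q \<Longrightarrow> \<exists>h\<in>homs C Z I. m \<cdot> h = g"
    using kernelE[OF q(1)] by metis
  obtain e where e: "e \<in> homs C X I" "m \<cdot> e = f"
    using m_fac[OF f q(2)] by blast
  have [simp]: "X \<in> Obj C" "I \<in> Obj C" "Y \<in> Obj C" "Q \<in> Obj C"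
    using hom_Obj f q(1) m(1) by blast+
  have "w = Zero C I Z" if w: "w \<in> homs C I Z" "w \<cdot> e = Zero C X Z" for Z w
  proof -
    have [simp]: "Z \<in> Obj C"
      using hom_Obj w(1) by blast
    obtain K n where n: "n \<in> homs C K I" "monic C n" "w \<cdot> n = Zero C K Z"
      and n_fac: "\<And>V g. g \<in> homs C V I \<Longrightarrow> w \<cdot> g = Zero C V Z \<Longrightarrow> \<exists>h\<in>homs C V K. n \<cdot> h = g"
      using kernelE[OF w(1)] by metis
    obtain e' where e': "e' \<in> homs C X K" "n \<cdot> e' = e"
      using n_fac[OF e(1) w(2)] by blast
    have [simp]: "K \<in> Obj C"
      using hom_Obj n(1) by blast
    have mn: "monic C (m \<cdot> n)" "m \<cdot> n \<in> homs C K Y"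
      using monic_Comp[OF n(2) m(2)] m n by auto
    obtain g where g: "is_kernel C (m \<cdot> n) g"
      using monic_is_kernel[OF mn(1)] by blast
    define V where "V = Cod C g"
    have gY: "g \<in> homs C Y V"
      using g mn(2) unfolding is_kernel_def V_def by auto
    have [simp]: "V \<in> Obj C"
      using hom_Obj gY by blast
    have gmn: "g \<cdot> (m \<cdot> n) = Zero C K V"
      using is_kernelD(2)[OF g gY] mn(2) by simp
    have "g \<cdot> f = (g \<cdot> (m \<cdot> n)) \<cdot> e'"
      using e' e(2) gY m n by (auto simp del: e(2) simp flip: e(2) e'(2))
    then have "g \<cdot> f = Zero C X V"
      using gmn e' by simp
    then obtain h where h: "h \<in> homs C Q V" "h \<cdot> q = g"
      using q_fac[OF gY] by blast
    have "g \<cdot> m = h \<cdot> (q \<cdot> m)"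
      using h(1) q(1) m(1) by (simp flip: h(2))
    then have "g \<cdot> m = Zero C I V"
      using h(1) m(3) by simp
    then obtain t where t: "t \<in> homs C I K" "(m \<cdot> n) \<cdot> t = m"
      using is_kernelD(3)[OF g gY m(1)] mn(2) by auto
    have "m \<cdot> (n \<cdot> t) = m \<cdot> Id C I"
      using t m n by simp
    then have nt: "n \<cdot> t = Id C I"
      by (rule monic_cancel[OF m(2), rotated -1]) (use m n t in auto)
    have "w = w \<cdot> (n \<cdot> t)"
      unfolding nt using w by simp
    also have "\<dots> = (w \<cdot> n) \<cdot> t"
      using w(1) n(1) t(1) by simp
    also have "\<dots> = Zero C I Z"
      unfolding n(3) using t(1) by simp
    finally show "w = Zero C I Z" .
  qed
  then have "epic C e"
    unfolding epic_iff using e by auto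
  then show thesis
    using that m e by blast
qed

lemma short_exact_monic:
  assumes "monic C m" "m \<in> homs C X Y" "is_cokernel C q m"
  shows "short_exact C m q"
  using monic_kernel_of_cokernel[OF assms] assms(3) unfolding short_exact_def by blast

lemma short_exact_epic:
  assumes "epic C q" "q \<in> homs C X Y" "is_kernel C k q"
  shows "short_exact C k q"
  using epic_cokernel_of_kernel[OF assms] assms(3) unfolding short_exact_def by blast

text \<open>
  The complement of a retract is the kernel \<open>k\<close> of the retraction \<open>r\<close>: the idempotent
  \<open>w = 1 - s r\<close> is killed by \<open>r\<close>, so it factors as \<open>w = k t\<close>, and \<open>s, k, r, t\<close> satisfy the
  equations of a biproduct.
\<close>

lemma retract_direct_summand:
  assumes "s \<in> homs C Z S" "r \<in> homs C S Z" "r \<cdot> s = Id C Z"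
  obtains W where "direct_sum_list C S [Z, W]" "zero_object C W \<Longrightarrow> isomorphism C s"
proof -
  have [simp]: "Z \<in> Obj C" "S \<in> Obj C"
    using hom_Obj[OF assms(1)] by auto
  obtain W k where k: "k \<in> homs C W S" "monic C k" "r \<cdot> k = Zero C W Z"
    and k_fac: "\<And>V g. g \<in> homs C V S \<Longrightarrow> r \<cdot> g = Zero C V Z \<Longrightarrow> \<exists>h\<in>homs C V W. k \<cdot> h = g"
    using kernelE[OF assms(2)] by metis
  have [simp]: "W \<in> Obj C"
    using hom_Obj[OF k(1)] by auto
  have sr: "s \<cdot> r \<in> homs C S S"
    using assms by simp
  obtain w where w: "w \<in> homs C S S" "Add C w (s \<cdot> r) = Id C S"
    using ex_difference[OF Id_homs sr] by auto
  have "Add C (r \<cdot> w) r = Add C (r \<cdot> w) ((r \<cdot> s) \<cdot> r)"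
    using assms by simp
  also have "\<dots> = r \<cdot> Add C w (s \<cdot> r)"
    using w(1) assms(1,2) by simp
  also have "\<dots> = Add C (Zero C S Z) r"
    using w(2) assms by simp
  finally have "r \<cdot> w = Zero C S Z"
    by (rule Add_cancel_right[rotated -1]) (use w assms in auto)
  then obtain t where t: "t \<in> homs C S W" "k \<cdot> t = w"
    using k_fac[OF w(1)] by blast
  have "Add C (w \<cdot> s) s = Add C (w \<cdot> s) (s \<cdot> (r \<cdot> s))"
    using assms by simp
  also have "\<dots> = Add C w (s \<cdot> r) \<cdot> s"
    using w(1) assms(1,2) by simp
  also have "\<dots> = Add C (Zero C Z S) s"
    using w(2) assms by simp
  finally have "w \<cdot> s = Zero C Z S"
    by (rule Add_cancel_right[rotated -1]) (use w assms in auto)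
  then have "k \<cdot> (t \<cdot> s) = Zero C Z S"
    using t(1) k(1) assms(1) by (simp flip: t(2))
  then have ts: "t \<cdot> s = Zero C Z W"
    using monic_zero[OF k(2), of "t \<cdot> s" Z] t(1) k(1) assms(1) by simp
  have "w \<cdot> k = Add C (w \<cdot> k) (s \<cdot> (r \<cdot> k))"
    using k w assms by simp
  also have "\<dots> = Add C w (s \<cdot> r) \<cdot> k"
    using w(1) k assms(1,2) by simp
  also have "\<dots> = k"
    using w(2) k by simp
  finally have "k \<cdot> (t \<cdot> k) = k \<cdot> Id C W"
    using t(1) k(1) by (simp flip: t(2))
  then have tk: "t \<cdot> k = Id C W"
    by (rule monic_cancel[OF k(2), rotated -1]) (use k t in auto)
  have sum: "Add C (k \<cdot> t) (s \<cdot> r) = Id C S"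
    using w t by simp
  have sum': "Add C (s \<cdot> r) (k \<cdot> t) = Id C S"
  proof -
    interpret G: comm_group "hom_group C S S"
      using hom_comm_group by simp
    show ?thesis
      using G.m_comm[of "s \<cdot> r" "k \<cdot> t"] sum k t assms by (auto simp: hom_group_def)
  qed
  have "direct_sum_list C S [Z, W]"
    by (rule biproduct_direct_sum[OF assms(1) k(1) assms(2) t(1) assms(3) tk k(3) ts sum'])
  moreover have "isomorphism C s" if "zero_object C W"
  proof -
    have "k \<cdot> t = Zero C S S"
      using zero_object_hom(1)[OF that t(1)] k by simp
    then have "s \<cdot> r = Id C S"
      using sum sr by simp
    then show ?thesis
      using isomorphismI[OF assms(1,2,3)] by blast
  qed
  ultimately show thesis
    using that by blast
qed

lemma direct_summand_iff_retract: "direct_summand C Z S \<longleftrightarrow> retract C Z S"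
proof
  assume "retract C Z S"
  then obtain s r where "s \<in> homs C Z S" "r \<in> homs C S Z" "r \<cdot> s = Id C Z"
    unfolding retract_def by blast
  then obtain W where "direct_sum_list C S [Z, W]"
    by (rule retract_direct_summand)
  then show "direct_summand C Z S"
    unfolding direct_summand_def by blast
qed (rule direct_summand_retract)

lemma indecomposable_retract_iso:
  assumes "indecomposable C Y" "\<not> zero_object C Z"
    and "s \<in> homs C Z Y" "r \<in> homs C Y Z" "r \<cdot> s = Id C Z"
  shows "isomorphism C s"
proof -
  obtain W where W: "direct_sum_list C Y [Z, W]" "zero_object C W \<Longrightarrow> isomorphism C s"
    using retract_direct_summand[OF assms(3-5)] by blast
  then show ?thesis
    using assms(1,2) unfolding indecomposable_def by blast
qed

end


lemma sub_leI:
  assumes "n \<cdot>\<^bsub>C\<^esub> h = m" "m \<in> homs C U X" "n \<in> homs C V X" "h \<in> homs C U V"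
  shows "sub_le C m n"
  using assms unfolding sub_le_def by auto

lemma sub_leE:
  assumes "sub_le C m n" "m \<in> homs C U X" "n \<in> homs C V X"
  obtains h where "h \<in> homs C U V" "n \<cdot>\<^bsub>C\<^esub> h = m"
  using assms unfolding sub_le_def by auto


section \<open>Length functions\<close>

locale length_category = abelian_length_category +
  fixes lam
  assumes length_function: "length_function C lam"
begin

lemma lam_nonneg: "X \<in> Obj C \<Longrightarrow> 0 \<le> lam X"
  and lam_zero_iff: "X \<in> Obj C \<Longrightarrow> lam X = 0 \<longleftrightarrow> zero_object C X"
  and lam_short_exact: "short_exact C f g \<Longrightarrow> lam (Cod C f) = lam (Dom C f) + lam (Cod C g)"
  using length_function unfolding length_function_def by blast+

lemma lam_cokernel:
  assumes "monic C m" "m \<in> homs C X Y" "is_cokernel C q m"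
  shows "lam Y = lam X + lam (Cod C q)"
  using lam_short_exact[OF short_exact_monic[OF assms]] assms(2) by simp

lemma lam_kernel:
  assumes "epic C q" "q \<in> homs C X Y" "is_kernel C k q"
  shows "lam X = lam (Dom C k) + lam Y"
  using lam_short_exact[OF short_exact_epic[OF assms]] is_kernelD(1)[OF assms(3,2)] assms(2) by simp

lemma lam_monic_le:
  assumes "monic C m" "m \<in> homs C X Y"
  shows "lam X \<le> lam Y"
proof -
  obtain Q q where "is_cokernel C q m" "q \<in> homs C Y Q"
    using cokernelE[OF assms(2)] by metis
  then show ?thesis
    using lam_cokernel[OF assms] lam_nonneg[of Q] hom_Obj by fastforce
qed

lemma lam_epic_le:
  assumes "epic C e" "e \<in> homs C X Y"
  shows "lam Y \<le> lam X"
proof -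
  obtain K k where "is_kernel C k e" "k \<in> homs C K X"
    using kernelE[OF assms(2)] by metis
  then show ?thesis
    using lam_kernel[OF assms] lam_nonneg[of K] hom_Obj by fastforce
qed

lemma monic_lam_eq_iso:
  assumes "monic C m" "m \<in> homs C X Y" "lam Y \<le> lam X"
  shows "isomorphism C m"
proof -
  obtain Q q where q: "is_cokernel C q m" "q \<in> homs C Y Q" "q \<cdot> m = Zero C X Q"
    and fac: "\<And>Z g. g \<in> homs C Y Z \<Longrightarrow> g \<cdot> m = Zero C X Z \<Longrightarrow> \<exists>h\<in>homs C Q Z. h \<cdot> q = g"
    using cokernelE[OF assms(2)] by metis
  have "Q \<in> Obj C"
    using hom_Obj q(2) by blast
  then have Q: "zero_object C Q"
    using lam_cokernel[OF assms(1,2) q(1)] assms(3) lam_nonneg[of Q] lam_zero_iff[of Q] q(2) by simp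
  have "epic C m"
    unfolding epic_iff
  proof (intro conjI allI impI)
    fix Z u
    assume u: "u \<in> homs C (Cod C m) Z \<and> u \<cdot> m = Zero C (Dom C m) Z"
    then obtain h where h: "h \<in> homs C Q Z" "h \<cdot> q = u"
      using fac[of u Z] assms(2) by auto
    have "Z \<in> Obj C"
      using hom_Obj u by blast
    then show "u = Zero C (Cod C m) Z"
      using h q(2) zero_object_hom(2)[OF Q h(1)] assms(2) by auto
  qed (use assms in auto)
  then show ?thesis
    using monic_epic_iso assms(1) by blast
qed

lemma epic_lam_eq_iso:
  assumes "epic C e" "e \<in> homs C X Y" "lam X \<le> lam Y"
  shows "isomorphism C e"
proof -
  obtain K k where k: "is_kernel C k e" "k \<in> homs C K X" "e \<cdot> k = Zero C K Y"
    and fac: "\<And>Z g. g \<in> homs C Z X \<Longrightarrow> e \<cdot> g = Zero C Z Y \<Longrightarrow> \<exists>h\<in>homs C Z K. k \<cdot> h = g"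
    using kernelE[OF assms(2)] by metis
  have "K \<in> Obj C"
    using hom_Obj k(2) by blast
  then have K: "zero_object C K"
    using lam_kernel[OF assms(1,2) k(1)] assms(3) lam_nonneg[of K] lam_zero_iff[of K] k(2) by simp
  have "monic C e"
    unfolding monic_iff
  proof (intro conjI allI impI)
    fix Z u
    assume u: "u \<in> homs C Z (Dom C e) \<and> e \<cdot> u = Zero C Z (Cod C e)"
    then obtain h where h: "h \<in> homs C Z K" "k \<cdot> h = u"
      using fac[of u Z] assms(2) by auto
    have "Z \<in> Obj C"
      using hom_Obj u by blast
    then show "u = Zero C Z (Dom C e)"
      using h k(2) zero_object_hom(1)[OF K h(1)] assms(2) by auto
  qed (use assms in auto)
  then show ?thesis
    using monic_epic_iso assms(1) by blast
qed

lemma lam_iso: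
  assumes "isomorphism C f" "f \<in> homs C X Y"
  shows "lam X = lam Y"
proof -
  obtain g where g: "g \<in> homs C Y X" "g \<cdot> f = Id C X" "f \<cdot> g = Id C Y"
    using isomorphismE[OF assms] by metis
  then have "monic C f" "monic C g"
    using split_monic[OF assms(2) g(1,2)] split_monic[OF g(1) assms(2) g(3)] by auto
  then show ?thesis
    using lam_monic_le assms(2) g(1) by (metis order_antisym)
qed

lemma maximal_subobject:
  assumes "X \<in> Obj C" "S \<noteq> {}" "\<And>m. m \<in> S \<Longrightarrow> subobject C m X"
  shows "\<exists>m\<in>S. \<forall>n\<in>S. sub_le C m n \<longrightarrow> sub_le C n m"
proof (rule ccontr)
  assume "\<not> ?thesis"
  then have *: "\<exists>n. n \<in> S \<and> sub_le C m n \<and> \<not> sub_le C n m" if "m \<in> S" for m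
    using that by blast
  have "\<exists>f. \<forall>i::nat. f i \<in> S \<and> (sub_le C (f i) (f (Suc i)) \<and> \<not> sub_le C (f (Suc i)) (f i))"
    using assms(2) * by (intro dependent_nat_choice) auto
  then obtain f where f: "\<And>i::nat. f i \<in> S" "\<And>i. sub_le C (f i) (f (Suc i))"
      "\<And>i. \<not> sub_le C (f (Suc i)) (f i)"
    by blast
  then obtain N where "\<forall>i\<ge>N. sub_le C (f i) (f N)"
    using acc[of X f] assms by blast
  then show False
    using f(3)[of N] by simp
qed

lemma minimal_subobject:
  assumes "X \<in> Obj C" "S \<noteq> {}" "\<And>m. m \<in> S \<Longrightarrow> subobject C m X"
  shows "\<exists>m\<in>S. \<forall>n\<in>S. sub_le C n m \<longrightarrow> sub_le C m n"
proof (rule ccontr)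
  assume "\<not> ?thesis"
  then have *: "\<exists>n. n \<in> S \<and> sub_le C n m \<and> \<not> sub_le C m n" if "m \<in> S" for m
    using that by blast
  have "\<exists>f. \<forall>i::nat. f i \<in> S \<and> (sub_le C (f (Suc i)) (f i) \<and> \<not> sub_le C (f i) (f (Suc i)))"
    using assms(2) * by (intro dependent_nat_choice) auto
  then obtain f where f: "\<And>i::nat. f i \<in> S" "\<And>i. sub_le C (f (Suc i)) (f i)"
      "\<And>i. \<not> sub_le C (f i) (f (Suc i))"
    by blast
  then obtain N where "\<forall>i\<ge>N. sub_le C (f N) (f i)"
    using dcc[of X f] assms by blast
  then show False
    using f(3)[of N] by simp
qed

definition sub_values :: "'a \<Rightarrow> real set" where
  "sub_values X = {lam (Dom C m) | m. subobject C m X}"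

lemma sub_valuesI: "monic C m \<Longrightarrow> m \<in> homs C U X \<Longrightarrow> lam U \<in> sub_values X"
  unfolding sub_values_def subobject_def by auto

lemma sub_valuesE:
  assumes "x \<in> sub_values X"
  obtains m U where "monic C m" "m \<in> homs C U X" "x = lam U"
  using assms unfolding sub_values_def subobject_def monic_def by auto

lemma sub_values_monic:
  assumes "monic C m" "m \<in> homs C X Y"
  shows "sub_values X \<subseteq> sub_values Y"
proof
  fix x
  assume "x \<in> sub_values X"
  then obtain n U where n: "monic C n" "n \<in> homs C U X" "x = lam U"
    by (rule sub_valuesE)
  then show "x \<in> sub_values Y"
    using sub_valuesI[OF monic_Comp[OF n(1) assms(1)], of U Y] assms by simp
qed

text \<open>
  If \<open>N\<close> is a maximal proper subobject of \<open>M\<close>, then a subobject \<open>U\<close> of \<open>M\<close> either lies in \<open>N\<close> or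
  satisfies \<open>U + N = M\<close>; in the second case \<open>\<lambda>(U) = \<lambda>(U \<inter> N) + \<lambda>(M) - \<lambda>(N)\<close>.
\<close>

lemma sub_values_maximal_proper:
  assumes n: "monic C n" "n \<in> homs C N M"
    and max: "\<And>p P. monic C p \<Longrightarrow> p \<in> homs C P M \<Longrightarrow> sub_le C n p \<Longrightarrow> \<not> isomorphism C p \<Longrightarrow>
      sub_le C p n"
  shows "sub_values M \<subseteq> sub_values N \<union> (\<lambda>x. x + (lam M - lam N)) ` sub_values N"
proof
  fix x
  assume "x \<in> sub_values M"
  then obtain u U where u: "monic C u" "u \<in> homs C U M" "x = lam U"
    by (rule sub_valuesE)
  obtain Z q where q: "is_cokernel C q n" "q \<in> homs C M Z" "epic C q" "q \<cdot> n = Zero C N Z"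
    using cokernelE[OF n(2)] by metis
  have qu: "q \<cdot> u \<in> homs C U Z"
    using q u by simp
  obtain I m e where m: "m \<in> homs C I Z" "monic C m" and e: "e \<in> homs C U I" "epic C e"
    and me: "m \<cdot> e = q \<cdot> u"
    using image_factorization[OF qu] .
  obtain Q c where c: "is_cokernel C c m" "c \<in> homs C Z Q" "epic C c" "c \<cdot> m = Zero C I Q"
    using cokernelE[OF m(1)] by metis
  have cq: "c \<cdot> q \<in> homs C M Q"
    using c q by simp
  obtain P p where p: "p \<in> homs C P M" "monic C p" "(c \<cdot> q) \<cdot> p = Zero C P Q"
    and p_fac: "\<And>V g. g \<in> homs C V M \<Longrightarrow> (c \<cdot> q) \<cdot> g = Zero C V Q \<Longrightarrow> \<exists>h\<in>homs C V P. p \<cdot> h = g"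
    using kernelE[OF cq] by metis
  have [simp]: "M \<in> Obj C" "N \<in> Obj C" "U \<in> Obj C" "Z \<in> Obj C" "Q \<in> Obj C" "I \<in> Obj C"
    using hom_Obj n(2) u(2) q(2) c(2) m(1) by blast+
  have "(c \<cdot> q) \<cdot> n = Zero C N Q"
    using c q n by simp
  then have np: "sub_le C n p"
    using p_fac[OF n(2)] sub_leI[OF _ n(2) p(1)] by blast
  show "x \<in> sub_values N \<union> (\<lambda>x. x + (lam M - lam N)) ` sub_values N"
  proof (cases "isomorphism C p")
    case False
    have "(c \<cdot> q) \<cdot> u = c \<cdot> (m \<cdot> e)"
      unfolding me using c q u by simp
    also have "\<dots> = (c \<cdot> m) \<cdot> e"
      using c(2) m(1) e(1) by simp
    also have "\<dots> = Zero C U Q"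
      unfolding c(4) using e(1) by simp
    finally have "(c \<cdot> q) \<cdot> u = Zero C U Q" .
    then obtain h where h: "h \<in> homs C U P" "p \<cdot> h = u"
      using p_fac[OF u(2)] by blast
    obtain h' where h': "h' \<in> homs C P N" "n \<cdot> h' = p"
      using sub_leE[OF max[OF p(2,1) np False] p(1) n(2)] .
    have "n \<cdot> (h' \<cdot> h) = u"
      using h(1) h'(1) n(2) by (simp flip: h(2) h'(2))
    then have "monic C (h' \<cdot> h)"
      using monic_left_factor[of n "h' \<cdot> h"] h(1) h'(1) n(2) u(1) by simp
    then have "lam U \<in> sub_values N"
      using h h' by (intro sub_valuesI) auto
    then show ?thesis
      using u by blast
  next
    case True
    obtain t where t: "t \<in> homs C M P" "p \<cdot> t = Id C M"
      using isomorphismE[OF True p(1)] .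
    have "c \<cdot> q = (c \<cdot> q) \<cdot> (p \<cdot> t)"
      unfolding t(2) using c(2) q(2) by simp
    also have "\<dots> = ((c \<cdot> q) \<cdot> p) \<cdot> t"
      using c(2) q(2) p(1) t(1) by simp
    also have "\<dots> = Zero C M Q"
      unfolding p(3) using t(1) by simp
    finally have "c \<cdot> q = Zero C M Q" .
    then have "c = Zero C Z Q"
      using epic_zero[OF q(3), of c Q] c q by simp
    then have "Id C Q = Zero C Q Q"
      using epic_zero[OF c(3), of "Id C Q" Q] c by simp
    then have "lam Q = 0"
      using lam_zero_iff zero_object_iff by simp
    then have lam_I: "lam I = lam Z"
      using lam_cokernel[OF m(2,1) c(1)] c by simp
    obtain K k where k: "is_kernel C k e" "k \<in> homs C K U" "monic C k" "e \<cdot> k = Zero C K I"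
      using kernelE[OF e(1)] by metis
    have "K \<in> Obj C"
      using hom_Obj k(2) by blast
    have lam_U: "lam U = lam K + lam Z"
      using lam_kernel[OF e(2,1) k(1)] lam_I k by simp
    have lam_M: "lam M = lam N + lam Z"
      using lam_cokernel[OF n q(1)] q by simp
    have "q \<cdot> (u \<cdot> k) = (q \<cdot> u) \<cdot> k"
      using q u k by simp
    also have "\<dots> = m \<cdot> (e \<cdot> k)"
      using m e k by (simp flip: me)
    also have "\<dots> = Zero C K Z"
      using m k \<open>K \<in> Obj C\<close> by simp
    finally obtain h where h: "h \<in> homs C K N" "n \<cdot> h = u \<cdot> k"
      using is_kernelD(3)[OF monic_kernel_of_cokernel[OF n q(1)] q(2), of "u \<cdot> k" K] u k n by auto
    have "monic C (n \<cdot> h)"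
      using monic_Comp[OF k(3) u(1)] u k h by simp
    then have "monic C h"
      using monic_left_factor[of n h] h n by simp
    then have "lam K \<in> sub_values N"
      using h by (intro sub_valuesI)
    moreover have "x = lam K + (lam M - lam N)"
      using u(3) lam_U lam_M by simp
    ultimately show ?thesis
      by blast
  qed
qed

text \<open>
  Otherwise there is a minimal subobject \<open>M\<close> with infinitely many values. All proper subobjects of
  \<open>M\<close> then have finitely many values, and since \<open>M\<close> has a maximal proper subobject (unless it has
  no proper subobjects at all), so does \<open>M\<close>.
\<close>

lemma finite_sub_values:
  assumes X: "X \<in> Obj C"
  shows "finite (sub_values X)"
proof (rule ccontr)
  assume inf: "infinite (sub_values X)"
  define S where "S = {m. subobject C m X \<and> infinite (sub_values (Dom C m))}"
  have "Id C X \<in> S"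
    using X inf monic_Id by (auto simp: S_def subobject_def)
  then obtain m where m: "m \<in> S" and m_min: "\<And>n. n \<in> S \<Longrightarrow> sub_le C n m \<Longrightarrow> sub_le C m n"
    using minimal_subobject[of X S] X unfolding S_def by blast
  define M where "M = Dom C m"
  have mX: "m \<in> homs C M X" "monic C m" and inf_M: "infinite (sub_values M)"
    using m unfolding S_def M_def subobject_def monic_def by auto
  have M: "M \<in> Obj C"
    using hom_Obj mX(1) by blast
  have proper: "finite (sub_values N)" if n: "monic C n" "n \<in> homs C N M" "\<not> isomorphism C n" for n N
  proof (rule ccontr)
    assume "infinite (sub_values N)"
    then have "m \<cdot> n \<in> S"
      using monic_Comp[OF n(1) mX(2)] n mX by (auto simp: S_def subobject_def)
    moreover have mn: "m \<cdot> n \<in> homs C N X"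
      using n mX by simp
    moreover have "sub_le C (m \<cdot> n) m"
      using n(2) by (intro sub_leI[OF _ mn mX(1)]) auto
    ultimately have "sub_le C m (m \<cdot> n)"
      using m_min by blast
    then obtain t where t: "t \<in> homs C M N" "(m \<cdot> n) \<cdot> t = m"
      using sub_leE mX(1) mn by metis
    then have "m \<cdot> (n \<cdot> t) = m \<cdot> Id C M"
      using n mX by simp
    then have "n \<cdot> t = Id C M"
      by (rule monic_cancel[OF mX(2), rotated -1]) (use n t mX M in auto)
    then show False
      using split_monic_epic_iso[OF n(2) t(1) _ n(1)] n(3) by blast
  qed
  define T where "T = {n. subobject C n M \<and> \<not> isomorphism C n}"
  show False
  proof (cases "T = {}")
    case True
    have "sub_values M \<subseteq> {lam M}"
    proof
      fix x
      assume "x \<in> sub_values M"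
      then obtain u U where u: "monic C u" "u \<in> homs C U M" "x = lam U"
        by (rule sub_valuesE)
      then have "isomorphism C u"
        using True unfolding T_def subobject_def by auto
      then show "x \<in> {lam M}"
        using lam_iso u by blast
    qed
    then show False
      using inf_M finite_subset by blast
  next
    case False
    then obtain n where n: "n \<in> T" and n_max: "\<And>p. p \<in> T \<Longrightarrow> sub_le C n p \<Longrightarrow> sub_le C p n"
      using maximal_subobject[of M T] M unfolding T_def by blast
    have n': "monic C n" "n \<in> homs C (Dom C n) M" "\<not> isomorphism C n"
      using n unfolding T_def subobject_def monic_def by auto
    have "sub_values M \<subseteq> sub_values (Dom C n) \<union>
        (\<lambda>x. x + (lam M - lam (Dom C n))) ` sub_values (Dom C n)"
    proof (rule sub_values_maximal_proper[OF n'(1,2)])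
      fix p P
      assume "monic C p" "p \<in> homs C P M" "sub_le C n p" "\<not> isomorphism C p"
      then show "sub_le C p n"
        by (intro n_max) (auto simp: T_def subobject_def)
    qed
    then show False
      using inf_M proper[OF n'] by (meson finite_UnI finite_imageI finite_subset)
  qed
qed

text \<open>
  The number of values of \<open>\<lambda>\<close> on subobjects replaces the composition length: it is a natural
  number that drops when one passes to a proper subobject or to a proper quotient.
\<close>

definition sub_size :: "'a \<Rightarrow> nat" where
  "sub_size X = card (sub_values X)"

lemma sub_size_monic_less:
  assumes "monic C m" "m \<in> homs C X Y" "\<not> isomorphism C m"
  shows "sub_size X < sub_size Y"
proof -
  have Y: "Y \<in> Obj C"
    using hom_Obj assms(2) by blast
  have "lam X < lam Y"
    using monic_lam_eq_iso[OF assms(1,2)] assms(3) by linarith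
  then have "lam Y \<notin> sub_values X"
    using lam_monic_le by (metis sub_valuesE not_le)
  moreover have "lam Y \<in> sub_values Y"
    using sub_valuesI[OF monic_Id[OF Y]] Y by simp
  ultimately have "sub_values X \<subset> sub_values Y"
    using sub_values_monic[OF assms(1,2)] by blast
  then show ?thesis
    unfolding sub_size_def using finite_sub_values[OF Y] psubset_card_mono by blast
qed

text \<open>
  The preimage in \<open>X\<close> of a subobject \<open>V\<close> of the quotient \<open>Y\<close> has the value
  \<open>\<lambda>(V) + \<lambda>(X) - \<lambda>(Y)\<close>. This embeds the values of \<open>Y\<close> into those of \<open>X\<close> and misses the value \<open>0\<close>.
\<close>

lemma sub_size_epic_less:
  assumes "epic C e" "e \<in> homs C X Y" "\<not> isomorphism C e"
  shows "sub_size Y < sub_size X"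
proof -
  have [simp]: "X \<in> Obj C" "Y \<in> Obj C"
    using hom_Obj assms(2) by blast+
  define d where "d = lam X - lam Y"
  have "0 < d"
    using epic_lam_eq_iso[OF assms(1,2)] assms(3) unfolding d_def by linarith
  have "(\<lambda>x. x + d) ` sub_values Y \<subseteq> sub_values X - {0}"
  proof
    fix y
    assume "y \<in> (\<lambda>x. x + d) ` sub_values Y"
    then obtain v V where v: "monic C v" "v \<in> homs C V Y" and y: "y = lam V + d"
      by (auto elim: sub_valuesE)
    obtain Q c where c: "is_cokernel C c v" "c \<in> homs C Y Q" "epic C c"
      using cokernelE[OF v(2)] by metis
    have ce: "epic C (c \<cdot> e)" "c \<cdot> e \<in> homs C X Q"
      using epic_Comp[OF assms(1) c(3)] assms(2) c by auto
    obtain P p where p: "is_kernel C p (c \<cdot> e)" "p \<in> homs C P X" "monic C p"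
      using kernelE[OF ce(2)] by metis
    have "lam X = lam P + lam Q"
      using lam_kernel[OF ce p(1)] p by simp
    moreover have "lam Y = lam V + lam Q"
      using lam_cokernel[OF v c(1)] c by simp
    ultimately have "y = lam P"
      unfolding y d_def by simp
    moreover have "0 \<le> lam V"
      using lam_nonneg hom_Obj v(2) by blast
    ultimately show "y \<in> sub_values X - {0}"
      using sub_valuesI[OF p(3,2)] y \<open>0 < d\<close> by simp
  qed
  moreover have "0 \<in> sub_values X"
  proof -
    obtain N where N: "zero_object C N"
      using ex_zero_object by blast
    then have "N \<in> Obj C" "lam N = 0"
      using zero_object_iff lam_zero_iff by auto
    moreover have "monic C (Zero C N X)"
      unfolding monic_iff using zero_object_hom(1)[OF N] \<open>N \<in> Obj C\<close> by auto
    ultimately show ?thesis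
      using sub_valuesI[of "Zero C N X" N X] by simp
  qed
  ultimately have "(\<lambda>x. x + d) ` sub_values Y \<subset> sub_values X"
    by blast
  then have "card ((\<lambda>x. x + d) ` sub_values Y) < sub_size X"
    unfolding sub_size_def using finite_sub_values[of X] by (simp add: psubset_card_mono)
  then show ?thesis
    unfolding sub_size_def by (simp add: card_image inj_on_def)
qed

lemma proper_summand:
  assumes i: "i \<in> homs C U X" and j: "j \<in> homs C V X" and q: "q \<in> homs C X V"
    and eqs: "q \<cdot> i = Zero C U V" "q \<cdot> j = Id C V" and V: "\<not> zero_object C V"
  shows "\<not> isomorphism C i"
proof
  assume "isomorphism C i"
  then obtain g where g: "g \<in> homs C X U" "i \<cdot> g = Id C X"
    using isomorphismE i by metis
  have [simp]: "V \<in> Obj C"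
    using hom_Obj j by blast
  have "Id C V = q \<cdot> ((i \<cdot> g) \<cdot> j)"
    using j g(2) eqs by simp
  also have "\<dots> = (q \<cdot> i) \<cdot> (g \<cdot> j)"
    using i j g(1) q by simp
  also have "\<dots> = Zero C V V"
    using eqs(1) g(1) j by simp
  finally show False
    using V zero_object_iff by simp
qed

lemma ex_indecomposable_decomposition:
  assumes "X \<in> Obj C"
  shows "\<exists>Ys. (\<forall>Y\<in>set Ys. indecomposable C Y) \<and> direct_sum_list C X Ys"
  using assms
proof (induction "sub_size X" arbitrary: X rule: less_induct)
  case less
  show ?case
  proof (cases "zero_object C X \<or> indecomposable C X")
    case True
    then show ?thesis
    proof
      assume "zero_object C X"
      then have "direct_sum_list C X []"
        unfolding direct_sum_list_def by (intro direct_sum_zero) auto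
      then show ?thesis
        by (intro exI[of _ "[]"]) simp
    next
      assume "indecomposable C X"
      then show ?thesis
        using direct_sum_list_single[OF less(2)] by (intro exI[of _ "[X]"]) simp
    qed
  next
    case False
    then obtain U V where UV: "direct_sum_list C X [U, V]" "\<not> zero_object C U" "\<not> zero_object C V"
      using less(2) unfolding indecomposable_def by blast
    obtain i j p q where i: "i \<in> homs C U X" and j: "j \<in> homs C V X"
      and p: "p \<in> homs C X U" and q: "q \<in> homs C X V"
      and eqs: "p \<cdot> i = Id C U" "q \<cdot> j = Id C V" "p \<cdot> j = Zero C V U" "q \<cdot> i = Zero C U V"
      using UV(1) by (rule direct_sum_biproduct)
    have [simp]: "U \<in> Obj C" "V \<in> Obj C"
      using hom_Obj i j by blast+
    have mono: "monic C i" "monic C j"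
      using split_monic[OF i p eqs(1)] split_monic[OF j q eqs(2)] .
    have "\<not> isomorphism C i" "\<not> isomorphism C j"
      using proper_summand[OF i j q eqs(4,2) UV(3)] proper_summand[OF j i p eqs(3,1) UV(2)] .
    then have "sub_size U < sub_size X" "sub_size V < sub_size X"
      using sub_size_monic_less mono i j by blast+
    then obtain Ys Zs where "\<forall>Y\<in>set Ys. indecomposable C Y" "direct_sum_list C U Ys"
      "\<forall>Y\<in>set Zs. indecomposable C Y" "direct_sum_list C V Zs"
      using less(1)[of U] less(1)[of V] by auto
    then show ?thesis
      using direct_sum_append[OF _ _ UV(1)] by (intro exI[of _ "Ys @ Zs"]) auto
  qed
qed

end


section \<open>The order on finite sets of reals\<close>

text \<open>
  The sets agree below \<open>x\<close>, and \<open>x\<close> is the first point at which they differ. In this form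
  transitivity is visible: the smaller one of two such points works for the composite.
\<close>

lemma gr_less_iff:
  assumes "finite I" "finite J"
  shows "gr_less I J \<longleftrightarrow> (\<exists>x\<in>J - I. \<forall>y<x. y \<in> I \<longleftrightarrow> y \<in> J)"
proof -
  define D where "D = (I - J) \<union> (J - I)"
  have fin: "finite D"
    using assms by (auto simp: D_def)
  show ?thesis
  proof
    assume less: "gr_less I J"
    then have "D \<noteq> {}"
      unfolding gr_less_def D_def by blast
    then have "Min D \<in> D"
      using fin by (rule Min_in[rotated])
    moreover have "y \<notin> D" if "y < Min D" for y
      using Min_le[OF fin, of y] that by auto
    moreover have "Min D \<in> J"
      using less unfolding gr_less_def D_def by blast
    ultimately show "\<exists>x\<in>J - I. \<forall>y<x. y \<in> I \<longleftrightarrow> y \<in> J"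
      unfolding D_def by (intro bexI[of _ "Min D"]) (auto simp: D_def)
  next
    assume "\<exists>x\<in>J - I. \<forall>y<x. y \<in> I \<longleftrightarrow> y \<in> J"
    then obtain x where x: "x \<in> J - I" "\<And>y. y < x \<Longrightarrow> y \<in> I \<longleftrightarrow> y \<in> J"
      by blast
    then have "Min D = x"
      using fin by (intro Min_eqI) (auto simp: D_def intro: leI)
    then show "gr_less I J"
      using x unfolding gr_less_def D_def by auto
  qed
qed

lemma gr_less_trans:
  assumes "finite I" "finite J" "finite K" "gr_less I J" "gr_less J K"
  shows "gr_less I K"
proof -
  obtain x where x: "x \<in> J - I" "\<And>y. y < x \<Longrightarrow> y \<in> I \<longleftrightarrow> y \<in> J"
    using assms by (auto simp: gr_less_iff)
  obtain z where z: "z \<in> K - J" "\<And>y. y < z \<Longrightarrow> y \<in> J \<longleftrightarrow> y \<in> K"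
    using assms by (auto simp: gr_less_iff)
  have "min x z \<in> K - I"
    using x(1) z(1) x(2)[of z] z(2)[of x] by (auto simp: min_def not_le)
      (metis order_le_less)+
  moreover have "y \<in> I \<longleftrightarrow> y \<in> K" if "y < min x z" for y
    using x(2)[of y] z(2)[of y] that by simp
  ultimately show ?thesis
    using gr_less_iff[OF assms(1,3)] by blast
qed

lemma gr_less_irrefl [simp]: "\<not> gr_less I I"
  by (simp add: gr_less_def)

lemma gr_less_total:
  assumes "finite I" "finite J"
  shows "I = J \<or> gr_less I J \<or> gr_less J I"
proof -
  have "Min ((I - J) \<union> (J - I)) \<in> (I - J) \<union> (J - I)" if "I \<noteq> J"
    using assms that by (intro Min_in) auto
  moreover have "(J - I) \<union> (I - J) = (I - J) \<union> (J - I)"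
    by blast
  ultimately show ?thesis
    unfolding gr_less_def by auto
qed

definition gr_le :: "real set \<Rightarrow> real set \<Rightarrow> bool" where
  "gr_le I J \<longleftrightarrow> I = J \<or> gr_less I J"

lemma gr_le_refl [simp]: "gr_le I I"
  by (simp add: gr_le_def)

lemma gr_le_trans:
  "finite I \<Longrightarrow> finite J \<Longrightarrow> finite K \<Longrightarrow> gr_le I J \<Longrightarrow> gr_le J K \<Longrightarrow> gr_le I K"
  unfolding gr_le_def by (metis gr_less_trans)

lemma gr_le_less_trans:
  "finite I \<Longrightarrow> finite J \<Longrightarrow> finite K \<Longrightarrow> gr_le I J \<Longrightarrow> gr_less J K \<Longrightarrow> gr_less I K"
  unfolding gr_le_def by (metis gr_less_trans)

lemma gr_less_le_trans:
  "finite I \<Longrightarrow> finite J \<Longrightarrow> finite K \<Longrightarrow> gr_less I J \<Longrightarrow> gr_le J K \<Longrightarrow> gr_less I K"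
  unfolding gr_le_def by (metis gr_less_trans)

lemma gr_less_not_le: "finite I \<Longrightarrow> finite J \<Longrightarrow> gr_less I J \<longleftrightarrow> \<not> gr_le J I"
  unfolding gr_le_def by (metis gr_less_irrefl gr_less_total gr_less_trans)

lemma gr_le_antisym: "finite I \<Longrightarrow> finite J \<Longrightarrow> gr_le I J \<Longrightarrow> gr_le J I \<Longrightarrow> I = J"
  using gr_less_not_le by (metis gr_le_def)

lemma gr_less_psubset:
  assumes "finite J" "I \<subset> J"
  shows "gr_less I J"
proof -
  have "Min (J - I) \<in> J - I"
    using assms by (intro Min_in) auto
  moreover have "(I - J) \<union> (J - I) = J - I"
    using assms by blast
  ultimately show ?thesis
    using assms unfolding gr_less_def by auto
qed

text \<open>
  Elements above all of \<open>J\<close> come after the first difference, so that adding one to \<open>I\<close> has no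
  influence on the comparison. This is the combinatorial core of the main property.
\<close>

lemma gr_less_insert_left:
  assumes "finite I" "finite J" "gr_less I J" "\<And>y. y \<in> J \<Longrightarrow> y < x"
  shows "gr_less (insert x I) J"
proof -
  obtain z where z: "z \<in> J - I" "\<And>y. y < z \<Longrightarrow> y \<in> I \<longleftrightarrow> y \<in> J"
    using assms(1-3) by (auto simp: gr_less_iff)
  then have "z < x"
    using assms(4) by blast
  then have "z \<in> J - insert x I" "\<forall>y<z. y \<in> insert x I \<longleftrightarrow> y \<in> J"
    using z by auto
  then show ?thesis
    using assms(1,2) gr_less_iff[of "insert x I" J] by blast
qed

lemma gr_is_max_ex:
  assumes "finite \<S>" "\<S> \<noteq> {}" "\<And>I. I \<in> \<S> \<Longrightarrow> finite I"
  shows "\<exists>I. gr_is_max \<S> I"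
  using assms
proof (induction rule: finite_ne_induct)
  case (singleton I)
  then show ?case
    unfolding gr_is_max_def by blast
next
  case (insert I \<S>)
  then obtain K where K: "K \<in> \<S>" "\<And>J. J \<in> \<S> \<Longrightarrow> gr_le J K"
    unfolding gr_is_max_def gr_le_def by blast
  show ?case
  proof (cases "gr_le I K")
    case True
    then show ?thesis
      using K unfolding gr_is_max_def gr_le_def by blast
  next
    case False
    then have "gr_le K I"
      using gr_less_not_le[of K I] K insert unfolding gr_le_def by blast
    then have "gr_le J I" if "J \<in> \<S>" for J
      using gr_le_trans[of J K I] K that insert by blast
    then show ?thesis
      unfolding gr_is_max_def gr_le_def by blast
  qed
qed

lemma gr_is_max_iff: "gr_is_max \<S> I \<longleftrightarrow> I \<in> \<S> \<and> (\<forall>J\<in>\<S>. gr_le J I)"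
  unfolding gr_is_max_def gr_le_def by blast


section \<open>The Gabriel--Roiter measure of indecomposable objects\<close>

context length_category
begin

lemma sub_le_Comp_iff:
  assumes "monic C m" "m \<in> homs C X Y" "a \<in> homs C U X" "b \<in> homs C V X"
  shows "sub_le C (m \<cdot> a) (m \<cdot> b) \<longleftrightarrow> sub_le C a b"
proof -
  have ma: "m \<cdot> a \<in> homs C U Y" and mb: "m \<cdot> b \<in> homs C V Y"
    using assms by auto
  show ?thesis
  proof
    assume "sub_le C (m \<cdot> a) (m \<cdot> b)"
    then obtain h where h: "h \<in> homs C U V" "(m \<cdot> b) \<cdot> h = m \<cdot> a"
      by (rule sub_leE[OF _ ma mb])
    have "m \<cdot> (b \<cdot> h) = m \<cdot> a"
      using h assms by simp
    then have "b \<cdot> h = a"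
      by (rule monic_cancel[OF assms(1), rotated -1]) (use h assms in auto)
    then show "sub_le C a b"
      by (rule sub_leI[OF _ assms(3,4) h(1)])
  next
    assume "sub_le C a b"
    then obtain h where h: "h \<in> homs C U V" "b \<cdot> h = a"
      by (rule sub_leE[OF _ assms(3,4)])
    then have "(m \<cdot> b) \<cdot> h = m \<cdot> a"
      using h(1) assms by simp
    then show "sub_le C (m \<cdot> a) (m \<cdot> b)"
      by (rule sub_leI[OF _ ma mb h(1)])
  qed
qed

lemma sub_less_lam:
  assumes "sub_less C a b" "a \<in> homs C U X" "b \<in> homs C V X" "monic C a"
  shows "lam U < lam V"
proof (rule ccontr)
  assume "\<not> lam U < lam V"
  obtain h where h: "h \<in> homs C U V" "b \<cdot> h = a"
    using assms(1) unfolding sub_less_def by (auto elim: sub_leE[OF _ assms(2,3)])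
  have "monic C h"
    using monic_left_factor[of b h] h assms(3,4) by simp
  then have "isomorphism C h"
    using monic_lam_eq_iso[OF _ h(1)] \<open>\<not> lam U < lam V\<close> by linarith
  then obtain g where g: "g \<in> homs C V U" "h \<cdot> g = Id C V"
    using isomorphismE h(1) by metis
  have "a \<cdot> g = b \<cdot> (h \<cdot> g)"
    using g(1) h(1) assms(3) by (simp flip: h(2))
  also have "\<dots> = b"
    using g(2) assms(3) by simp
  finally have "sub_le C b a"
    by (rule sub_leI[OF _ assms(3,2) g(1)])
  then show False
    using assms(1) unfolding sub_less_def by blast
qed

lemma ind_chainD:
  assumes "ind_chain C Y ms" "m \<in> set ms"
  shows "m \<in> homs C (Dom C m) Y" "monic C m" "indecomposable C (Dom C m)"
  using assms unfolding ind_chain_def subobject_def monic_def by auto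

definition chain_values :: "'b list \<Rightarrow> real set" where
  "chain_values ms = (\<lambda>m. lam (Dom C m)) ` set ms"

abbreviation mu :: "'a \<Rightarrow> real set" where
  "mu \<equiv> gr_measure_ind C lam"

lemma ind_chain_Id: "indecomposable C Y \<Longrightarrow> ind_chain C Y [Id C Y]"
  unfolding ind_chain_def subobject_def using monic_Id by (auto simp: indecomposable_def)

lemma mu_is_max:
  assumes "indecomposable C Y"
  shows "gr_is_max {chain_values ms | ms. ind_chain C Y ms} (mu Y)"
    and "finite (mu Y)"
proof -
  let ?S = "{chain_values ms | ms. ind_chain C Y ms}"
  have "chain_values ms \<subseteq> sub_values Y" if "ind_chain C Y ms" for ms
    using ind_chainD[OF that] sub_valuesI unfolding chain_values_def by blast
  then have "?S \<subseteq> Pow (sub_values Y)"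
    by blast
  moreover have "finite (sub_values Y)"
    using finite_sub_values assms by (simp add: indecomposable_def)
  ultimately have fin: "finite ?S" "\<And>I. I \<in> ?S \<Longrightarrow> finite I"
    using finite_subset by (blast, metis (mono_tags, lifting) PowD finite_subset subsetD)
  have "?S \<noteq> {}"
    using ind_chain_Id[OF assms] by blast
  then obtain I where I: "gr_is_max ?S I"
    using gr_is_max_ex fin by blast
  have "J = I" if "gr_is_max ?S J" for J
    using I that gr_le_antisym[of I J] fin unfolding gr_is_max_iff by blast
  with I have "The (gr_is_max ?S) = I"
    by (rule the_equality)
  then have "mu Y = I"
    unfolding gr_measure_ind_def chain_values_def by simp
  then show "gr_is_max ?S (mu Y)" "finite (mu Y)"
    using I fin unfolding gr_is_max_iff by auto
qed

lemma mu_attained: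
  assumes "indecomposable C Y"
  obtains ms where "ind_chain C Y ms" "mu Y = chain_values ms"
  using mu_is_max(1)[OF assms] unfolding gr_is_max_iff by blast

lemma chain_values_le:
  assumes "indecomposable C Y" "ind_chain C Y ms"
  shows "gr_le (chain_values ms) (mu Y)"
  using mu_is_max(1)[OF assms(1)] assms(2) unfolding gr_is_max_iff by blast

lemma ind_chain_map:
  assumes "monic C m" "m \<in> homs C X Y" "ind_chain C X ms"
  shows "ind_chain C Y (map (\<lambda>n. m \<cdot> n) ms)" "chain_values (map (\<lambda>n. m \<cdot> n) ms) = chain_values ms"
proof -
  note ms = ind_chainD[OF assms(3)]
  have "subobject C (m \<cdot> n) Y" "Dom C (m \<cdot> n) = Dom C n" if "n \<in> set ms" for n
    using ms[OF that] monic_Comp[OF _ assms(1), of n] assms(2) by (auto simp: subobject_def)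
  moreover have "sorted_wrt (\<lambda>a b. sub_less C (m \<cdot> a) (m \<cdot> b)) ms"
  proof (rule sorted_wrt_mono_rel)
    show "sorted_wrt (sub_less C) ms"
      using assms(3) unfolding ind_chain_def by blast
    show "sub_less C (m \<cdot> a) (m \<cdot> b)" if "a \<in> set ms" "b \<in> set ms" "sub_less C a b" for a b
      using sub_le_Comp_iff[OF assms(1,2) ms(1)[OF that(1)] ms(1)[OF that(2)]]
        sub_le_Comp_iff[OF assms(1,2) ms(1)[OF that(2)] ms(1)[OF that(1)]] that(3)
      unfolding sub_less_def by blast
  qed
  ultimately show "ind_chain C Y (map (\<lambda>n. m \<cdot> n) ms)"
      "chain_values (map (\<lambda>n. m \<cdot> n) ms) = chain_values ms"
    using assms(3) ms(3) unfolding ind_chain_def chain_values_def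
    by (auto simp: sorted_wrt_map image_image)
qed

lemma ind_chain_restrict:
  assumes "monic C n" "n \<in> homs C X Y" "ind_chain C Y ms" "\<And>m. m \<in> set ms \<Longrightarrow> sub_le C m n"
  obtains ms' where "ind_chain C X ms'" "chain_values ms' = chain_values ms"
proof -
  note ms = ind_chainD[OF assms(3)]
  have "\<exists>h. h \<in> homs C (Dom C m) X \<and> n \<cdot> h = m" if "m \<in> set ms" for m
    using sub_leE[OF assms(4)[OF that] ms(1)[OF that] assms(2)] by blast
  then obtain h where h: "\<And>m. m \<in> set ms \<Longrightarrow> h m \<in> homs C (Dom C m) X"
      "\<And>m. m \<in> set ms \<Longrightarrow> n \<cdot> h m = m"
    by metis
  have "subobject C (h m) X" "Dom C (h m) = Dom C m" if "m \<in> set ms" for m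
    using h(1)[OF that] monic_left_factor[of n "h m"] h(2)[OF that] ms(2)[OF that] assms(2)
    by (auto simp: subobject_def)
  moreover have "sorted_wrt (\<lambda>a b. sub_less C (h a) (h b)) ms"
  proof (rule sorted_wrt_mono_rel)
    show "sorted_wrt (sub_less C) ms"
      using assms(3) unfolding ind_chain_def by blast
    show "sub_less C (h a) (h b)" if "a \<in> set ms" "b \<in> set ms" "sub_less C a b" for a b
      using sub_le_Comp_iff[OF assms(1,2) h(1)[OF that(1)] h(1)[OF that(2)]]
        sub_le_Comp_iff[OF assms(1,2) h(1)[OF that(2)] h(1)[OF that(1)]] that h(2)
      unfolding sub_less_def by simp
  qed
  ultimately have "ind_chain C X (map h ms)" "chain_values (map h ms) = chain_values ms"
    using assms(3) ms(3) unfolding ind_chain_def chain_values_def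
    by (auto simp: sorted_wrt_map image_image)
  then show thesis
    using that by blast
qed

lemma mu_monic:
  assumes "indecomposable C X" "indecomposable C Y" "monic C m" "m \<in> homs C X Y"
  shows "gr_le (mu X) (mu Y)"
proof -
  obtain ms where "ind_chain C X ms" "mu X = chain_values ms"
    using mu_attained[OF assms(1)] .
  then show ?thesis
    using ind_chain_map[OF assms(3,4)] chain_values_le[OF assms(2)] by metis
qed

lemma mu_iso:
  assumes "indecomposable C X" "indecomposable C Y" "isomorphism C f" "f \<in> homs C X Y"
  shows "mu X = mu Y"
proof -
  obtain g where g: "g \<in> homs C Y X" "g \<cdot> f = Id C X" "f \<cdot> g = Id C Y"
    using isomorphismE[OF assms(3,4)] .
  have "gr_le (mu X) (mu Y)"
    using mu_monic[OF assms(1,2) split_monic[OF assms(4) g(1,2)] assms(4)] .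
  moreover have "gr_le (mu Y) (mu X)"
    using mu_monic[OF assms(2,1) split_monic[OF g(1) assms(4) g(3)] g(1)] .
  ultimately show ?thesis
    using gr_le_antisym mu_is_max(2) assms(1,2) by blast
qed

text \<open>
  A chain that realises \<open>\<mu>(X)\<close> ends with all of \<open>X\<close>, since otherwise \<open>X\<close> could be appended; the
  rest of the chain lives in its largest term.
\<close>

lemma mu_recursion:
  assumes X: "indecomposable C X"
  obtains I where "mu X = insert (lam X) I" "\<And>x. x \<in> I \<Longrightarrow> x < lam X"
    "I = {} \<or> (\<exists>X' n. indecomposable C X' \<and> monic C n \<and> n \<in> homs C X' X \<and> lam X' < lam X \<and>
      gr_le I (mu X'))"
proof -
  have XO [simp]: "X \<in> Obj C"
    using X unfolding indecomposable_def by blast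
  obtain ms where ms: "ind_chain C X ms" "mu X = chain_values ms"
    using mu_attained[OF X] .
  have "ms \<noteq> []" and sorted: "sorted_wrt (sub_less C) ms"
    using ms(1) unfolding ind_chain_def by auto
  then obtain ns m where ns: "ms = ns @ [m]"
    by (metis rev_exhaust)
  define U where "U = Dom C m"
  have m: "m \<in> homs C U X" "monic C m"
    using ind_chainD[OF ms(1), of m] by (auto simp: ns U_def)
  have below: "lam (Dom C n) < lam U" if "n \<in> set ns" for n
    using sub_less_lam[of n m "Dom C n" X U] ind_chainD[OF ms(1), of n] sorted m that
    by (auto simp: ns sorted_wrt_append)
  have "lam U \<le> lam X"
    using lam_monic_le m by blast
  have "lam U = lam X"
  proof (rule ccontr)
    assume "lam U \<noteq> lam X"
    then have less: "lam (Dom C n) < lam X" if "n \<in> set ms" for n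
      using below[of n] \<open>lam U \<le> lam X\<close> that by (auto simp: ns U_def)
    have "sub_less C n (Id C X)" if "n \<in> set ms" for n
    proof -
      note n = ind_chainD[OF ms(1) that]
      have "sub_le C n (Id C X)"
        by (rule sub_leI[OF _ n(1) Id_homs n(1)]) (use n(1) in auto)
      moreover have "\<not> sub_le C (Id C X) n"
      proof
        assume "sub_le C (Id C X) n"
        then obtain h where "h \<in> homs C X (Dom C n)" "n \<cdot> h = Id C X"
          by (rule sub_leE[OF _ Id_homs n(1)]) simp
        then have "isomorphism C n"
          using split_monic_epic_iso n by blast
        then show False
          using lam_iso[OF _ n(1)] less[OF that] by simp
      qed
      ultimately show ?thesis
        unfolding sub_less_def by blast
    qed
    then have "ind_chain C X (ms @ [Id C X])"
      using ms(1) ind_chain_Id[OF X] unfolding ind_chain_def by (auto simp: sorted_wrt_append)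
    then have "gr_le (chain_values (ms @ [Id C X])) (mu X)"
      using chain_values_le[OF X] by blast
    moreover have "gr_less (mu X) (chain_values (ms @ [Id C X]))"
    proof (rule gr_less_psubset)
      have "lam X \<notin> chain_values ms"
        using less unfolding chain_values_def by force
      moreover have "chain_values (ms @ [Id C X]) = insert (lam X) (chain_values ms)"
        by (simp add: chain_values_def)
      ultimately show "mu X \<subset> chain_values (ms @ [Id C X])"
        using ms(2) by blast
    qed (simp add: chain_values_def)
    ultimately show False
      using gr_less_not_le mu_is_max(2)[OF X] by (simp add: chain_values_def)
  qed
  show thesis
  proof (rule that[of "chain_values ns"])
    show "mu X = insert (lam X) (chain_values ns)"
      using ms(2) \<open>lam U = lam X\<close> by (simp add: ns chain_values_def U_def)
    show "x < lam X" if "x \<in> chain_values ns" for x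
      using that below \<open>lam U = lam X\<close> by (auto simp: chain_values_def)
    show "chain_values ns = {} \<or> (\<exists>X' n. indecomposable C X' \<and> monic C n \<and> n \<in> homs C X' X \<and>
      lam X' < lam X \<and> gr_le (chain_values ns) (mu X'))"
    proof (cases "ns = []")
      case True
      then show ?thesis
        by (simp add: chain_values_def)
    next
      case False
      then have n: "last ns \<in> set ns" "last ns \<in> set ms"
        by (simp_all add: ns)
      note n' = ind_chainD[OF ms(1) n(2)]
      have chain: "ind_chain C X ns"
        using ms(1) False unfolding ind_chain_def by (auto simp: ns sorted_wrt_append)
      have "sub_le C k (last ns)" if "k \<in> set ns" for k
      proof (cases "k = last ns")
        case True
        then show ?thesis
          using sub_leI[OF _ n'(1) n'(1) Id_homs] n'(1) Dom_Obj by auto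
      next
        case neq: False
        have "sorted_wrt (sub_less C) (butlast ns @ [last ns])"
          using chain False unfolding ind_chain_def by simp
        moreover have "k \<in> set (butlast ns)"
          using that neq False by (metis append_butlast_last_id in_set_conv_decomp
            rotate1.simps(2) set_ConsD set_rotate1)
        ultimately show ?thesis
          by (simp add: sorted_wrt_append sub_less_def)
      qed
      then obtain ks where ks: "ind_chain C (Dom C (last ns)) ks" "chain_values ks = chain_values ns"
        using ind_chain_restrict[OF n'(2,1) chain] by blast
      then have "gr_le (chain_values ns) (mu (Dom C (last ns)))"
        using chain_values_le[OF n'(3)] by metis
      then show ?thesis
        using n' below[OF n(1)] \<open>lam U = lam X\<close> by auto
    qed
  qed
qed

lemma mu_lam:
  assumes "indecomposable C X"
  shows "lam X \<in> mu X" "x \<in> mu X \<Longrightarrow> x \<le> lam X"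
proof -
  obtain I where "mu X = insert (lam X) I" "\<And>x. x \<in> I \<Longrightarrow> x < lam X"
    using mu_recursion[OF assms] by metis
  then show "lam X \<in> mu X" "x \<in> mu X \<Longrightarrow> x \<le> lam X"
    by force+
qed

lemma mu_eq_lam_eq:
  "indecomposable C X \<Longrightarrow> indecomposable C Y \<Longrightarrow> mu X = mu Y \<Longrightarrow> lam X = lam Y"
  using mu_lam by (metis order_antisym)


section \<open>Gabriel's main property\<close>

text \<open>
  The family may be infinite, so that the main property applies to reject quotients, which embed
  into products of possibly infinitely many objects.
\<close>

definition jointly_monic :: "'a \<Rightarrow> 'b set \<Rightarrow> bool" where
  "jointly_monic X F \<longleftrightarrow> (\<forall>f\<in>F. f \<in> Arr C \<and> Dom C f = X) \<and>
    (\<forall>Z u. u \<in> homs C Z X \<and> (\<forall>f\<in>F. f \<cdot> u = Zero C Z (Cod C f)) \<longrightarrow> u = Zero C Z X)"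

lemma jointly_monic_zero:
  assumes "jointly_monic X F" "u \<in> homs C Z X" "\<And>f. f \<in> F \<Longrightarrow> f \<cdot> u = Zero C Z (Cod C f)"
  shows "u = Zero C Z X"
  using assms unfolding jointly_monic_def by blast

lemma jointly_monic_hom:
  assumes "jointly_monic X F" "f \<in> F"
  shows "f \<in> homs C X (Cod C f)"
  using assms unfolding jointly_monic_def by auto

text \<open>
  The projections of a decomposition into indecomposable objects are jointly monic.
\<close>

lemma indecomposable_retractions_zero:
  assumes "u \<in> homs C Z X"
    and "\<And>W s r. indecomposable C W \<Longrightarrow> s \<in> homs C W X \<Longrightarrow> r \<in> homs C X W \<Longrightarrow> r \<cdot> s = Id C W \<Longrightarrow>
      r \<cdot> u = Zero C Z W"
  shows "u = Zero C Z X"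
proof -
  have "X \<in> Obj C"
    using hom_Obj assms(1) by blast
  then obtain Ys where Ys: "\<forall>Y\<in>set Ys. indecomposable C Y" "direct_sum_list C X Ys"
    using ex_indecomposable_decomposition by blast
  have ind: "indecomposable C (Ys ! i)" if "i < length Ys" for i
    using Ys(1) that by simp
  then have Obj: "Ys ! i \<in> Obj C" if "i \<in> {..<length Ys}" for i
    using that unfolding indecomposable_def by blast
  have "finite {i \<in> {..<length Ys}. \<not> zero_object C (Ys ! i)}"
    by simp
  with Ys(2)[unfolded direct_sum_list_def] Obj show ?thesis
  proof (rule direct_sum_projections)
    fix \<iota> \<pi>
    assume "\<And>i. i \<in> {..<length Ys} \<Longrightarrow> \<iota> i \<in> homs C (Ys ! i) X"
      "\<And>i. i \<in> {..<length Ys} \<Longrightarrow> \<pi> i \<in> homs C X (Ys ! i)"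
      "\<And>i. i \<in> {..<length Ys} \<Longrightarrow> \<pi> i \<cdot> \<iota> i = Id C (Ys ! i)"
      and joint: "\<And>Z u. u \<in> homs C Z X \<Longrightarrow>
        (\<And>i. i \<in> {..<length Ys} \<Longrightarrow> \<pi> i \<cdot> u = Zero C Z (Ys ! i)) \<Longrightarrow> u = Zero C Z X"
    then show "u = Zero C Z X"
      using assms(2) ind by (intro joint[OF assms(1)]) blast
  qed
qed

text \<open>
  The case in which all members of the family are epimorphisms. If none is an isomorphism, then
  all lengths \<open>\<lambda>(Y)\<close> of the targets are below \<open>\<lambda>(X)\<close>. Write \<open>\<mu>(X) = I \<union> {\<lambda>(X)}\<close>. If
  \<open>I \<noteq> {}\<close>, it is realised inside a proper subobject \<open>X'\<close>, and the restriction of the family to \<open>X'\<close> cannot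
  contain an isomorphism, because \<open>X'\<close> would split off; by induction some target has
  \<open>I < \<mu>(Y)\<close>. If \<open>I = {}\<close>, every target does. Since \<open>\<lambda>(X)\<close> exceeds all elements of \<open>\<mu>(Y)\<close>, even \<open>\<mu>(X) < \<mu>(Y)\<close>.
\<close>

lemma main_property_epic:
  assumes X: "indecomposable C X" and G: "jointly_monic X G"
    and G': "\<And>g. g \<in> G \<Longrightarrow> epic C g \<and> indecomposable C (Cod C g) \<and> gr_le (mu (Cod C g)) (mu X)"
    and IH: "\<And>X' F. sub_size X' < sub_size X \<Longrightarrow> indecomposable C X' \<Longrightarrow> jointly_monic X' F \<Longrightarrow>
      (\<And>f. f \<in> F \<Longrightarrow> indecomposable C (Cod C f) \<and> gr_le (mu (Cod C f)) (mu X')) \<Longrightarrow>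
      \<exists>f\<in>F. isomorphism C f"
  shows "\<exists>g\<in>G. isomorphism C g"
proof (rule ccontr)
  assume no_iso: "\<not> ?thesis"
  have XO: "X \<in> Obj C" "Id C X \<noteq> Zero C X X"
    using X zero_object_iff unfolding indecomposable_def by auto
  have lam_less: "lam (Cod C g) < lam X" if "g \<in> G" for g
    using epic_lam_eq_iso[of g X "Cod C g"] G'[OF that] jointly_monic_hom[OF G that] no_iso that
    by (meson not_le)
  obtain I where I: "mu X = insert (lam X) I" "\<And>x. x \<in> I \<Longrightarrow> x < lam X"
    and I_cases: "I = {} \<or> (\<exists>X' n. indecomposable C X' \<and> monic C n \<and> n \<in> homs C X' X \<and>
      lam X' < lam X \<and> gr_le I (mu X'))"
    using mu_recursion[OF X] by blast
  have fin_I: "finite I"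
    using mu_is_max(2)[OF X] I(1) by simp
  have fin_G: "finite (mu (Cod C g))" if "g \<in> G" for g
    using mu_is_max(2) G'[OF that] by blast
  have "\<exists>g\<in>G. gr_less I (mu (Cod C g))"
    using I_cases
  proof
    assume "I = {}"
    have "G \<noteq> {}"
      using jointly_monic_zero[OF G Id_homs[OF XO(1)]] XO(2) by blast
    then obtain g where g: "g \<in> G"
      by blast
    then have "mu (Cod C g) \<noteq> {}"
      using mu_lam(1) G' by blast
    then show ?thesis
      using gr_less_psubset[OF fin_G[OF g], of I] \<open>I = {}\<close> g by blast
  next
    assume "\<exists>X' n. indecomposable C X' \<and> monic C n \<and> n \<in> homs C X' X \<and>
      lam X' < lam X \<and> gr_le I (mu X')"
    then obtain X' n where X': "indecomposable C X'" and n: "monic C n" "n \<in> homs C X' X"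
      and "lam X' < lam X" and I_le: "gr_le I (mu X')"
      by blast
    have n_no_iso: "\<not> isomorphism C n"
      using lam_iso n(2) \<open>lam X' < lam X\<close> by fastforce
    show ?thesis
    proof (rule ccontr)
      assume not: "\<not> ?thesis"
      have le: "gr_le (mu (Cod C g)) (mu X')" if "g \<in> G" for g
        using gr_le_trans[OF fin_G[OF that] fin_I mu_is_max(2)[OF X'] _ I_le] not that
          gr_less_not_le[OF fin_I fin_G[OF that]] by blast
      have restrict: "g \<cdot> n \<in> homs C X' (Cod C g)" if "g \<in> G" for g
        using jointly_monic_hom[OF G that] n(2) by simp
      have "jointly_monic X' ((\<lambda>g. g \<cdot> n) ` G)"
        unfolding jointly_monic_def
      proof (intro conjI ballI allI impI)
        fix Z u
        assume u: "u \<in> homs C Z X' \<and> (\<forall>f\<in>(\<lambda>g. g \<cdot> n) ` G. f \<cdot> u = Zero C Z (Cod C f))"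
        have "g \<cdot> (n \<cdot> u) = Zero C Z (Cod C g)" if g: "g \<in> G" for g
        proof -
          have "g \<cdot> (n \<cdot> u) = (g \<cdot> n) \<cdot> u"
            using u n(2) jointly_monic_hom[OF G g] by simp
          also have "\<dots> = Zero C Z (Cod C (g \<cdot> n))"
            using u g by blast
          finally show ?thesis
            using restrict[OF g] by simp
        qed
        then have "n \<cdot> u = Zero C Z X"
          by (intro jointly_monic_zero[OF G]) (use u n(2) in auto)
        then show "u = Zero C Z X'"
          using monic_zero[OF n(1), of u Z] u n(2) by simp
      qed (use restrict in auto)
      then have "\<exists>f\<in>(\<lambda>g. g \<cdot> n) ` G. isomorphism C f"
        using G' le restrict
        by (intro IH[OF sub_size_monic_less[OF n n_no_iso] X']) auto
      then obtain g where g: "g \<in> G" "isomorphism C (g \<cdot> n)"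
        by blast
      obtain h where h: "h \<in> homs C (Cod C g) X'" "h \<cdot> (g \<cdot> n) = Id C X'"
        using isomorphismE[OF g(2) restrict[OF g(1)]] by metis
      have "(h \<cdot> g) \<cdot> n = Id C X'" "h \<cdot> g \<in> homs C X X'"
        using h n(2) jointly_monic_hom[OF G g(1)] by auto
      then have "isomorphism C n"
        using indecomposable_retract_iso[OF X _ n(2)] X' unfolding indecomposable_def by blast
      then show False
        using n_no_iso by blast
    qed
  qed
  then obtain g where g: "g \<in> G" "gr_less I (mu (Cod C g))"
    by blast
  have "gr_less (mu X) (mu (Cod C g))"
    unfolding I(1)
  proof (rule gr_less_insert_left[OF fin_I fin_G[OF g(1)] g(2)])
    show "y < lam X" if "y \<in> mu (Cod C g)" for y
      using mu_lam(2)[OF _ that] G'[OF g(1)] lam_less[OF g(1)] by fastforce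
  qed
  then show False
    using gr_less_not_le[OF mu_is_max(2)[OF X] fin_G[OF g(1)]] G'[OF g(1)] by blast
qed

text \<open>
  In general one replaces every \<open>f\<close> by the components of \<open>X \<rightarrow> Im f\<close> with respect to a
  decomposition of the image. If such a component is an isomorphism onto \<open>W\<close>, then \<open>f\<close> is monic
  and \<open>\<mu>(X) = \<mu>(W) \<le> \<mu>(Y) \<le> \<mu>(X)\<close>; equal measures have equal maxima \<open>\<lambda>(X) = \<lambda>(Y)\<close>, so
  that \<open>f\<close> is an isomorphism.
\<close>

theorem main_property:
  assumes "indecomposable C X" "jointly_monic X F"
    and "\<And>f. f \<in> F \<Longrightarrow> indecomposable C (Cod C f) \<and> gr_le (mu (Cod C f)) (mu X)"
  shows "\<exists>f\<in>F. isomorphism C f"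
  using assms
proof (induction "sub_size X" arbitrary: X F rule: less_induct)
  case (less X F)
  note X = less(2) and F = less(3) and F' = less(4)
  define G where "G = {g. \<exists>f\<in>F. \<exists>I m e W s r. m \<in> homs C I (Cod C f) \<and> monic C m \<and>
    e \<in> homs C X I \<and> epic C e \<and> m \<cdot> e = f \<and>
    indecomposable C W \<and> s \<in> homs C W I \<and> r \<in> homs C I W \<and> r \<cdot> s = Id C W \<and> g = r \<cdot> e}"
  have G: "jointly_monic X G"
    unfolding jointly_monic_def
  proof (intro conjI ballI allI impI)
    fix Z u
    assume u: "u \<in> homs C Z X \<and> (\<forall>g\<in>G. g \<cdot> u = Zero C Z (Cod C g))"
    then have Z: "Z \<in> Obj C"
      using hom_Obj by blast
    show "u = Zero C Z X"
    proof (rule jointly_monic_zero[OF F])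
      fix f
      assume f: "f \<in> F"
      obtain I m e where m: "m \<in> homs C I (Cod C f)" "monic C m" and e: "e \<in> homs C X I" "epic C e"
        and me: "m \<cdot> e = f"
        using image_factorization[OF jointly_monic_hom[OF F f]] .
      have "e \<cdot> u = Zero C Z I"
      proof (rule indecomposable_retractions_zero)
        fix W s r
        assume W: "indecomposable C W" "s \<in> homs C W I" "r \<in> homs C I W" "r \<cdot> s = Id C W"
        then have "r \<cdot> e \<in> G"
          unfolding G_def using f m e me by blast
        then have "(r \<cdot> e) \<cdot> u = Zero C Z (Cod C (r \<cdot> e))"
          using u by blast
        then show "r \<cdot> (e \<cdot> u) = Zero C Z W"
          using u e(1) W(3) by simp
      qed (use u e in auto)
      have "f \<cdot> u = m \<cdot> (e \<cdot> u)"
        using m(1) e(1) u by (simp flip: me)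
      also have "\<dots> = Zero C Z (Cod C f)"
        unfolding \<open>e \<cdot> u = _\<close> using m(1) Z by simp
      finally show "f \<cdot> u = Zero C Z (Cod C f)" .
    qed (use u in blast)
  qed (auto simp: G_def)
  have G': "epic C g \<and> indecomposable C (Cod C g) \<and> gr_le (mu (Cod C g)) (mu X) \<and>
      (isomorphism C g \<longrightarrow> (\<exists>f\<in>F. isomorphism C f))" if "g \<in> G" for g
  proof -
    obtain f I m e W s r where f: "f \<in> F" and m: "m \<in> homs C I (Cod C f)" "monic C m"
      and e: "e \<in> homs C X I" "epic C e" and me: "m \<cdot> e = f" and W: "indecomposable C W"
      and s: "s \<in> homs C W I" and r: "r \<in> homs C I W" "r \<cdot> s = Id C W" and g: "g = r \<cdot> e"
      using \<open>g \<in> G\<close> unfolding G_def by blast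
    have gW: "g \<in> homs C X W" "Cod C g = W"
      using e r g by auto
    have "epic C r"
      unfolding epic_iff
    proof (intro conjI allI impI)
      fix Z u
      assume u: "u \<in> homs C (Cod C r) Z \<and> u \<cdot> r = Zero C (Dom C r) Z"
      then have "Z \<in> Obj C"
        using hom_Obj by blast
      have "u = u \<cdot> (r \<cdot> s)"
        unfolding r(2) using u r(1) by simp
      also have "\<dots> = Zero C I Z \<cdot> s"
        using u r(1) s by (intro Comp_reassoc) auto
      also have "\<dots> = Zero C W Z"
        using s \<open>Z \<in> Obj C\<close> by simp
      finally show "u = Zero C (Cod C r) Z"
        using r(1) by simp
    qed (use r in auto)
    then have "epic C g"
      using epic_Comp[OF e(2)] g e(1) r(1) by simp
    have ms: "monic C (m \<cdot> s)" "m \<cdot> s \<in> homs C W (Cod C f)"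
      using monic_Comp[OF split_monic[OF s r] m(2)] m(1) s by auto
    have f_ind: "indecomposable C (Cod C f)" "gr_le (mu (Cod C f)) (mu X)"
      using F'[OF f] by auto
    have W_le: "gr_le (mu W) (mu (Cod C f))"
      using mu_monic[OF W f_ind(1) ms] .
    note fin = mu_is_max(2)[OF W] mu_is_max(2)[OF f_ind(1)] mu_is_max(2)[OF X]
    have "isomorphism C f" if "isomorphism C g"
    proof -
      have "monic C g"
        using isomorphism_monic[OF that gW(1)] .
      then have "monic C e"
        using monic_left_factor[of r e] g r(1) e(1) by simp
      then have "monic C f"
        using monic_Comp[OF _ m(2), of e] me m(1) e(1) by simp
      have "mu W = mu X"
        using mu_iso[OF X W that gW(1)] by simp
      then have "mu (Cod C f) = mu X"
        using gr_le_antisym[OF fin(2,3) f_ind(2)] W_le by simp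
      then have "lam (Cod C f) = lam X"
        using mu_eq_lam_eq[OF f_ind(1) X] by simp
      then show ?thesis
        using monic_lam_eq_iso[OF \<open>monic C f\<close> jointly_monic_hom[OF F f]] by simp
    qed
    then show ?thesis
      using \<open>epic C g\<close> W gW(2) gr_le_trans[OF fin W_le f_ind(2)] f by blast
  qed
  have "\<exists>g\<in>G. isomorphism C g"
    using G' by (intro main_property_epic[OF X G _ less(1)]) blast+
  then show ?case
    using G' by blast
qed


section \<open>Objects cogenerated by a set of objects\<close>

text \<open>
  \<open>M\<close> embeds into a product of objects of \<open>\<Theta>\<close>, expressed without the product.
\<close>

definition cogenerated :: "'a set \<Rightarrow> 'a \<Rightarrow> bool" where
  "cogenerated \<Theta> M \<longleftrightarrow> M \<in> Obj C \<and> (\<forall>Z u. u \<in> homs C Z M \<and>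
    (\<forall>T\<in>\<Theta>. \<forall>g\<in>homs C M T. g \<cdot> u = Zero C Z T) \<longrightarrow> u = Zero C Z M)"

lemma cogeneratedI:
  assumes "M \<in> Obj C"
    and "\<And>Z u. u \<in> homs C Z M \<Longrightarrow> (\<And>T g. T \<in> \<Theta> \<Longrightarrow> g \<in> homs C M T \<Longrightarrow> g \<cdot> u = Zero C Z T) \<Longrightarrow>
      u = Zero C Z M"
  shows "cogenerated \<Theta> M"
  using assms unfolding cogenerated_def by blast

lemma cogenerated_zero:
  assumes "cogenerated \<Theta> M" "u \<in> homs C Z M"
    "\<And>T g. T \<in> \<Theta> \<Longrightarrow> g \<in> homs C M T \<Longrightarrow> g \<cdot> u = Zero C Z T"
  shows "u = Zero C Z M"
  using assms unfolding cogenerated_def by blast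

lemma cogenerated_Obj: "cogenerated \<Theta> M \<Longrightarrow> M \<in> Obj C"
  unfolding cogenerated_def by blast

lemma cogenerated_trans:
  assumes "cogenerated \<Theta> M" "\<And>T. T \<in> \<Theta> \<Longrightarrow> cogenerated \<Theta>' T"
  shows "cogenerated \<Theta>' M"
proof (rule cogeneratedI[OF cogenerated_Obj[OF assms(1)]])
  fix Z u
  assume u: "u \<in> homs C Z M" "\<And>T g. T \<in> \<Theta>' \<Longrightarrow> g \<in> homs C M T \<Longrightarrow> g \<cdot> u = Zero C Z T"
  show "u = Zero C Z M"
  proof (rule cogenerated_zero[OF assms(1) u(1)])
    fix T g
    assume T: "T \<in> \<Theta>" "g \<in> homs C M T"
    show "g \<cdot> u = Zero C Z T"
    proof (rule cogenerated_zero[OF assms(2)[OF T(1)]])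
      fix T' h
      assume "T' \<in> \<Theta>'" "h \<in> homs C T T'"
      then show "h \<cdot> (g \<cdot> u) = Zero C Z T'"
        using u(2)[of T' "h \<cdot> g"] u(1) T(2) by simp
    qed (use u T in auto)
  qed
qed

lemma cogenerated_member:
  assumes "T \<in> \<Theta>" "T \<in> Obj C"
  shows "cogenerated \<Theta> T"
proof (rule cogeneratedI[OF assms(2)])
  fix Z u
  assume "u \<in> homs C Z T" "\<And>T' g. T' \<in> \<Theta> \<Longrightarrow> g \<in> homs C T T' \<Longrightarrow> g \<cdot> u = Zero C Z T'"
  then show "u = Zero C Z T"
    using assms Id_homs[OF assms(2)] by fastforce
qed

lemma cogenerated_mono:
  assumes "cogenerated \<Theta> M" "\<Theta> \<subseteq> \<Theta>'"
  shows "cogenerated \<Theta>' M"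
  using assms unfolding cogenerated_def by blast

lemma cogenerated_ideal:
  assumes "ideal C P M M (Id C M)" "M \<in> Obj C"
  shows "cogenerated P M"
proof (rule cogeneratedI[OF assms(2)])
  fix Z u
  assume u: "u \<in> homs C Z M" "\<And>T g. T \<in> P \<Longrightarrow> g \<in> homs C M T \<Longrightarrow> g \<cdot> u = Zero C Z T"
  have "Id C M \<cdot> u = Zero C Z M"
    using ideal_annihilates[OF assms(1) u] by blast
  then show "u = Zero C Z M"
    using u(1) by simp
qed

text \<open>
  The main property for the composites \<open>W \<rightarrow> M \<rightarrow> T\<close>. The two lemmas below are its contrapositive
  for upper bounds: a subobject of an object cogenerated by small objects is small.
\<close>

lemma cogenerated_mu_iso:
  assumes W: "indecomposable C W" "m \<in> homs C W M" "monic C m" and M: "cogenerated \<Theta> M"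
    and \<Theta>: "\<And>T. T \<in> \<Theta> \<Longrightarrow> indecomposable C T \<and> gr_le (mu T) (mu W)"
  shows "\<exists>T\<in>\<Theta>. mu T = mu W"
proof -
  define F where "F = {g \<cdot> m | g T. T \<in> \<Theta> \<and> g \<in> homs C M T}"
  have F: "\<exists>T\<in>\<Theta>. f \<in> homs C W T" if "f \<in> F" for f
    using that W(2) unfolding F_def by auto
  have "jointly_monic W F"
    unfolding jointly_monic_def
  proof (intro conjI ballI allI impI)
    fix Z u
    assume u: "u \<in> homs C Z W \<and> (\<forall>f\<in>F. f \<cdot> u = Zero C Z (Cod C f))"
    have "m \<cdot> u = Zero C Z M"
    proof (rule cogenerated_zero[OF M])
      fix T g
      assume g: "T \<in> \<Theta>" "g \<in> homs C M T"
      then have "(g \<cdot> m) \<cdot> u = Zero C Z (Cod C (g \<cdot> m))"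
        using u unfolding F_def by blast
      then show "g \<cdot> (m \<cdot> u) = Zero C Z T"
        using u g W(2) by simp
    qed (use u W in auto)
    then show "u = Zero C Z W"
      using monic_zero[OF W(3), of u Z] u W(2) by simp
  qed (use F in auto)
  moreover have "indecomposable C (Cod C f) \<and> gr_le (mu (Cod C f)) (mu W)" if "f \<in> F" for f
    using F[OF that] \<Theta> by auto
  ultimately obtain f where f: "f \<in> F" "isomorphism C f"
    using main_property[OF W(1)] by blast
  then obtain T where T: "T \<in> \<Theta>" "f \<in> homs C W T"
    using F by blast
  then show ?thesis
    using mu_iso[OF W(1) _ f(2)] \<Theta> by (intro bexI[of _ T]) auto
qed

lemma cogenerated_mu_less:
  assumes W: "indecomposable C W" "m \<in> homs C W M" "monic C m" and "finite I"
    and M: "cogenerated {T. indecomposable C T \<and> gr_less (mu T) I} M"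
  shows "gr_less (mu W) I"
proof (rule ccontr)
  note fin = mu_is_max(2)
  assume "\<not> ?thesis"
  then have I: "gr_le I (mu W)"
    using gr_less_not_le assms(4) fin[OF W(1)] by blast
  have "gr_less (mu T) (mu W)" if "indecomposable C T \<and> gr_less (mu T) I" for T
    using gr_less_le_trans[OF _ assms(4) fin[OF W(1)] _ I] that fin by blast
  then show False
    using cogenerated_mu_iso[OF W M] unfolding gr_le_def by fastforce
qed

lemma cogenerated_mu_le:
  assumes W: "indecomposable C W" "m \<in> homs C W M" "monic C m" and "finite I"
    and M: "cogenerated {T. indecomposable C T \<and> gr_le (mu T) I} M"
  shows "gr_le (mu W) I"
proof (rule ccontr)
  note fin = mu_is_max(2)
  assume "\<not> ?thesis"
  then have I: "gr_less I (mu W)"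
    using gr_less_not_le assms(4) fin[OF W(1)] by blast
  have "gr_less (mu T) (mu W)" if "indecomposable C T \<and> gr_le (mu T) I" for T
    using gr_le_less_trans[OF _ assms(4) fin[OF W(1)] _ I] that fin by blast
  then show False
    using cogenerated_mu_iso[OF W M] unfolding gr_le_def by fastforce
qed

lemma cogenerated_indecomposable_retracts:
  assumes "M \<in> Obj C"
    and "\<And>W s r. indecomposable C W \<Longrightarrow> s \<in> homs C W M \<Longrightarrow> r \<in> homs C M W \<Longrightarrow> r \<cdot> s = Id C W \<Longrightarrow> W \<in> \<Theta>"
  shows "cogenerated \<Theta> M"
proof (rule cogeneratedI[OF assms(1)])
  fix Z u
  assume u: "u \<in> homs C Z M" "\<And>T g. T \<in> \<Theta> \<Longrightarrow> g \<in> homs C M T \<Longrightarrow> g \<cdot> u = Zero C Z T"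
  show "u = Zero C Z M"
  proof (rule indecomposable_retractions_zero[OF u(1)])
    fix W s r
    assume W: "indecomposable C W" "s \<in> homs C W M" "r \<in> homs C M W" "r \<cdot> s = Id C W"
    show "r \<cdot> u = Zero C Z W"
      using u(2)[OF assms(2)[OF W] W(3)] .
  qed
qed


section \<open>The Gabriel--Roiter measure of arbitrary objects\<close>

text \<open>
  By the main property, the largest measure of a summand does not depend on the decomposition:
  the summands of one decomposition embed into the direct sum of the other one.
\<close>

lemma gr_measure_is_max:
  assumes Ys: "\<forall>Y\<in>set Ys. indecomposable C Y" "direct_sum_list C X Ys"
  shows "gr_is_max (insert {} (mu ` set Ys)) (gr_measure C lam X)"
proof -
  have fin: "finite I"
    if "\<forall>Y\<in>set Zs. indecomposable C Y" "I \<in> insert {} (mu ` set Zs)" for I Zs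
    using that mu_is_max(2) by auto
  have le: "gr_le I J" if Zs: "\<forall>Y\<in>set Zs. indecomposable C Y" "direct_sum_list C X Zs"
    and Vs: "\<forall>Y\<in>set Vs. indecomposable C Y" "direct_sum_list C X Vs"
    and I: "gr_is_max (insert {} (mu ` set Zs)) I" and J: "gr_is_max (insert {} (mu ` set Vs)) J"
  for Zs Vs I J
  proof (cases "I = {}")
    case True
    then show ?thesis
      using J unfolding gr_is_max_iff by blast
  next
    case False
    then obtain W where W: "W \<in> set Zs" "I = mu W"
      using I unfolding gr_is_max_iff by blast
    have Obj: "\<forall>Y\<in>set Zs. Y \<in> Obj C" "\<forall>Y\<in>set Vs. Y \<in> Obj C"
      using Zs(1) Vs(1) unfolding indecomposable_def by blast+
    obtain s r where s: "s \<in> homs C W X" "r \<in> homs C X W" "r \<cdot> s = Id C W"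
      using direct_sum_list_projections(2)[OF Obj(1) Zs(2) W(1)] unfolding retract_def by blast
    have "X \<in> Obj C"
      using hom_Obj s(1) by blast
    then have "cogenerated (set Vs) X"
      using cogenerated_ideal direct_sum_list_projections(1)[OF Obj(2) Vs(2)] by blast
    then have "cogenerated {T. indecomposable C T \<and> gr_le (mu T) J} X"
      by (rule cogenerated_mono) (use Vs J in \<open>auto simp: gr_is_max_iff\<close>)
    moreover have "finite J"
      using fin[OF Vs(1)] J unfolding gr_is_max_iff by blast
    ultimately show ?thesis
      using cogenerated_mu_le[OF _ s(1) split_monic[OF s]] Zs(1) W by blast
  qed
  obtain I where I: "gr_is_max (insert {} (mu ` set Ys)) I"
    using gr_is_max_ex[of "insert {} (mu ` set Ys)"] fin[OF Ys(1)] by auto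
  have "gr_measure C lam X = I"
    unfolding gr_measure_def
  proof (rule the_equality)
    fix J
    assume "\<exists>Zs. (\<forall>Y\<in>set Zs. indecomposable C Y) \<and> direct_sum_list C X Zs \<and>
      gr_is_max (insert {} (mu ` set Zs)) J"
    then obtain Zs where Zs: "\<forall>Y\<in>set Zs. indecomposable C Y" "direct_sum_list C X Zs"
      "gr_is_max (insert {} (mu ` set Zs)) J"
      by blast
    have "finite I" "finite J"
      using fin[OF Ys(1)] fin[OF Zs(1)] I Zs(3) unfolding gr_is_max_iff by blast+
    then show "J = I"
      using gr_le_antisym le[OF Ys Zs(1,2) I Zs(3)] le[OF Zs(1,2) Ys Zs(3) I] by blast
  qed (use Ys I in blast)
  then show ?thesis
    using I by simp
qed

lemma gr_measure_indecomposable: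
  assumes "indecomposable C Y"
  shows "gr_measure C lam Y = mu Y"
proof -
  have "direct_sum_list C Y [Y]"
    using direct_sum_list_single assms unfolding indecomposable_def by blast
  then have "gr_is_max {{}, mu Y} (gr_measure C lam Y)"
    using gr_measure_is_max[of "[Y]" Y] assms by simp
  moreover have "gr_less {} (mu Y)"
    using gr_less_psubset[of "mu Y" "{}"] mu_is_max(2)[OF assms] mu_lam(1)[OF assms] by blast
  ultimately show ?thesis
    using gr_less_not_le[of "{}" "mu Y"] mu_is_max(2)[OF assms] unfolding gr_is_max_iff by auto
qed

lemma gr_measure_zero:
  assumes "zero_object C X"
  shows "gr_measure C lam X = {}"
proof -
  have "direct_sum_list C X []"
    unfolding direct_sum_list_def using assms by (intro direct_sum_zero) auto
  then show ?thesis
    using gr_measure_is_max[of "[]" X] unfolding gr_is_max_iff by simp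
qed

lemma finite_gr_measure:
  assumes "X \<in> Obj C"
  shows "finite (gr_measure C lam X)"
proof -
  obtain Ys where "\<forall>Y\<in>set Ys. indecomposable C Y" "direct_sum_list C X Ys"
    using ex_indecomposable_decomposition[OF assms] by blast
  then show ?thesis
    using gr_measure_is_max[of Ys X] mu_is_max(2) unfolding gr_is_max_iff by auto
qed

lemma cogenerated_gr_measure:
  assumes "X \<in> Obj C"
  shows "cogenerated {T. indecomposable C T \<and> gr_le (mu T) (gr_measure C lam X)} X"
proof -
  obtain Ys where Ys: "\<forall>Y\<in>set Ys. indecomposable C Y" "direct_sum_list C X Ys"
    using ex_indecomposable_decomposition[OF assms] by blast
  then have "cogenerated (set Ys) X"
    using cogenerated_ideal[OF direct_sum_list_projections(1) assms] unfolding indecomposable_def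
    by blast
  then show ?thesis
    by (rule cogenerated_mono)
      (use Ys(1) gr_measure_is_max[OF Ys] in \<open>auto simp: gr_is_max_iff\<close>)
qed

text \<open>
  A decomposition of a nonzero object has a summand, and measures of indecomposable objects are
  nonempty; so the maximum is the measure of a summand rather than the default value \<open>{}\<close>.
\<close>

lemma gr_measure_attained:
  assumes "X \<in> Obj C" "\<not> zero_object C X"
  obtains W s where "indecomposable C W" "s \<in> homs C W X" "monic C s" "mu W = gr_measure C lam X"
proof -
  obtain Ys where Ys: "\<forall>Y\<in>set Ys. indecomposable C Y" "direct_sum_list C X Ys"
    using ex_indecomposable_decomposition[OF assms(1)] by blast
  have Obj: "\<forall>Y\<in>set Ys. Y \<in> Obj C"
    using Ys(1) unfolding indecomposable_def by blast
  note max = gr_measure_is_max[OF Ys]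
  have "gr_measure C lam X \<noteq> {}"
  proof
    assume empty: "gr_measure C lam X = {}"
    have "Ys = []"
    proof (rule ccontr)
      assume "Ys \<noteq> []"
      then have Y: "hd Ys \<in> set Ys" "indecomposable C (hd Ys)"
        using Ys(1) by auto
      then have "gr_le (mu (hd Ys)) {}"
        using max empty unfolding gr_is_max_iff by auto
      moreover have "gr_less {} (mu (hd Ys))"
        using gr_less_psubset[of "mu (hd Ys)" "{}"] mu_is_max(2)[OF Y(2)] mu_lam(1)[OF Y(2)] by blast
      ultimately show False
        using gr_less_not_le[of "{}" "mu (hd Ys)"] mu_is_max(2)[OF Y(2)] by blast
    qed
    then have "cogenerated {} X"
      using cogenerated_ideal[OF direct_sum_list_projections(1)[OF Obj Ys(2)] assms(1)] by simp
    then have "Id C X = Zero C X X"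
      using cogenerated_zero[of "{}" X "Id C X" X] assms(1) by simp
    then show False
      using assms zero_object_iff by blast
  qed
  then obtain W where "W \<in> set Ys" "mu W = gr_measure C lam X"
    using max unfolding gr_is_max_iff by auto
  moreover from this obtain s r where "s \<in> homs C W X" "r \<in> homs C X W" "r \<cdot> s = Id C W"
    using direct_sum_list_projections(2)[OF Obj Ys(2)] unfolding retract_def by blast
  ultimately show thesis
    using that Ys(1) split_monic by blast
qed

end


section \<open>Rejects\<close>

context length_category
begin

text \<open>
  Take a minimal one among the subobjects that contain everything on which all morphisms
  \<open>X \<rightarrow> T\<close> vanish. It lies in each kernel, because otherwise it could be intersected with one.
\<close>

lemma ex_reject:
  assumes X: "X \<in> Obj C"
  shows "\<exists>r. is_reject C r X \<Theta>"
proof -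
  define K where "K = {k. \<exists>T\<in>\<Theta>. \<exists>f\<in>homs C X T. is_kernel C k f}"
  define S where "S = {k. subobject C k X \<and>
    (\<forall>g\<in>Arr C. Cod C g = X \<and> (\<forall>k'\<in>K. sub_le C g k') \<longrightarrow> sub_le C g k)}"
  have "sub_le C g (Id C X)" if "g \<in> Arr C" "Cod C g = X" for g
    using that X unfolding sub_le_def by auto
  then have "Id C X \<in> S"
    using monic_Id[OF X] X unfolding S_def subobject_def by auto
  moreover have "subobject C k X" if "k \<in> S" for k
    using that unfolding S_def by blast
  ultimately obtain k where k: "k \<in> S" and min: "\<And>n. n \<in> S \<Longrightarrow> sub_le C n k \<Longrightarrow> sub_le C k n"
    using minimal_subobject[OF X, of S] by blast
  define U where "U = Dom C k"
  have kX: "k \<in> homs C U X" "monic C k"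
    using k unfolding S_def subobject_def monic_def U_def by auto
  have "sub_le C k k'" if "k' \<in> K" for k'
  proof -
    obtain T f where f: "T \<in> \<Theta>" "f \<in> homs C X T" "is_kernel C k' f"
      using \<open>k' \<in> K\<close> unfolding K_def by blast
    have k'X: "k' \<in> homs C (Dom C k') X"
      using is_kernelD(1)[OF f(3,2)] .
    have fk: "f \<cdot> k \<in> homs C U T"
      using f(2) kX(1) by simp
    obtain J j where j: "j \<in> homs C J U" "monic C j" "(f \<cdot> k) \<cdot> j = Zero C J T"
      and j_fac: "\<And>Z g. g \<in> homs C Z U \<Longrightarrow> (f \<cdot> k) \<cdot> g = Zero C Z T \<Longrightarrow> \<exists>h\<in>homs C Z J. j \<cdot> h = g"
      using kernelE[OF fk] by metis
    have kj: "k \<cdot> j \<in> homs C J X"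
      using kX(1) j(1) by simp
    have "sub_le C g (k \<cdot> j)"
      if g: "g \<in> Arr C" "Cod C g = X" "\<forall>k'\<in>K. sub_le C g k'" for g
    proof -
      define Z where "Z = Dom C g"
      have gX: "g \<in> homs C Z X"
        using g by (simp add: Z_def)
      have "sub_le C g k"
        using k g unfolding S_def by blast
      then obtain h where h: "h \<in> homs C Z U" "k \<cdot> h = g"
        by (rule sub_leE[OF _ gX kX(1)])
      have "sub_le C g k'"
        using g \<open>k' \<in> K\<close> by blast
      then obtain h' where h': "h' \<in> homs C Z (Dom C k')" "k' \<cdot> h' = g"
        by (rule sub_leE[OF _ gX k'X])
      have "Z \<in> Obj C" "T \<in> Obj C"
        using hom_Obj gX f(2) by blast+
      have "(f \<cdot> k) \<cdot> h = f \<cdot> (k' \<cdot> h')"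
        unfolding h'(2) using f(2) kX(1) h by simp
      also have "\<dots> = Zero C (Dom C k') T \<cdot> h'"
        using is_kernelD(2)[OF f(3,2)] f(2) k'X h'(1) by (intro Comp_reassoc) auto
      also have "\<dots> = Zero C Z T"
        using h'(1) \<open>T \<in> Obj C\<close> by simp
      finally obtain h'' where h'': "h'' \<in> homs C Z J" "j \<cdot> h'' = h"
        using j_fac[OF h(1)] by blast
      have "(k \<cdot> j) \<cdot> h'' = g"
        using kX(1) j(1) h'' h(2) by simp
      then show ?thesis
        by (rule sub_leI[OF _ gX kj h''(1)])
    qed
    then have "k \<cdot> j \<in> S"
      using monic_Comp[OF j(2) kX(2)] j(1) kX(1) unfolding S_def subobject_def by simp
    moreover have "sub_le C (k \<cdot> j) k"
      by (rule sub_leI[OF _ kj kX(1) j(1)]) simp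
    ultimately have "sub_le C k (k \<cdot> j)"
      by (rule min)
    then obtain t where t: "t \<in> homs C U J" "(k \<cdot> j) \<cdot> t = k"
      by (rule sub_leE[OF _ kX(1) kj])
    have "T \<in> Obj C"
      using hom_Obj f(2) by blast
    have "f \<cdot> k = f \<cdot> ((k \<cdot> j) \<cdot> t)"
      unfolding t(2) ..
    also have "\<dots> = ((f \<cdot> k) \<cdot> j) \<cdot> t"
      using f(2) kX(1) j(1) t(1) by simp
    also have "\<dots> = Zero C U T"
      unfolding j(3) using t(1) \<open>T \<in> Obj C\<close> by simp
    finally obtain h where "h \<in> homs C U (Dom C k')" "k' \<cdot> h = k"
      using is_kernelD(3)[OF f(3,2) kX(1)] by blast
    then show ?thesis
      using sub_leI[OF _ kX(1) k'X] by blast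
  qed
  then have "is_reject C k X \<Theta>"
    using k unfolding is_reject_def is_intersection_def S_def K_def by blast
  then show ?thesis
    by blast
qed

lemma ex_reject_quotient:
  assumes "X \<in> Obj C"
  shows "\<exists>Q. reject_quotient C X \<Theta> Q"
proof -
  obtain r where r: "is_reject C r X \<Theta>"
    using ex_reject[OF assms] by blast
  then have "r \<in> Arr C"
    unfolding is_reject_def is_intersection_def subobject_def monic_def by blast
  then show ?thesis
    using ex_cokernel r unfolding reject_quotient_def by blast
qed

lemma is_rejectD:
  assumes "is_reject C r X \<Theta>"
  shows "r \<in> homs C (Dom C r) X"
    "T \<in> \<Theta> \<Longrightarrow> f \<in> homs C X T \<Longrightarrow> f \<cdot> r = Zero C (Dom C r) T"
    "g \<in> homs C Z X \<Longrightarrow> (\<And>T f. T \<in> \<Theta> \<Longrightarrow> f \<in> homs C X T \<Longrightarrow> f \<cdot> g = Zero C Z T) \<Longrightarrow>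
      \<exists>h\<in>homs C Z (Dom C r). r \<cdot> h = g"
proof -
  define K where "K = {k. \<exists>T\<in>\<Theta>. \<exists>f\<in>homs C X T. is_kernel C k f}"
  have r: "subobject C r X" "\<And>k. k \<in> K \<Longrightarrow> sub_le C r k"
    "\<And>g. g \<in> Arr C \<Longrightarrow> Cod C g = X \<Longrightarrow> (\<And>k. k \<in> K \<Longrightarrow> sub_le C g k) \<Longrightarrow> sub_le C g r"
    using assms unfolding is_reject_def is_intersection_def K_def[symmetric] by blast+
  show rX: "r \<in> homs C (Dom C r) X"
    using r(1) unfolding subobject_def monic_def by auto
  show "f \<cdot> r = Zero C (Dom C r) T" if T: "T \<in> \<Theta>" and f: "f \<in> homs C X T"
  proof -
    obtain V k where k: "is_kernel C k f" "k \<in> homs C V X" "f \<cdot> k = Zero C V T"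
      using kernelE[OF f] by metis
    have "sub_le C r k"
      using r(2) T f k(1) unfolding K_def by blast
    then obtain h where h: "h \<in> homs C (Dom C r) V" "k \<cdot> h = r"
      by (rule sub_leE[OF _ rX k(2)])
    have "T \<in> Obj C"
      using hom_Obj f by blast
    have "f \<cdot> (k \<cdot> h) = Zero C V T \<cdot> h"
      by (rule Comp_reassoc[OF k(3)]) (use f k h in auto)
    also have "\<dots> = Zero C (Dom C r) T"
      using h(1) \<open>T \<in> Obj C\<close> by simp
    finally show ?thesis
      unfolding h(2) .
  qed
  show "\<exists>h\<in>homs C Z (Dom C r). r \<cdot> h = g" if g: "g \<in> homs C Z X"
    and zero: "\<And>T f. T \<in> \<Theta> \<Longrightarrow> f \<in> homs C X T \<Longrightarrow> f \<cdot> g = Zero C Z T"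
  proof -
    have "sub_le C g k" if "k \<in> K" for k
    proof -
      obtain T f where f: "T \<in> \<Theta>" "f \<in> homs C X T" "is_kernel C k f"
        using \<open>k \<in> K\<close> unfolding K_def by blast
      obtain h where "h \<in> homs C Z (Dom C k)" "k \<cdot> h = g"
        using is_kernelD(3)[OF f(3,2) g zero[OF f(1,2)]] by blast
      then show ?thesis
        using sub_leI[OF _ g is_kernelD(1)[OF f(3,2)]] by blast
    qed
    then have "sub_le C g r"
      using g r(3) by simp
    then show ?thesis
      by (rule sub_leE[OF _ g rX]) blast
  qed
qed

text \<open>
  The quotient by the reject is the largest quotient cogenerated by \<open>\<Theta>\<close>. If all morphisms
  \<open>Q \<rightarrow> T\<close> kill \<open>u\<close>, let \<open>c\<close> be the cokernel of \<open>u\<close> and \<open>p\<close> the kernel of \<open>c q\<close>. Every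
  \<open>X \<rightarrow> T\<close> factors through \<open>c q\<close>, hence kills \<open>p\<close>; so \<open>p\<close> lies in the reject, \<open>q\<close> factors
  through \<open>c q\<close>, and \<open>c\<close> is monic.
\<close>

lemma reject_quotientE:
  assumes "reject_quotient C X \<Theta> Q"
  obtains q where "q \<in> homs C X Q" "epic C q" "cogenerated \<Theta> Q"
    "\<And>M g. cogenerated \<Theta> M \<Longrightarrow> g \<in> homs C X M \<Longrightarrow> \<exists>h\<in>homs C Q M. h \<cdot> q = g"
proof -
  obtain r q where r: "is_reject C r X \<Theta>" and q: "is_cokernel C q r" and "Cod C q = Q"
    using assms unfolding reject_quotient_def by blast
  note reject = is_rejectD[OF r] and coker = is_cokernelD[OF q is_rejectD(1)[OF r]]
  have qQ: "q \<in> homs C X Q" and epic: "epic C q"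
    using coker(1) cokernel_epic[OF q] \<open>Cod C q = Q\<close> by auto
  have XO: "X \<in> Obj C" "Q \<in> Obj C"
    using hom_Obj[OF qQ] by auto
  show thesis
  proof (rule that[OF qQ epic])
    show "\<exists>h\<in>homs C Q M. h \<cdot> q = g" if M: "cogenerated \<Theta> M" and g: "g \<in> homs C X M" for M g
    proof -
      have "g \<cdot> r = Zero C (Dom C r) M"
      proof (rule cogenerated_zero[OF M])
        show "g \<cdot> r \<in> homs C (Dom C r) M"
          using g reject(1) by simp
        fix T f
        assume "T \<in> \<Theta>" "f \<in> homs C M T"
        then show "f \<cdot> (g \<cdot> r) = Zero C (Dom C r) T"
          using reject(2)[of T "f \<cdot> g"] g reject(1) by simp
      qed
      then show ?thesis
        using coker(3)[OF g] \<open>Cod C q = Q\<close> by simp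
    qed
    show "cogenerated \<Theta> Q"
    proof (rule cogeneratedI[OF XO(2)])
      fix Z u
      assume u: "u \<in> homs C Z Q" and zero: "\<And>T g. T \<in> \<Theta> \<Longrightarrow> g \<in> homs C Q T \<Longrightarrow> g \<cdot> u = Zero C Z T"
      obtain D c where c: "c \<in> homs C Q D" "epic C c" "c \<cdot> u = Zero C Z D"
        and c_fac: "\<And>V g. g \<in> homs C Q V \<Longrightarrow> g \<cdot> u = Zero C Z V \<Longrightarrow> \<exists>h\<in>homs C D V. h \<cdot> c = g"
        using cokernelE[OF u] by metis
      have cq: "c \<cdot> q \<in> homs C X D" "epic C (c \<cdot> q)"
        using epic_Comp[OF epic c(2)] c(1) qQ by auto
      obtain P p where p: "is_kernel C p (c \<cdot> q)" "p \<in> homs C P X" "(c \<cdot> q) \<cdot> p = Zero C P D"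
        using kernelE[OF cq(1)] by metis
      have PO: "P \<in> Obj C" "Z \<in> Obj C"
        using hom_Obj p(2) u by blast+
      have "f \<cdot> p = Zero C P T" if T: "T \<in> \<Theta>" and f: "f \<in> homs C X T" for T f
      proof -
        obtain g where g: "g \<in> homs C Q T" "g \<cdot> q = f"
          using coker(3)[OF f reject(2)[OF T f]] \<open>Cod C q = Q\<close> by blast
        obtain h where h: "h \<in> homs C D T" "h \<cdot> c = g"
          using c_fac[OF g(1) zero[OF T g(1)]] by blast
        have "f \<cdot> p = ((h \<cdot> c) \<cdot> q) \<cdot> p"
          unfolding h(2) g(2) ..
        also have "\<dots> = h \<cdot> ((c \<cdot> q) \<cdot> p)"
          using h(1) c(1) qQ p(2) by simp
        also have "\<dots> = Zero C P T"
          unfolding p(3) using h(1) PO by simp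
        finally show ?thesis .
      qed
      then obtain h where h: "h \<in> homs C P (Dom C r)" "r \<cdot> h = p"
        using reject(3)[OF p(2)] by blast
      have "q \<cdot> (r \<cdot> h) = Zero C (Dom C r) Q \<cdot> h"
        by (rule Comp_reassoc) (use coker(2) reject(1) qQ h \<open>Cod C q = Q\<close> in auto)
      then have "q \<cdot> p = Zero C P Q"
        unfolding h(2) using h(1) XO by simp
      moreover have "is_cokernel C (c \<cdot> q) p"
        using epic_cokernel_of_kernel[OF cq(2,1) p(1)] .
      ultimately have "\<exists>t\<in>homs C (Cod C (c \<cdot> q)) Q. t \<cdot> (c \<cdot> q) = q"
        using is_cokernelD(3)[OF _ p(2) qQ] by blast
      moreover have "Cod C (c \<cdot> q) = D"
        using cq(1) by simp
      ultimately obtain t where t: "t \<in> homs C D Q" "t \<cdot> (c \<cdot> q) = q"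
        by metis
      have "(t \<cdot> c) \<cdot> q = Id C Q \<cdot> q"
        using t c(1) qQ by simp
      then have tc: "t \<cdot> c = Id C Q"
        by (rule epic_cancel[OF epic, rotated -1]) (use t c qQ XO in auto)
      have "t \<cdot> (c \<cdot> u) = Id C Q \<cdot> u"
        by (rule Comp_reassoc[OF tc]) (use t c u in auto)
      then show "u = Zero C Z Q"
        unfolding c(3) using u t(1) PO by simp
    qed
  qed
qed

text \<open>
  Passing from representatives to all indecomposable objects makes the description of
  \<open>\<A>(<I)\<close> invariant under isomorphisms.
\<close>

lemma cogenerated_gr_below_iff:
  assumes R: "ind_representatives C R"
  shows "cogenerated (gr_below C lam R I) M \<longleftrightarrow>
    cogenerated {T. indecomposable C T \<and> gr_less (mu T) I} M"
proof
  have "gr_below C lam R I \<subseteq> {T. indecomposable C T \<and> gr_less (mu T) I}"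
    using R gr_measure_indecomposable unfolding gr_below_def ind_representatives_def by auto
  then show "cogenerated (gr_below C lam R I) M \<Longrightarrow>
      cogenerated {T. indecomposable C T \<and> gr_less (mu T) I} M"
    using cogenerated_mono by blast
next
  assume "cogenerated {T. indecomposable C T \<and> gr_less (mu T) I} M"
  then show "cogenerated (gr_below C lam R I) M"
  proof (rule cogenerated_trans)
    fix T
    assume "T \<in> {T. indecomposable C T \<and> gr_less (mu T) I}"
    then have T: "indecomposable C T" "gr_less (mu T) I"
      by auto
    then obtain T' where T': "T' \<in> R" "isomorphic C T T'"
      using R unfolding ind_representatives_def by blast
    then obtain f where f: "f \<in> homs C T T'" "isomorphism C f"
      unfolding isomorphic_def by blast
    have "indecomposable C T'"
      using R T'(1) unfolding ind_representatives_def by blast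
    then have below: "T' \<in> gr_below C lam R I"
      using mu_iso[OF T(1) _ f(2,1)] T(2) T'(1) gr_measure_indecomposable
      unfolding gr_below_def by simp
    show "cogenerated (gr_below C lam R I) T"
    proof (rule cogeneratedI)
      show "T \<in> Obj C"
        using hom_Obj f(1) by blast
      fix Z u
      assume u: "u \<in> homs C Z T"
        "\<And>V g. V \<in> gr_below C lam R I \<Longrightarrow> g \<in> homs C T V \<Longrightarrow> g \<cdot> u = Zero C Z V"
      have "f \<cdot> u = Zero C Z T'"
        using u(2)[OF below f(1)] .
      then show "u = Zero C Z T"
        using monic_zero[OF isomorphism_monic[OF f(2,1)], of u Z] u(1) f(1) by simp
    qed
  qed
qed

end


section \<open>Additive closures\<close>

context abelian_category
begin

lemma ideal_singleton_retract: "retract C Z S \<Longrightarrow> ideal C {S} Z Z (Id C Z)"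
  unfolding retract_def using ideal_through[of S "{S}"] by fastforce

lemma factors_through_iff:
  assumes "f \<in> homs C X Y"
  shows "factors_through C f W \<longleftrightarrow> (\<exists>g\<in>homs C X W. \<exists>h\<in>homs C W Y. h \<cdot> g = f)"
  using assms by (simp add: factors_through_def)

text \<open>
  One more copy of \<open>S\<close> accommodates one more term \<open>b a\<close> of the sum.
\<close>

lemma ideal_factors_power:
  assumes "ideal C {S} Y Z f" "S \<in> Obj C"
  shows "\<exists>n T. direct_sum_list C T (replicate n S) \<and> factors_through C f T"
  using assms(1)
proof (induction rule: ideal.induct)
  case zero
  obtain N where N: "zero_object C N"
    using ex_zero_object by blast
  then have "direct_sum_list C N (replicate 0 S)"
    unfolding direct_sum_list_def by (intro direct_sum_zero) auto
  moreover have "factors_through C (Zero C Y Z) N"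
    using zero N zero_object_iff unfolding factors_through_def
    by (intro bexI[of _ "Zero C Y N"] bexI[of _ "Zero C N Z"]) auto
  ultimately show ?case
    by blast
next
  case (step W a b g)
  then have W: "W = S"
    by simp
  obtain n T where T: "direct_sum_list C T (replicate n S)" "factors_through C g T"
    using step.IH by blast
  have gYZ: "g \<in> homs C Y Z"
    using ideal_homs[OF step(4)] .
  obtain k h where k: "k \<in> homs C Y T" and h: "h \<in> homs C T Z" and g: "h \<cdot> k = g"
    using T(2) unfolding factors_through_iff[OF gYZ] by blast
  have a: "a \<in> homs C Y S" and b: "b \<in> homs C S Z"
    using step(2,3) W by auto
  have Obj: "T \<in> Obj C" "Y \<in> Obj C" "Z \<in> Obj C"
    using hom_Obj k h by blast+
  obtain U where U: "direct_sum_list C U [S, T]"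
    using ex_direct_sum[OF assms(2) Obj(1)] by blast
  then obtain i j p q where i: "i \<in> homs C S U" and j: "j \<in> homs C T U"
    and p: "p \<in> homs C U S" and q: "q \<in> homs C U T"
    and eqs: "p \<cdot> i = Id C S" "q \<cdot> j = Id C T" "p \<cdot> j = Zero C T S" "q \<cdot> i = Zero C S T"
    by (rule direct_sum_biproduct)
  have comps: "p \<cdot> (i \<cdot> a) = a" "q \<cdot> (j \<cdot> k) = k" "p \<cdot> (j \<cdot> k) = Zero C Y S" "q \<cdot> (i \<cdot> a) = Zero C Y T"
    using Comp_reassoc[OF eqs(1), of a] Comp_reassoc[OF eqs(2), of k] Comp_reassoc[OF eqs(3), of k]
      Comp_reassoc[OF eqs(4), of a] i j p q a k assms(2) Obj by auto
  have "Add C (b \<cdot> p) (h \<cdot> q) \<cdot> Add C (i \<cdot> a) (j \<cdot> k) = Add C (b \<cdot> a) g"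
    using a b k h i j p q comps Obj assms(2) gYZ by (simp add: g)
  moreover have "Add C (i \<cdot> a) (j \<cdot> k) \<in> homs C Y U" "Add C (b \<cdot> p) (h \<cdot> q) \<in> homs C U Z"
    "Add C (b \<cdot> a) g \<in> homs C Y Z"
    using a b k h i j p q gYZ by auto
  ultimately have "factors_through C (Add C (b \<cdot> a) g) U"
    using factors_through_iff by blast
  moreover have "direct_sum_list C U (replicate (Suc n) S)"
    using direct_sum_append[OF direct_sum_list_single[OF assms(2)] T(1) U] by simp
  ultimately show ?case
    unfolding W by blast
qed

lemma subcategory_ideal: "subcategory C {Z \<in> Obj C. ideal C P Z Z (Id C Z)}"
  unfolding subcategory_def
proof (intro conjI ballI allI impI)
  fix X Y
  assume X: "X \<in> {Z \<in> Obj C. ideal C P Z Z (Id C Z)}" and "isomorphic C X Y"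
  then obtain f where f: "isomorphism C f" "f \<in> homs C X Y"
    unfolding isomorphic_def by blast
  then obtain g where "g \<in> homs C Y X" "f \<cdot> g = Id C Y"
    using isomorphismE by metis
  then have "retract C Y X"
    using f(2) unfolding retract_def by blast
  then show "Y \<in> {Z \<in> Obj C. ideal C P Z Z (Id C Z)}"
    using ideal_retract X hom_Obj f(2) by blast
next
  fix Ys S
  assume Ys: "set Ys \<subseteq> {Z \<in> Obj C. ideal C P Z Z (Id C Z)} \<and> direct_sum_list C S Ys"
  then have "S \<in> Obj C"
    unfolding direct_sum_list_def direct_sum_def by blast
  moreover have "ideal C (set Ys) S S (Id C S)"
    using direct_sum_list_projections(1) Ys by blast
  ultimately show "S \<in> {Z \<in> Obj C. ideal C P Z Z (Id C Z)}"
    using ideal_trans[of "set Ys" S S "Id C S" P] Ys by blast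
next
  fix S Z
  assume "S \<in> {Z \<in> Obj C. ideal C P Z Z (Id C Z)}" "direct_summand C Z S"
  then show "Z \<in> {Z \<in> Obj C. ideal C P Z Z (Id C Z)}"
    using direct_summand_retract[of Z S] ideal_retract hom_Obj unfolding retract_def by blast
qed auto

end


section \<open>The sequence of quotients\<close>

locale gr_sequence = length_category C lam
  for C :: "('o, 'm) additive_cat" (structure) and lam +
  fixes R :: "'o set" and Xs :: "nat \<Rightarrow> 'o"
  assumes R: "ind_representatives C R"
    and Xs_1_Obj: "Xs 1 \<in> Obj C"
    and Xs_step: "1 \<le> i \<Longrightarrow>
      reject_quotient C (Xs i) (gr_below C lam R (gr_measure C lam (Xs i))) (Xs (i + 1))"
begin

abbreviation measure_at :: "nat \<Rightarrow> real set" where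
  "measure_at i \<equiv> gr_measure C lam (Xs i)"

definition small :: "real set \<Rightarrow> 'o set" where
  "small I = {T. indecomposable C T \<and> gr_less (mu T) I}"

lemma quotient_map:
  assumes "1 \<le> i"
  obtains q where "q \<in> homs C (Xs i) (Xs (Suc i))" "epic C q"
    "cogenerated (small (measure_at i)) (Xs (Suc i))"
    "\<And>M g. cogenerated (small (measure_at i)) M \<Longrightarrow> g \<in> homs C (Xs i) M \<Longrightarrow>
      \<exists>h\<in>homs C (Xs (Suc i)) M. h \<cdot> q = g"
proof -
  have "cogenerated (gr_below C lam R (measure_at i)) = cogenerated (small (measure_at i))"
    using cogenerated_gr_below_iff[OF R] by (auto simp: small_def fun_eq_iff)
  note reject_quotientE[OF Xs_step[OF assms], unfolded this Suc_eq_plus1[symmetric]]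
  then show thesis
    using that by blast
qed

lemma Xs_Obj: "1 \<le> i \<Longrightarrow> Xs i \<in> Obj C"
proof (induction i rule: dec_induct)
  case base
  show ?case
    by (rule Xs_1_Obj)
next
  case (step i)
  then obtain q where "q \<in> homs C (Xs i) (Xs (Suc i))"
    using quotient_map[of i] by blast
  then show ?case
    using hom_Obj by blast
qed

lemma finite_measure_at: "1 \<le> i \<Longrightarrow> finite (measure_at i)"
  using finite_gr_measure Xs_Obj by blast

lemma zero_Suc:
  assumes "1 \<le> i" "zero_object C (Xs i)"
  shows "zero_object C (Xs (Suc i))"
proof -
  obtain q where q: "q \<in> homs C (Xs i) (Xs (Suc i))" "epic C q"
    using quotient_map[OF assms(1)] by blast
  have Obj: "Xs (Suc i) \<in> Obj C" "Xs i \<in> Obj C"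
    using hom_Obj q(1) by blast+
  have "Id C (Xs (Suc i)) \<cdot> q = Zero C (Xs i) (Xs (Suc i))"
    using zero_object_hom(2)[OF assms(2) q(1)] Obj by simp
  then have "Id C (Xs (Suc i)) = Zero C (Xs (Suc i)) (Xs (Suc i))"
    using epic_zero[OF q(2), of "Id C (Xs (Suc i))" "Xs (Suc i)"] q(1) Obj by simp
  then show ?thesis
    using zero_object_iff Obj by blast
qed

text \<open>
  \<open>X\<^bsub>i+1\<^esub>\<close> is cogenerated by objects of measure below \<open>\<mu>(X\<^sub>i)\<close>, hence by the main property the
  same bound holds for its indecomposable summands.
\<close>

lemma measure_Suc_less:
  assumes "1 \<le> i" "\<not> zero_object C (Xs i)"
  shows "gr_less (measure_at (Suc i)) (measure_at i)"
proof (cases "zero_object C (Xs (Suc i))")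
  case True
  obtain W s where "indecomposable C W" "mu W = measure_at i"
    using gr_measure_attained[OF Xs_Obj assms(2)] assms(1) by blast
  then have "measure_at i \<noteq> {}"
    using mu_lam(1) by blast
  then show ?thesis
    using gr_measure_zero[OF True] gr_less_psubset[OF finite_measure_at[OF assms(1)], of "{}"] by auto
next
  case False
  have "Xs (Suc i) \<in> Obj C"
    by (rule Xs_Obj) simp
  then obtain W s where W: "indecomposable C W" "s \<in> homs C W (Xs (Suc i))" "monic C s"
      "mu W = measure_at (Suc i)"
    using gr_measure_attained False by blast
  have "cogenerated (small (measure_at i)) (Xs (Suc i))"
    using quotient_map[OF assms(1)] by blast
  then show ?thesis
    using cogenerated_mu_less[OF W(1-3) finite_measure_at[OF assms(1)]] W(4)
    unfolding small_def by simp
qed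

lemma measure_antimono:
  assumes "1 \<le> i" "i \<le> j"
  shows "gr_le (measure_at j) (measure_at i)"
  using assms(2)
proof (induction j rule: dec_induct)
  case base
  show ?case
    by simp
next
  case (step j)
  have j: "1 \<le> j"
    using step assms(1) by simp
  have "gr_le (measure_at (Suc j)) (measure_at j)"
  proof (cases "zero_object C (Xs j)")
    case True
    then show ?thesis
      using zero_Suc[OF j] gr_measure_zero by simp
  next
    case False
    then show ?thesis
      using measure_Suc_less[OF j] unfolding gr_le_def by blast
  qed
  then show ?case
    using gr_le_trans[OF _ _ _ _ step.IH] finite_measure_at j assms(1) by simp
qed

lemma cogenerated_later:
  assumes "1 \<le> i" "i < j"
  shows "cogenerated (small (measure_at i)) (Xs j)"
proof -
  obtain k where k: "j = Suc k" "i \<le> k"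
    using assms(2) by (metis Suc_leI Suc_le_D Suc_le_mono)
  have "cogenerated (small (measure_at k)) (Xs j)"
    using quotient_map[of k] k assms(1) by (metis le_trans)
  moreover have "gr_less (mu T) (measure_at i)"
    if "indecomposable C T" "gr_less (mu T) (measure_at k)" for T
    using gr_less_le_trans[OF mu_is_max(2)[OF that(1)] _ _ that(2) measure_antimono[OF assms(1) k(2)]]
      finite_measure_at k(2) assms(1) by simp
  then have "small (measure_at k) \<subseteq> small (measure_at i)"
    unfolding small_def by blast
  ultimately show ?thesis
    by (rule cogenerated_mono)
qed

text \<open>
  If \<open>X\<^sub>i \<noteq> 0\<close>, then \<open>X\<^sub>i \<rightarrow> X\<^bsub>i+1\<^esub>\<close> is not an isomorphism because the measure drops, and so
  the number of \<open>\<lambda>\<close>-values on subobjects decreases.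
\<close>

lemma ex_zero: "\<exists>l. zero_object C (Xs (l + 1))"
proof (rule ccontr)
  assume no_zero: "\<not> ?thesis"
  have less: "sub_size (Xs (Suc (Suc l))) < sub_size (Xs (Suc l))" for l
  proof -
    obtain q where q: "q \<in> homs C (Xs (Suc l)) (Xs (Suc (Suc l)))" "epic C q"
      using quotient_map[of "Suc l"] by auto
    have "\<not> isomorphism C q"
    proof
      assume iso: "isomorphism C q"
      have nz: "\<not> zero_object C (Xs (Suc l))"
        using no_zero by simp
      have "Xs (Suc l) \<in> Obj C"
        using hom_Obj q(1) by blast
      then obtain W s where W: "indecomposable C W" "s \<in> homs C W (Xs (Suc l))" "monic C s"
          "mu W = measure_at (Suc l)"
        using gr_measure_attained nz by blast
      have "monic C (q \<cdot> s)" "q \<cdot> s \<in> homs C W (Xs (Suc (Suc l)))"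
        using monic_Comp[OF W(3) isomorphism_monic[OF iso q(1)]] q(1) W(2) by auto
      then have "gr_less (mu W) (measure_at (Suc l))"
        using cogenerated_mu_less[OF W(1) _ _ finite_measure_at]
          cogenerated_later[of "Suc l" "Suc (Suc l)"] unfolding small_def by auto
      then show False
        using W(4) by simp
    qed
    then show ?thesis
      using sub_size_epic_less[OF q(2,1)] by blast
  qed
  have "sub_size (Xs (Suc l)) + l \<le> sub_size (Xs 1)" for l
  proof (induction l)
    case (Suc l)
    then show ?case
      using less[of l] by simp
  qed simp
  from this[of "Suc (sub_size (Xs 1))"] show False
    by simp
qed

definition len :: nat where
  "len = (LEAST l. zero_object C (Xs (l + 1)))"

lemma zero_iff:
  assumes "1 \<le> i"
  shows "zero_object C (Xs i) \<longleftrightarrow> len < i"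
proof
  assume "zero_object C (Xs i)"
  then have "zero_object C (Xs (i - 1 + 1))"
    using assms by simp
  then have "len \<le> i - 1"
    unfolding len_def by (rule Least_le)
  then show "len < i"
    using assms by simp
next
  assume "len < i"
  then have "Suc len \<le> i"
    by simp
  then show "zero_object C (Xs i)"
  proof (induction i rule: dec_induct)
    case base
    show ?case
      using LeastI_ex[OF ex_zero] unfolding len_def by simp
  next
    case (step i)
    then show ?case
      using zero_Suc[of i] by simp
  qed
qed

text \<open>
  Morphisms \<open>X\<^sub>j \<rightarrow> X\<^sub>k\<close> with \<open>k > j\<close> factor through \<open>X\<^sub>j \<rightarrow> X\<^bsub>j+1\<^esub>\<close>, because \<open>X\<^sub>k\<close> is
  cogenerated by objects of measure below \<open>\<mu>(X\<^sub>j)\<close>. Iterating this, \<open>X\<^sub>j \<rightarrow> X\<^sub>i\<close> is a left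
  approximation.
\<close>

lemma projection:
  assumes "1 \<le> j" "j \<le> i"
  shows "\<exists>p\<in>homs C (Xs j) (Xs i). epic C p \<and>
    (\<forall>k\<ge>i. \<forall>g\<in>homs C (Xs j) (Xs k). \<exists>h\<in>homs C (Xs i) (Xs k). h \<cdot> p = g)"
  using assms(2)
proof (induction i rule: dec_induct)
  case base
  have "Xs j \<in> Obj C"
    using Xs_Obj assms(1) by blast
  then show ?case
    using epic_Id by (intro bexI[of _ "Id C (Xs j)"]) auto
next
  case (step i)
  obtain p where p: "p \<in> homs C (Xs j) (Xs i)" "epic C p"
    and p_fac: "\<And>k g. i \<le> k \<Longrightarrow> g \<in> homs C (Xs j) (Xs k) \<Longrightarrow> \<exists>h\<in>homs C (Xs i) (Xs k). h \<cdot> p = g"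
    using step.IH by blast
  have i: "1 \<le> i"
    using step assms(1) by simp
  obtain q where q: "q \<in> homs C (Xs i) (Xs (Suc i))" "epic C q"
    and q_fac: "\<And>M g. cogenerated (small (measure_at i)) M \<Longrightarrow> g \<in> homs C (Xs i) M \<Longrightarrow>
      \<exists>h\<in>homs C (Xs (Suc i)) M. h \<cdot> q = g"
    using quotient_map[OF i] by metis
  have "\<exists>h\<in>homs C (Xs (Suc i)) (Xs k). h \<cdot> (q \<cdot> p) = g"
    if k: "Suc i \<le> k" and g: "g \<in> homs C (Xs j) (Xs k)" for k g
  proof -
    obtain h where h: "h \<in> homs C (Xs i) (Xs k)" "h \<cdot> p = g"
      using p_fac[OF _ g] k by auto
    obtain h' where h': "h' \<in> homs C (Xs (Suc i)) (Xs k)" "h' \<cdot> q = h"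
      using q_fac[OF cogenerated_later h(1)] i k by auto
    have "h' \<cdot> (q \<cdot> p) = h \<cdot> p"
      by (rule Comp_reassoc[OF h'(2)]) (use h' q p in auto)
    then show ?thesis
      using h'(1) h(2) by blast
  qed
  moreover have "epic C (q \<cdot> p)" "q \<cdot> p \<in> homs C (Xs j) (Xs (Suc i))"
    using epic_Comp[OF p(2) q(2)] p(1) q(1) by auto
  ultimately show ?case
    by blast
qed


section \<open>The subcategories of the chain\<close>

definition tail :: "nat \<Rightarrow> 'o set" where
  "tail i = Xs ` {i..}"

lemma tail_Suc: "tail i = insert (Xs i) (tail (Suc i))"
proof -
  have "{i..} = insert i {Suc i..}"
    by auto
  then show ?thesis
    by (simp add: tail_def)
qed

lemma tail_antimono: "i \<le> j \<Longrightarrow> tail j \<subseteq> tail i"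
  unfolding tail_def by auto

lemma ex_tail_direct_sum:
  assumes "1 \<le> i"
  shows "\<exists>S. direct_sum C S {i..} Xs"
proof (cases "i \<le> Suc len")
  case True
  then show ?thesis
    using assms
  proof (induction i rule: inc_induct)
    case base
    have "zero_object C (Xs (Suc len))"
      using zero_iff by simp
    then show ?case
      using zero_iff by (intro exI[of _ "Xs (Suc len)"] direct_sum_zero) auto
  next
    case (step i)
    then obtain S where S: "direct_sum C S {Suc i..} Xs"
      by auto
    then have "S \<in> Obj C"
      unfolding direct_sum_def by blast
    then obtain T where T: "direct_sum_list C T [Xs i, S]"
      using ex_direct_sum Xs_Obj step by blast
    have "direct_sum C T ({i} \<union> {Suc i..}) Xs"
      using Xs_Obj step by (intro direct_sum_Un[OF direct_sum_singleton S _ T]) auto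
    moreover have "{i} \<union> {Suc i..} = {i..}"
      by auto
    ultimately show ?case
      by auto
  qed
next
  case False
  then show ?thesis
    using zero_iff assms by (intro exI[of _ "Xs i"] direct_sum_zero) auto
qed

lemma tail_direct_sum:
  assumes "1 \<le> i" "direct_sum C S {i..} Xs"
  shows "S \<in> Obj C" "ideal C (tail i) S S (Id C S)" "i \<le> j \<Longrightarrow> retract C (Xs j) S"
proof -
  show "S \<in> Obj C"
    using assms(2) unfolding direct_sum_def by blast
  have Obj: "Xs j \<in> Obj C" if "j \<in> {i..}" for j
    using Xs_Obj that assms(1) by simp
  have "{j \<in> {i..}. \<not> zero_object C (Xs j)} \<subseteq> {..len}"
    using zero_iff assms(1) by auto
  then have fin: "finite {j \<in> {i..}. \<not> zero_object C (Xs j)}"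
    using finite_subset by blast
  have "ideal C (tail i) S S (Id C S) \<and> (\<forall>j\<in>{i..}. retract C (Xs j) S)"
    using assms(2) Obj fin
  proof (rule direct_sum_projections)
    fix \<iota> \<pi>
    assume "\<And>j. j \<in> {i..} \<Longrightarrow> \<iota> j \<in> homs C (Xs j) S" "\<And>j. j \<in> {i..} \<Longrightarrow> \<pi> j \<in> homs C S (Xs j)"
      "\<And>j. j \<in> {i..} \<Longrightarrow> \<pi> j \<cdot> \<iota> j = Id C (Xs j)" "ideal C (Xs ` {i..}) S S (Id C S)"
    then show "ideal C (tail i) S S (Id C S) \<and> (\<forall>j\<in>{i..}. retract C (Xs j) S)"
      unfolding retract_def tail_def by blast
  qed
  then show "ideal C (tail i) S S (Id C S)" "i \<le> j \<Longrightarrow> retract C (Xs j) S"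
    by auto
qed

lemma ideal_tail_power:
  assumes "1 \<le> i" "direct_sum C S {i..} Xs" "ideal C (tail i) Y Z f"
  shows "\<exists>n T. direct_sum_list C T (replicate n S) \<and> factors_through C f T"
proof (rule ideal_factors_power)
  show "ideal C {S} Y Z f"
    using assms(3)
  proof (rule ideal_trans)
    fix W
    assume "W \<in> tail i"
    then obtain j where "i \<le> j" "W = Xs j"
      unfolding tail_def by auto
    then show "ideal C {S} W W (Id C W)"
      using tail_direct_sum(3)[OF assms(1,2)] ideal_singleton_retract by blast
  qed
qed (use tail_direct_sum assms in blast)

lemma add_tail_iff:
  assumes "1 \<le> i"
  shows "Z \<in> add_tail C Xs i \<longleftrightarrow> Z \<in> Obj C \<and> ideal C (tail i) Z Z (Id C Z)"
proof
  assume "Z \<in> add_tail C Xs i"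
  then obtain S n T where S: "direct_sum C S {i..} Xs" and T: "direct_sum_list C T (replicate n S)"
    and Z: "direct_summand C Z T"
    unfolding add_tail_def add_closure_def by blast
  have "ideal C (set (replicate n S)) T T (Id C T)"
    using tail_direct_sum(1)[OF assms S] by (intro direct_sum_list_projections(1)[OF _ T]) auto
  then have "ideal C (tail i) T T (Id C T)"
    by (rule ideal_trans) (use tail_direct_sum(2)[OF assms S] in auto)
  moreover have "retract C Z T"
    using direct_summand_retract[OF Z] .
  ultimately show "Z \<in> Obj C \<and> ideal C (tail i) Z Z (Id C Z)"
    using ideal_retract hom_Obj unfolding retract_def by blast
next
  assume Z: "Z \<in> Obj C \<and> ideal C (tail i) Z Z (Id C Z)"
  obtain S where S: "direct_sum C S {i..} Xs"
    using ex_tail_direct_sum[OF assms] by blast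
  obtain n T where T: "direct_sum_list C T (replicate n S)" "factors_through C (Id C Z) T"
    using ideal_tail_power[OF assms S] Z by blast
  have "Id C Z \<in> homs C Z Z"
    using Id_homs Z by blast
  then have "retract C Z T"
    using T(2) factors_through_iff unfolding retract_def by blast
  then show "Z \<in> add_tail C Xs i"
    using S T(1) direct_summand_iff_retract unfolding add_tail_def add_closure_def by blast
qed

lemma ideal_tail_factors:
  assumes "1 \<le> i" "ideal C (tail i) Y Z f"
  shows "\<exists>W\<in>add_tail C Xs i. factors_through C f W"
proof -
  obtain S where S: "direct_sum C S {i..} Xs"
    using ex_tail_direct_sum[OF assms(1)] by blast
  obtain n T where T: "direct_sum_list C T (replicate n S)" "factors_through C f T"
    using ideal_tail_power[OF assms(1) S assms(2)] by blast
  have "T \<in> Obj C"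
    using T(1) unfolding direct_sum_list_def direct_sum_def by blast
  then have "retract C T T"
    unfolding retract_def by (intro bexI[of _ "Id C T"]) auto
  then have "T \<in> add_tail C Xs i"
    using S T(1) direct_summand_iff_retract unfolding add_tail_def add_closure_def by blast
  then show ?thesis
    using T(2) by blast
qed

lemma subcategory_add_tail:
  assumes "1 \<le> i"
  shows "subcategory C (add_tail C Xs i)"
proof -
  have "add_tail C Xs i = {Z \<in> Obj C. ideal C (tail i) Z Z (Id C Z)}"
    using add_tail_iff[OF assms] by blast
  then show ?thesis
    using subcategory_ideal by simp
qed

lemma add_tail_zero: "add_tail C Xs (len + 1) = {Z. zero_object C Z}"
proof (rule subset_antisym; rule subsetI)
  fix Z
  assume "Z \<in> add_tail C Xs (len + 1)"
  then have Z: "Z \<in> Obj C" "ideal C (tail (Suc len)) Z Z (Id C Z)"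
    using add_tail_iff by auto
  have "Id C Z \<cdot> Id C Z = Zero C Z Z"
  proof (rule ideal_annihilates[OF Z(2) Id_homs[OF Z(1)]])
    fix W a
    assume "W \<in> tail (Suc len)" and a: "a \<in> homs C Z W"
    then have "zero_object C W"
      using zero_iff unfolding tail_def by auto
    then show "a \<cdot> Id C Z = Zero C Z W"
      using zero_object_hom(1)[OF _ a] a by simp
  qed
  then show "Z \<in> {Z. zero_object C Z}"
    using Z(1) zero_object_iff by simp
next
  fix Z
  assume "Z \<in> {Z. zero_object C Z}"
  then have "Z \<in> Obj C" "Id C Z = Zero C Z Z"
    using zero_object_iff by auto
  then show "Z \<in> add_tail C Xs (len + 1)"
    using add_tail_iff[of "len + 1"] ideal.zero[of Z C Z "tail (len + 1)"] by simp
qed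

text \<open>
  The inclusion is proper: if \<open>X\<^sub>i\<close> belonged to the next subcategory, then it would be
  cogenerated by objects of measure below \<open>\<mu>(X\<^sub>i)\<close>, against the main property.
\<close>

lemma add_tail_psubset:
  assumes "1 \<le> i" "i \<le> len"
  shows "add_tail C Xs (i + 1) \<subset> add_tail C Xs i"
proof
  show "add_tail C Xs (i + 1) \<subseteq> add_tail C Xs i"
    using add_tail_iff[OF assms(1)] add_tail_iff[of "i + 1"] ideal_mono tail_antimono[of i "i + 1"]
    by auto
  have Xi: "Xs i \<in> Obj C" "\<not> zero_object C (Xs i)"
    using Xs_Obj zero_iff assms by auto
  have "Id C (Xs i) \<cdot> Id C (Xs i) = Id C (Xs i)"
    using Xi(1) by simp
  then have "ideal C (tail i) (Xs i) (Xs i) (Id C (Xs i))"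
    using ideal_through[of "Xs i" "tail i" "Id C (Xs i)" "Xs i" "Id C (Xs i)" "Xs i"] Id_homs[OF Xi(1)]
    unfolding tail_def by simp
  then have "Xs i \<in> add_tail C Xs i"
    using add_tail_iff[OF assms(1)] Xi(1) by blast
  moreover have "Xs i \<notin> add_tail C Xs (i + 1)"
  proof
    assume "Xs i \<in> add_tail C Xs (i + 1)"
    then have "ideal C (tail (Suc i)) (Xs i) (Xs i) (Id C (Xs i))"
      using add_tail_iff[of "i + 1"] by simp
    then have "cogenerated (tail (Suc i)) (Xs i)"
      using cogenerated_ideal Xi(1) by blast
    then have "cogenerated (small (measure_at i)) (Xs i)"
    proof (rule cogenerated_trans)
      fix T
      assume "T \<in> tail (Suc i)"
      then show "cogenerated (small (measure_at i)) T"
        using cogenerated_later[OF assms(1)] unfolding tail_def by auto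
    qed
    moreover obtain W s where W: "indecomposable C W" "s \<in> homs C W (Xs i)" "monic C s"
        "mu W = measure_at i"
      using gr_measure_attained[OF Xi] .
    ultimately have "gr_less (mu W) (measure_at i)"
      using cogenerated_mu_less[OF W(1-3) finite_measure_at[OF assms(1)]]
      unfolding small_def by blast
    then show False
      using W(4) by simp
  qed
  ultimately show "add_tail C Xs (i + 1) \<noteq> add_tail C Xs i"
    by blast
qed

text \<open>
  The left approximation of \<open>Z\<close> is its largest quotient \<open>Z'\<close> that is cogenerated by the \<open>X\<^sub>k\<close> with
  \<open>k \<ge> i\<close>. Every endomorphism \<open>\<Sum> b a\<close> of \<open>Z\<close> that passes through objects \<open>X\<^sub>j\<close> induces an
  endomorphism of \<open>Z'\<close>, and since \<open>X\<^sub>j \<rightarrow> X\<^bsub>max i j\<^esub>\<close> is an approximation, the latter passes through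
  objects \<open>X\<^sub>k\<close> with \<open>k \<ge> i\<close>. For the identity of \<open>Z\<close> this shows that \<open>Z'\<close> lies in the subcategory.
\<close>

lemma ideal_tail_descends:
  assumes "1 \<le> i" and z: "z \<in> homs C Z Z'" and Z': "cogenerated (tail i) Z'"
    and z_fac: "\<And>M g. cogenerated (tail i) M \<Longrightarrow> g \<in> homs C Z M \<Longrightarrow> \<exists>h\<in>homs C Z' M. h \<cdot> z = g"
    and f: "ideal C (tail 1) Z Z f"
  shows "\<exists>f'. ideal C (tail i) Z' Z' f' \<and> f' \<cdot> z = z \<cdot> f"
  using f
proof (induction rule: ideal.induct)
  case zero
  have "Z' \<in> Obj C"
    using cogenerated_Obj[OF Z'] .
  then show ?case
    using ideal.zero[of Z' C Z' "tail i"] z zero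
    by (intro exI[of _ "Zero C Z' Z'"]) auto
next
  case (step W a b g)
  obtain j where j: "1 \<le> j" "W = Xs j"
    using step(1) unfolding tail_def by auto
  define k where "k = max i j"
  have k: "i \<le> k" "j \<le> k"
    by (simp_all add: k_def)
  have a: "a \<in> homs C Z (Xs j)" and b: "b \<in> homs C (Xs j) Z"
    using step(2,3) j by auto
  obtain p where p: "p \<in> homs C (Xs j) (Xs k)" "epic C p"
    and p_fac: "\<And>n h. k \<le> n \<Longrightarrow> h \<in> homs C (Xs j) (Xs n) \<Longrightarrow> \<exists>h'\<in>homs C (Xs k) (Xs n). h' \<cdot> p = h"
    using projection[OF j(1) k(2)] by blast
  have Xk: "Xs k \<in> Obj C" "Xs k \<in> tail i"
    using Xs_Obj k assms(1) by (auto simp: tail_def)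
  have "p \<cdot> a \<in> homs C Z (Xs k)"
    using p a by simp
  then obtain a' where a': "a' \<in> homs C Z' (Xs k)" "a' \<cdot> z = p \<cdot> a"
    using z_fac[OF cogenerated_member[OF Xk(2,1)]] by blast
  have zb: "z \<cdot> b \<in> homs C (Xs j) Z'"
    using z b by simp
  have "\<exists>b'\<in>homs C (Xs k) Z'. b' \<cdot> p = z \<cdot> b"
  proof (cases "i \<le> j")
    case True
    then have "k = j"
      by (simp add: k_def)
    then obtain t where t: "t \<in> homs C (Xs k) (Xs j)" "t \<cdot> p = Id C (Xs j)"
      using p_fac[of j "Id C (Xs j)"] Id_homs[OF Xk(1)] by auto
    have "((z \<cdot> b) \<cdot> t) \<cdot> p = (z \<cdot> b) \<cdot> (t \<cdot> p)"
      using z b t(1) p(1) by simp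
    also have "\<dots> = z \<cdot> b"
      unfolding t(2) using z b by simp
    finally show ?thesis
      using zb t(1) by (intro bexI[of _ "(z \<cdot> b) \<cdot> t"]) auto
  next
    case False
    then have "k = i"
      by (simp add: k_def)
    obtain N n where n: "is_kernel C n p" "n \<in> homs C N (Xs j)" "p \<cdot> n = Zero C N (Xs k)"
      using kernelE[OF p(1)] by metis
    have N: "N \<in> Obj C"
      using hom_Obj n(2) by blast
    have "(z \<cdot> b) \<cdot> n = Zero C N Z'"
    proof (rule cogenerated_zero[OF Z'])
      fix T h
      assume "T \<in> tail i" and h: "h \<in> homs C Z' T"
      then obtain m where m: "k \<le> m" "T = Xs m"
        unfolding tail_def \<open>k = i\<close> by auto
      have "h \<cdot> (z \<cdot> b) \<in> homs C (Xs j) (Xs m)"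
        using h zb m by simp
      then obtain h' where h': "h' \<in> homs C (Xs k) (Xs m)" "h' \<cdot> p = h \<cdot> (z \<cdot> b)"
        using p_fac[OF m(1)] by blast
      have "h \<cdot> ((z \<cdot> b) \<cdot> n) = (h' \<cdot> p) \<cdot> n"
        unfolding h'(2) using h z b n(2) by simp
      also have "\<dots> = h' \<cdot> (p \<cdot> n)"
        using h'(1) p(1) n(2) by simp
      also have "\<dots> = Zero C N T"
        unfolding n(3) using h'(1) N m(2) by simp
      finally show "h \<cdot> ((z \<cdot> b) \<cdot> n) = Zero C N T" .
    qed (use zb n in auto)
    then show ?thesis
      using is_cokernelD(3)[OF epic_cokernel_of_kernel[OF p(2,1) n(1)] n(2) zb] p(1) by simp
  qed
  then obtain b' where b': "b' \<in> homs C (Xs k) Z'" "b' \<cdot> p = z \<cdot> b"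
    by blast
  obtain g' where g': "ideal C (tail i) Z' Z' g'" "g' \<cdot> z = z \<cdot> g"
    using step.IH by blast
  have g'Z: "g' \<in> homs C Z' Z'" and gZ: "g \<in> homs C Z Z"
    using ideal_homs[OF g'(1)] ideal_homs[OF step(4)] .
  have "(b' \<cdot> a') \<cdot> z = b' \<cdot> (a' \<cdot> z)"
    using b' a' z by simp
  also have "\<dots> = (b' \<cdot> p) \<cdot> a"
    unfolding a'(2) using b'(1) p(1) a by simp
  also have "\<dots> = z \<cdot> (b \<cdot> a)"
    unfolding b'(2) using z b a by simp
  finally have ba: "(b' \<cdot> a') \<cdot> z = z \<cdot> (b \<cdot> a)" .
  have "Add C (b' \<cdot> a') g' \<cdot> z = Add C ((b' \<cdot> a') \<cdot> z) (g' \<cdot> z)"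
    using b'(1) a'(1) g'Z z by (intro Comp_Add(2)) auto
  also have "\<dots> = z \<cdot> Add C (b \<cdot> a) g"
    unfolding ba g'(2) using z a b gZ by (intro Comp_Add(1)[symmetric]) auto
  finally show ?case
    using ideal.step[OF Xk(2) a'(1) b'(1) g'(1)] j(2) by blast
qed

lemma left_rejective_add_tail:
  assumes "1 \<le> i"
  shows "left_rejective C (add_tail C Xs i) (add_tail C Xs 1)"
  unfolding left_rejective_def
proof (intro conjI ballI)
  show sub: "add_tail C Xs i \<subseteq> add_tail C Xs 1"
    using add_tail_iff[of 1] add_tail_iff[OF assms] ideal_mono tail_antimono[OF assms] by auto
  fix Z
  assume "Z \<in> add_tail C Xs 1"
  then have Z: "Z \<in> Obj C" "ideal C (tail 1) Z Z (Id C Z)"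
    using add_tail_iff[of 1] by auto
  obtain Z' where "reject_quotient C Z (tail i) Z'"
    using ex_reject_quotient[OF Z(1)] by blast
  then obtain z where z: "z \<in> homs C Z Z'" "epic C z" and Z': "cogenerated (tail i) Z'"
    and z_fac: "\<And>M g. cogenerated (tail i) M \<Longrightarrow> g \<in> homs C Z M \<Longrightarrow> \<exists>h\<in>homs C Z' M. h \<cdot> z = g"
    by (rule reject_quotientE) blast
  have Z'O: "Z' \<in> Obj C"
    using hom_Obj z(1) by blast
  obtain f where f: "ideal C (tail i) Z' Z' f" "f \<cdot> z = z \<cdot> Id C Z"
    using ideal_tail_descends[OF assms z(1) Z' z_fac Z(2)] by blast
  have "f \<cdot> z = Id C Z' \<cdot> z"
    using f(2) z(1) by simp
  then have "f = Id C Z'"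
    by (rule epic_cancel[OF z(2), rotated -1]) (use ideal_homs[OF f(1)] z Z'O in auto)
  then have member: "Z' \<in> add_tail C Xs i"
    using f(1) Z'O add_tail_iff[OF assms] by simp
  have "left_approximation C (add_tail C Xs i) Z z"
    unfolding left_approximation_def
  proof (intro conjI ballI)
    fix Y g
    assume "Y \<in> add_tail C Xs i" and g: "g \<in> homs C Z Y"
    then have "cogenerated (tail i) Y"
      using add_tail_iff[OF assms] cogenerated_ideal by blast
    then show "\<exists>h\<in>homs C (Cod C z) Y. h \<cdot> z = g"
      using z_fac[OF _ g] z(1) by simp
  qed (use z member in auto)
  moreover have "epic_in C (add_tail C Xs 1) z"
    unfolding epic_in_def
  proof (intro conjI ballI impI)
    show "Dom C z \<in> add_tail C Xs 1" "Cod C z \<in> add_tail C Xs 1"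
      using z(1) \<open>Z \<in> add_tail C Xs 1\<close> member sub by auto
    fix Y u v
    assume "u \<in> homs C (Cod C z) Y" "v \<in> homs C (Cod C z) Y" "u \<cdot> z = v \<cdot> z"
    then show "u = v"
      by (rule epic_cancel[OF z(2)])
  qed (use z in auto)
  ultimately show "\<exists>f. left_approximation C (add_tail C Xs i) Z f \<and> epic_in C (add_tail C Xs 1) f"
    by blast
qed

text \<open>
  \<open>Y\<close> is cogenerated by the \<open>X\<^sub>j\<close> with \<open>j \<ge> i\<close>, whose indecomposable summands have measure at most
  \<open>\<mu>(X\<^sub>j) \<le> \<mu>(X\<^sub>i)\<close>; the main property carries the bound over to \<open>Y\<close>.
\<close>

lemma mu_le_measure_at:
  assumes "1 \<le> i" "indecomposable C Y" "Y \<in> add_tail C Xs i"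
  shows "gr_le (mu Y) (measure_at i)"
proof -
  have Y: "Y \<in> Obj C" "ideal C (tail i) Y Y (Id C Y)"
    using add_tail_iff[OF assms(1)] assms(3) by auto
  have "cogenerated (tail i) Y"
    using cogenerated_ideal Y by blast
  then have "cogenerated {T. indecomposable C T \<and> gr_le (mu T) (measure_at i)} Y"
  proof (rule cogenerated_trans)
    fix T
    assume "T \<in> tail i"
    then obtain j where j: "i \<le> j" "T = Xs j"
      unfolding tail_def by auto
    have "gr_le (mu V) (measure_at i)" if "indecomposable C V" "gr_le (mu V) (measure_at j)" for V
      using gr_le_trans[OF mu_is_max(2)[OF that(1)] _ _ that(2) measure_antimono[OF assms(1) j(1)]]
        finite_measure_at j assms(1) by simp
    then have "{V. indecomposable C V \<and> gr_le (mu V) (measure_at j)} \<subseteq>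
        {V. indecomposable C V \<and> gr_le (mu V) (measure_at i)}"
      by blast
    moreover have "cogenerated {V. indecomposable C V \<and> gr_le (mu V) (measure_at j)} (Xs j)"
      using cogenerated_gr_measure Xs_Obj j(1) assms(1) by simp
    ultimately show "cogenerated {V. indecomposable C V \<and> gr_le (mu V) (measure_at i)} T"
      unfolding j(2) using cogenerated_mono by blast
  qed
  then show ?thesis
    using cogenerated_mu_le[OF assms(2) Id_homs[OF Y(1)] monic_Id[OF Y(1)]
        finite_measure_at[OF assms(1)]] by blast
qed

text \<open>
  Only the terms \<open>b a\<close> that pass through \<open>X\<^sub>i\<close> have to be changed: \<open>b : X\<^sub>i \<rightarrow> M\<close> kills the reject,
  since \<open>M\<close> is cogenerated by objects of measure below \<open>\<mu>(X\<^sub>i)\<close>, and so it factors through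
  \<open>X\<^bsub>i+1\<^esub>\<close>.
\<close>

lemma ideal_tail_Suc:
  assumes "1 \<le> i" "ideal C (tail i) Y M f" "cogenerated (small (measure_at i)) M"
  shows "ideal C (tail (Suc i)) Y M f"
  using assms(2)
proof (induction rule: ideal.induct)
  case zero
  then show ?case
    by (rule ideal.zero)
next
  case (step W a b g)
  show ?case
  proof (cases "W = Xs i")
    case False
    then have "W \<in> tail (Suc i)"
      using step(1) tail_Suc by blast
    then show ?thesis
      using step by (intro ideal.step)
  next
    case True
    obtain q where q: "q \<in> homs C (Xs i) (Xs (Suc i))"
      and q_fac: "\<And>M g. cogenerated (small (measure_at i)) M \<Longrightarrow> g \<in> homs C (Xs i) M \<Longrightarrow>
        \<exists>h\<in>homs C (Xs (Suc i)) M. h \<cdot> q = g"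
      using quotient_map[OF assms(1)] by metis
    obtain h where h: "h \<in> homs C (Xs (Suc i)) M" "h \<cdot> q = b"
      using q_fac[OF assms(3)] step(3) True by blast
    have "h \<cdot> (q \<cdot> a) = b \<cdot> a"
      by (rule Comp_reassoc[OF h(2)]) (use h q step(2) True in auto)
    moreover have "Xs (Suc i) \<in> tail (Suc i)" "q \<cdot> a \<in> homs C Y (Xs (Suc i))"
      using q step(2) True by (auto simp: tail_def)
    ultimately show ?thesis
      using ideal.step[of "Xs (Suc i)" "tail (Suc i)" "q \<cdot> a" C Y h M g] h(1) step.IH by simp
  qed
qed

text \<open>
  If \<open>\<mu>(Y) < \<mu>(X\<^sub>i)\<close>, then \<open>Y\<close> itself lies in the next subcategory. Otherwise every summand \<open>W\<close>
  of the image of a nonisomorphism \<open>f : Y \<rightarrow> Z\<close> has measure below \<open>\<mu>(X\<^sub>i)\<close>: if not, then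
  \<open>\<mu>(W) = \<mu>(Z) = \<mu>(Y)\<close>, so that \<open>W\<close>, \<open>Y\<close>, \<open>Z\<close> and the image all have the same length, and \<open>f\<close>
  is an isomorphism. Hence the image is cogenerated by objects of measure below \<open>\<mu>(X\<^sub>i)\<close>, and
  the epimorphism onto it lies in the ideal of the next subcategory.
\<close>

lemma nonisomorphism_factors:
  assumes i: "1 \<le> i" and Y: "indecomposable C Y" "Y \<in> add_tail C Xs i"
    and Z: "indecomposable C Z" "Z \<in> add_tail C Xs i"
    and f: "f \<in> homs C Y Z" "\<not> isomorphism C f"
  shows "\<exists>W\<in>add_tail C Xs (i + 1). factors_through C f W"
proof -
  note fin = mu_is_max(2)
  have YO: "Y \<in> Obj C" "ideal C (tail i) Y Y (Id C Y)"
    using add_tail_iff[OF i] Y(2) by auto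
  have "ideal C (tail (Suc i)) Y Z f"
  proof (cases "gr_less (mu Y) (measure_at i)")
    case True
    then have "cogenerated (small (measure_at i)) Y"
      using Y(1) YO(1) by (intro cogenerated_member) (auto simp: small_def)
    then have "ideal C (tail (Suc i)) Y Z (f \<cdot> Id C Y)"
      using ideal_Comp_left[OF ideal_tail_Suc[OF i YO(2)] f(1)] by blast
    then show ?thesis
      using f(1) by simp
  next
    case False
    then have mu_Y: "mu Y = measure_at i"
      using mu_le_measure_at[OF i Y] unfolding gr_le_def by blast
    obtain I m e where m: "m \<in> homs C I Z" "monic C m" and e: "e \<in> homs C Y I" "epic C e"
      and me: "m \<cdot> e = f"
      using image_factorization[OF f(1)] .
    have "I \<in> Obj C"
      using hom_Obj m(1) by blast
    then have "cogenerated (small (measure_at i)) I"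
    proof (rule cogenerated_indecomposable_retracts)
      fix W s r
      assume W: "indecomposable C W" and s: "s \<in> homs C W I" "r \<in> homs C I W" "r \<cdot> s = Id C W"
      have ms: "monic C (m \<cdot> s)" "m \<cdot> s \<in> homs C W Z"
        using monic_Comp[OF split_monic[OF s] m(2)] m(1) s(1) by auto
      have WZ: "gr_le (mu W) (mu Z)"
        using mu_monic[OF W Z(1) ms] .
      have ZX: "gr_le (mu Z) (measure_at i)"
        using mu_le_measure_at[OF i Z] .
      have "mu W \<noteq> measure_at i"
      proof
        assume "mu W = measure_at i"
        then have "mu Z = mu W"
          using gr_le_antisym[OF fin[OF W] fin[OF Z(1)] WZ] ZX by simp
        then have "lam W = lam Z" "lam Y = lam Z"
          using mu_eq_lam_eq[OF W Z(1)] mu_eq_lam_eq[OF Y(1) Z(1)] mu_Y \<open>mu W = measure_at i\<close>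
          by simp_all
        moreover have "lam W \<le> lam I" "lam I \<le> lam Z" "lam I \<le> lam Y"
          using lam_monic_le[OF split_monic[OF s] s(1)] lam_monic_le[OF m(2,1)]
            lam_epic_le[OF e(2,1)] by simp_all
        ultimately have "isomorphism C e" "lam Z \<le> lam Y"
          using epic_lam_eq_iso[OF e(2,1)] by auto
        then have "monic C f"
          using monic_Comp[OF isomorphism_monic[OF _ e(1)] m(2)] m(1) e(1) me by simp
        then have "isomorphism C f"
          using monic_lam_eq_iso[OF _ f(1)] \<open>lam Z \<le> lam Y\<close> by blast
        then show False
          using f(2) by blast
      qed
      moreover have "gr_le (mu W) (measure_at i)"
        using gr_le_trans[OF fin[OF W] fin[OF Z(1)] finite_measure_at[OF i] WZ ZX] .
      ultimately show "W \<in> small (measure_at i)"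
        using W unfolding small_def gr_le_def by blast
    qed
    moreover have "ideal C (tail i) Y I (e \<cdot> Id C Y)"
      using ideal_Comp_left[OF YO(2) e(1)] .
    ultimately have "ideal C (tail (Suc i)) Y I (e \<cdot> Id C Y)"
      using ideal_tail_Suc[OF i] by blast
    then have "ideal C (tail (Suc i)) Y Z (m \<cdot> (e \<cdot> Id C Y))"
      using ideal_Comp_left m(1) by blast
    then show ?thesis
      using e(1) me by simp
  qed
  then show ?thesis
    using ideal_tail_factors[of "Suc i"] by simp
qed

lemma rejective_chain: "left_complete_total_rejective_chain C len (add_tail C Xs)"
  unfolding left_complete_total_rejective_chain_def
proof (intro conjI ballI impI)
  show "\<And>i. i \<in> {1..len + 1} \<Longrightarrow> subcategory C (add_tail C Xs i)"
    using subcategory_add_tail by simp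
  show "add_tail C Xs (len + 1) = {Z. zero_object C Z}"
    by (rule add_tail_zero)
  show "\<And>i. i \<in> {1..len} \<Longrightarrow> add_tail C Xs (i + 1) \<subset> add_tail C Xs i"
    using add_tail_psubset by simp
  show "\<And>i. i \<in> {1..len} \<Longrightarrow> left_rejective C (add_tail C Xs i) (add_tail C Xs 1)"
    using left_rejective_add_tail by simp
  show "\<exists>W\<in>add_tail C Xs (i + 1). factors_through C f W"
    if "i \<in> {1..len}" "Y \<in> add_tail C Xs i" "Z \<in> add_tail C Xs i" "f \<in> homs C Y Z"
      "indecomposable C Y \<and> indecomposable C Z \<and> \<not> isomorphism C f" for i Y Z f
    using nonisomorphism_factors[of i Y Z f] that by (auto simp del: homs_iff)
qed

end

lemma (in length_category) ex_gr_reject_sequence: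
  assumes "X \<in> Obj C"
  shows "\<exists>Xs. gr_reject_sequence C lam R X Xs"
proof -
  define step where "step Y = (SOME Q. reject_quotient C Y (gr_below C lam R (gr_measure C lam Y)) Q)" for Y
  have step: "reject_quotient C Y (gr_below C lam R (gr_measure C lam Y)) (step Y)" if "Y \<in> Obj C" for Y
    using someI_ex[OF ex_reject_quotient[OF that]] unfolding step_def by blast
  have Obj: "step Y \<in> Obj C" if "Y \<in> Obj C" for Y
    using reject_quotientE[OF step[OF that]] hom_Obj by metis
  \<comment> \<open>Starting the iteration at index 1; the truncated \<open>0 - 1\<close> makes the entry at 0 equal to \<open>X\<close>.\<close>
  define Xs where "Xs i = (step ^^ (i - 1)) X" for i
  have "(step ^^ i) X \<in> Obj C" for i
    using assms Obj by (induction i) auto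
  moreover have "Xs (i + 1) = step (Xs i)" if "1 \<le> i" for i
    using that by (cases i) (auto simp: Xs_def)
  ultimately have "gr_reject_sequence C lam R X Xs"
    unfolding gr_reject_sequence_def using step by (auto simp: Xs_def)
  then show ?thesis
    by blast
qed

theorem proposition4p6:
  fixes A :: "('o, 'm) additive_cat"
    and lam :: "'o \<Rightarrow> real"
    and indA :: "'o set"
    and X :: 'o
  assumes "abelian_length_category A"
    and "length_function A lam"
    and "ind_representatives A indA"
    and "X \<in> Obj A"
  shows "(\<exists>Xs. gr_reject_sequence A lam indA X Xs) \<and>
    (\<forall>Xs. gr_reject_sequence A lam indA X Xs \<longrightarrow>
      (\<exists>l. zero_object A (Xs (l + 1))) \<and>
      left_complete_total_rejective_chain A
        (LEAST l. zero_object A (Xs (l + 1))) (add_tail A Xs))"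
proof (intro conjI allI impI)
  interpret length_category A lam
    using assms(1,2) by (simp add: length_category_def length_category_axioms_def)
  show "\<exists>Xs. gr_reject_sequence A lam indA X Xs"
    using ex_gr_reject_sequence[OF assms(4)] .
  fix Xs
  assume Xs: "gr_reject_sequence A lam indA X Xs"
  interpret gr_sequence A lam indA Xs
    by unfold_locales (use assms(3,4) Xs in \<open>auto simp: gr_reject_sequence_def\<close>)
  show "\<exists>l. zero_object A (Xs (l + 1))"
    by (rule ex_zero)
  show "left_complete_total_rejective_chain A (LEAST l. zero_object A (Xs (l + 1))) (add_tail A Xs)"
    using rejective_chain unfolding len_def .
qed

end
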